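(* Let $d\ge 1$ and let $\mu$ be a probability measure on $\mathbb{R}^d$ that has a density $f$ with respect to Lebesgue measure. Let $X_1,X_2,\ldots$ be i.i.d. random vectors with distribution $\mu$, and for each $n$ let $S_1$ be the Voronoi cell of $X_1$ in the Voronoi partition defined by $X_1,\ldots,X_n$. Then, for $\mu$-almost all $x$, conditionally on the event $X_1=x$, the random variable $n\mu(S_1)$ converges in distribution, as $n\to\infty$, to $Z$, where $Z$ is the non-negative random variable whose moments are $$\mathbb{E}[Z^k]=\mathbb{E}\left[\frac{k!}{W_k^k}\right]\qquad\text{for all integers } k\ge 1,$$ with $W_k$ as defined in the context (so that the law of $Z$ depends only on $d$).
   Context: $\|\cdot\|$ is the Euclidean norm on $\mathbb{R}^d$, $\lambda$ is Lebesgue measure on $\mathbb{R}^d$, and $B_{x,r}$ is the closed ball of radius $r$ centered at $x$. Voronoi partition: given $X_1,\ldots,X_n$, the cell $S_i$ consists of all points of $\mathbb{R}^d$ whose nearest neighbor among $X_1,\ldots,X_n$ is $X_i$, ties being broken in favor of smaller indices. In particular $S_1=\{y\in\mathbb{R}^d:\|y-X_1\|\le\|y-X_j\| \text{ for all } j=2,\ldots,n\}$; it depends on $n$. Conditioning on $X_1=x$ means that $X_1$ is replaced by the fixed point $x$ while $X_2,\ldots,X_n$ remain i.i.d. with distribution $\mu$. Definition of $W_k$: let $\overline{1}=(1,0,\ldots,0)\in\mathbb{R}^d$ and, for each integer $k\ge1$, let $Y_1,\ldots,Y_{k-1}$ be independent random vectors uniformly distributed in $B_{0,1}$; set $$W_k=\frac{\lambda\left(B_{\overline{1},1}\cup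 B_{Y_1,\|Y_1\|}\cup\cdots\cup B_{Y_{k-1},\|Y_{k-1}\|}\right)}{\lambda(B_{0,1})}$$ (so $W_1=1$). The law of a non-negative random variable $Z$ with the moments $\mathbb{E}[k!/W_k^k]$, $k\ge 1$, is uniquely determined by these moments (Carleman's condition). *)

theory Defs
  imports "HOL-Probability.Probability"
begin

text \<open>The cell of the point with index \<open>i\<close> in the Voronoi partition defined by
  \<open>X 1, \<dots>, X n\<close>; a point equidistant from several nearest \<open>X j\<close> goes to the smallest index.\<close>

definition voronoi_cell :: "nat \<Rightarrow> (nat \<Rightarrow> real^'d) \<Rightarrow> nat \<Rightarrow> (real^'d) set" where
  "voronoi_cell n X i =
     {y. (\<forall>j\<in>{1..n}. norm (y - X i) \<le> norm (y - X j)) \<and>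
         (\<forall>j\<in>{1..<i}. norm (y - X i) < norm (y - X j))}"

text \<open>Coordinates are indexed by an arbitrary finite type, which has no distinguished first
  element. The vector \<open>(1,0,\<dots>,0)\<close> is therefore \<open>axis i 1\<close> for a parameter \<open>i\<close>, which plays
  the role of the first coordinate.\<close>

definition W :: "'d::finite \<Rightarrow> nat \<Rightarrow> (nat \<Rightarrow> real^'d) \<Rightarrow> real" where
  "W i k Y =
     measure lborel (cball (axis i 1) 1 \<union> (\<Union>j\<in>{1..<k}. cball (Y j) (norm (Y j)))) /
     measure lborel (cball (0 :: real^'d) 1)"

text \<open>The joint law of independent \<open>Y 1, \<dots>, Y (k - 1)\<close>, each uniform on the unit ball.\<close>

definition unit_ball_sample :: "nat \<Rightarrow> (nat \<Rightarrow> real^'d) measure" where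
  "unit_ball_sample k = (\<Pi>\<^sub>M j\<in>{1..<k}. uniform_measure lborel (cball 0 1))"

text \<open>\<open>\<nu>\<close> is the law of a non-negative random variable \<open>Z\<close> with moments \<open>E[k! / W\<^sub>k^k]\<close>. Integrability
  is required because the Bochner integral of a non-integrable function is \<open>0\<close>.\<close>

definition has_W_moments :: "'d::finite \<Rightarrow> real measure \<Rightarrow> bool" where
  "has_W_moments i \<nu> \<longleftrightarrow>
     real_distribution \<nu> \<and> (AE z in \<nu>. 0 \<le> z) \<and>
     (\<forall>k\<ge>1. integrable \<nu> (\<lambda>z. z ^ k) \<and>
        (\<integral>z. z ^ k \<partial>\<nu>) = (\<integral>Y. fact k / W i k Y ^ k \<partial>unit_ball_sample k))"

end

theory Submission
  imports Defs
begin

text \<open>Fix a Lebesgue point \<open>x\<close> of \<open>f\<close> with \<open>f x > 0\<close>; \<open>\<mu>\<close>-almost every \<open>x\<close> is one. The \<open>k\<close>-th power of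
  \<open>\<mu> S\<close> is the probability that \<open>k\<close> further independent points \<open>y i\<close> fall into the cell \<open>S\<close>, that is,
  that none of the \<open>n - 1\<close> other sample points lies in the union of the balls around \<open>y i\<close> reaching
  \<open>x\<close>. Hence \<open>E (n * \<mu> S) ^ k = n ^ k * E (1 - \<mu> U) ^ (n - 1)\<close> with \<open>U\<close> this union. Rescaling
  \<open>y = x + n powr (-1/d) * u\<close>, the density becomes the constant \<open>c = f x\<close> in the limit, and the moment
  tends to the integral of \<open>c ^ k * exp (- c * vol U)\<close>. In polar form with respect to the farthest
  of the points \<open>u\<close>, this integral is \<open>k * (k - 1)! * E (1 / W k ^ k)\<close>. The limit moments are at most
  \<open>k!\<close>, so they determine the law, and tightness turns convergence of moments into weak
  convergence and also provides the limit law.\<close>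

subsection \<open>The method of moments\<close>

text \<open>The obstacle is the passage to the limit under the integral: f is controlled only near
  x, so after rescaling no integrable majorant is at hand far out. The bound is therefore sought in
  terms of \<open>\<mu>\<close> itself. Let F y be the mass of the ball around x through y. Whatever
  f does away from x, the set where F is at most t has mass at most t, and the ball around y through
  x has mass at least b * F y, with b > 0 depending on x. Together these bound the part of the
  moment where some n * F (y i) is at least m by the tail of a convergent series, uniformly in n.

  On bounded regions the integrand contains a product of k rescaled densities. Lebesgue points are
  therefore taken in the L1 sense, since convergence of ball averages of f would not control such
  products. The bound k! on the limit moments comes from W k being at least 1: its first ball alone
  has the volume of the unit ball. The limit is free of c because a gamma integral cancels c ^
  k.\<close>

lemma summable_fact_shift_ratio:
  "summable (\<lambda>j. (1/2::real) ^ j * (fact (k + j) / fact j))"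
proof (rule summable_ratio_test[where c = "3/4" and N = "2 * k"])
  fix n :: nat assume n: "2 * k \<le> n"
  \<comment> \<open>The quotient of consecutive terms is half of this fraction. From n = 2 * k on
    the fraction is at most 3/2, hence the ratio constant 3/4.\<close>
  have "real (k + n + 1) / real (n + 1) \<le> 3/2"
    using n by (simp add: field_simps)
  then have "1/2 * (real (k + n + 1) / real (n + 1)) \<le> 3/4"
    by linarith
  then have "((1/2) ^ n * (fact (k + n) / fact n)) * (1/2 * (real (k + n + 1) / real (n + 1)))
      \<le> ((1/2::real) ^ n * (fact (k + n) / fact n)) * (3/4)"
    by (rule mult_left_mono) simp
  moreover have "(1/2::real) ^ Suc n * (fact (k + Suc n) / fact (Suc n)) =
      ((1/2) ^ n * (fact (k + n) / fact n)) * (1/2 * (real (k + n + 1) / real (n + 1)))"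
    by (simp add: field_simps)
  ultimately show "norm ((1/2::real) ^ Suc n * (fact (k + Suc n) / fact (Suc n)))
      \<le> 3/4 * norm ((1/2::real) ^ n * (fact (k + n) / fact n))"
    by (simp only: real_norm_def abs_of_nonneg zero_le_mult_iff) (simp add: abs_of_nonneg)
qed simp

text \<open>The exponential of \<open>\<i> * h * x\<close> is expanded and integrated term by term;
  the norm of the j-th term is at most (1/2)^j * (k + j)! / j!, which is summable. Keeping a general
  weight x^k leaves only integrals of the same kind at t on the right, so agreement of all of them
  at t passes to t + h.\<close>

lemma (in real_distribution) weighted_char_expansion:
  fixes t h :: real
  assumes int: "\<And>k. integrable M (\<lambda>x. \<bar>x\<bar> ^ k)"
    and le: "\<And>k. (\<integral>x. \<bar>x\<bar> ^ k \<partial>M) \<le> fact k"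
    and h: "\<bar>h\<bar> \<le> 1/2"
  shows "(CLINT x|M. of_real x ^ k * iexp ((t + h) * x)) =
    (\<Sum>j. (\<i> * h) ^ j / fact j * (CLINT x|M. of_real x ^ (k + j) * iexp (t * x)))"
proof -
  define f where "f j x = (\<i> * h) ^ j / fact j * (of_real x ^ (k + j) * iexp (t * x))" for j x
  have norm_f: "norm (f j x) = \<bar>h\<bar> ^ j / fact j * \<bar>x\<bar> ^ (k + j)" for j x
    by (simp add: f_def norm_mult norm_power norm_divide)
  have [measurable]: "f j \<in> borel_measurable M" for j
    unfolding f_def by measurable
  have int_f: "integrable M (f j)" for j
    by (rule Bochner_Integration.integrable_bound[where f = "\<lambda>x. \<bar>h\<bar> ^ j / fact j * \<bar>x\<bar> ^ (k + j)"])
      (use int in \<open>auto simp: norm_f abs_mult\<close>)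
  have sums_f: "(\<lambda>j. f j x) sums (of_real x ^ k * iexp ((t + h) * x))" for x
  proof -
    have "(\<lambda>j. of_real x ^ k * iexp (t * x) * ((\<i> * h * x) ^ j /\<^sub>R fact j)) sums
        (of_real x ^ k * iexp (t * x) * exp (\<i> * h * x))"
      by (intro sums_mult exp_converges)
    moreover have "of_real x ^ k * iexp (t * x) * ((\<i> * h * x) ^ j /\<^sub>R fact j) = f j x" for j
      by (simp add: f_def power_add power_mult_distrib scaleR_conv_of_real field_simps)
    moreover have "iexp (t * x) * exp (\<i> * h * x) = iexp ((t + h) * x)"
      by (simp add: exp_add[symmetric] algebra_simps)
    ultimately show ?thesis by (simp add: mult.assoc)
  qed
  have "(CLINT x|M. (\<Sum>j. f j x)) = (\<Sum>j. CLINT x|M. f j x)"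
  proof (rule integral_suminf[OF int_f])
    show "AE x in M. summable (\<lambda>j. norm (f j x))"
    proof (rule AE_I2)
      fix x
      have "summable (\<lambda>j. \<bar>x\<bar> ^ k * ((\<bar>h\<bar> * \<bar>x\<bar>) ^ j /\<^sub>R fact j))"
        by (intro summable_mult summable_exp_generic)
      then show "summable (\<lambda>j. norm (f j x))"
        by (simp add: norm_f power_add power_mult_distrib field_simps)
    qed
    show "summable (\<lambda>j. \<integral>x. norm (f j x) \<partial>M)"
    proof (rule summable_comparison_test'[OF summable_fact_shift_ratio[of k]])
      fix j :: nat
      have "(\<integral>x. norm (f j x) \<partial>M) = \<bar>h\<bar> ^ j / fact j * (\<integral>x. \<bar>x\<bar> ^ (k + j) \<partial>M)"
        by (simp add: norm_f)
      also have "\<dots> \<le> (1/2) ^ j / fact j * fact (k + j)"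
        using h by (intro mult_mono divide_right_mono power_mono le) auto
      finally show "norm (\<integral>x. norm (f j x) \<partial>M) \<le> (1/2) ^ j * (fact (k + j) / fact j)"
        by simp
    qed
  qed
  moreover have "(CLINT x|M. f j x) =
      (\<i> * h) ^ j / fact j * (CLINT x|M. of_real x ^ (k + j) * iexp (t * x))" for j
    unfolding f_def by simp
  moreover have "(\<Sum>j. f j x) = of_real x ^ k * iexp ((t + h) * x)" for x
    using sums_f[of x] by (simp add: sums_iff)
  ultimately show ?thesis by simp
qed

text \<open>The moments are the derivatives of the characteristic function at the origin; its Taylor
  expansions have radius of convergence at least 1 everywhere, which allows a continuation in
  steps of length 1/2.\<close>

lemma moments_determine_distribution:
  assumes M1: "real_distribution M1" and M2: "real_distribution M2"
    and int1: "\<And>k. integrable M1 (\<lambda>x. \<bar>x\<bar> ^ k)" and int2: "\<And>k. integrable M2 (\<lambda>x. \<bar>x\<bar> ^ k)"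
    and le1: "\<And>k. (\<integral>x. \<bar>x\<bar> ^ k \<partial>M1) \<le> fact k" and le2: "\<And>k. (\<integral>x. \<bar>x\<bar> ^ k \<partial>M2) \<le> fact k"
    and eq: "\<And>k. (\<integral>x. x ^ k \<partial>M1) = (\<integral>x. x ^ k \<partial>M2)"
  shows "M1 = M2"
proof -
  have claim: "\<bar>t\<bar> \<le> real n / 2 \<Longrightarrow> (CLINT x|M1. of_real x ^ k * iexp (t * x)) =
      (CLINT x|M2. of_real x ^ k * iexp (t * x))" for n k t
  proof (induction n arbitrary: k t)
    case 0
    then have "t = 0" by simp
    then show ?case
      using eq[of k] by (simp flip: of_real_power add: integral_complex_of_real)
  next
    case (Suc n)
    \<comment> \<open>Cutting \<open>t\<close> into n + 1 equal parts treats both signs at once: one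
      part has length at most 1/2, and the other n parts end where the induction hypothesis applies.
      That hypothesis must cover all weights, because the expansion at \<open>s\<close> involves
      every order from \<open>k\<close> on.\<close>
    define h where "h = t / real (Suc n)"
    define s where "s = t - h"
    have h: "\<bar>h\<bar> \<le> 1/2"
      using Suc.prems by (simp add: h_def field_simps)
    have s_eq: "s = h * real n" by (simp add: s_def h_def field_simps)
    have s: "\<bar>s\<bar> \<le> real n / 2"
      using mult_right_mono[OF h, of "real n"] by (simp add: s_eq abs_mult)
    have t: "t = s + h" by (simp add: s_def)
    show ?case
      unfolding t real_distribution.weighted_char_expansion[OF M1 int1 le1 h]
        real_distribution.weighted_char_expansion[OF M2 int2 le2 h] Suc.IH[OF s] ..
  qed
  have "char M1 t = char M2 t" for t
  proof -
    obtain n where "2 * \<bar>t\<bar> \<le> real n" using real_arch_simple by blast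
    then show ?thesis using claim[of t n 0] by (simp add: char_def)
  qed
  then show ?thesis by (intro Levy_uniqueness M1 M2) auto
qed

text \<open>Powers are unbounded, so weak convergence does not apply to them directly; clipped to
  [0, R] they become bounded and continuous. Where z exceeds R, z^k is at most z^(2k) / R^k, so a
  higher moment controls the clipping error.\<close>

lemma (in real_distribution) truncated_moment:
  fixes R :: real
  assumes R: "0 < R" and nn: "AE z in M. 0 \<le> z"
    and int: "integrable M (\<lambda>z. z ^ k)" "integrable M (\<lambda>z. z ^ (2 * k))"
  shows "(\<integral>z. max 0 (min z R) ^ k \<partial>M) \<le> (\<integral>z. z ^ k \<partial>M)"
    and "(\<integral>z. z ^ k \<partial>M) - (\<integral>z. z ^ (2 * k) \<partial>M) / R ^ k \<le> (\<integral>z. max 0 (min z R) ^ k \<partial>M)"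
proof -
  have bdd: "norm (max 0 (min z R) ^ k) \<le> R ^ k" for z
    using R by (simp add: power_mono)
  have int': "integrable M (\<lambda>z. max 0 (min z R) ^ k)"
    by (rule integrable_const_bound[of _ "R ^ k"]) (use bdd in auto)
  show "(\<integral>z. max 0 (min z R) ^ k \<partial>M) \<le> (\<integral>z. z ^ k \<partial>M)"
    using nn R by (intro integral_mono_AE int int') (auto elim!: eventually_mono intro!: power_mono)
  have "z ^ k \<le> max 0 (min z R) ^ k + z ^ (2 * k) / R ^ k" if "0 \<le> z" for z
  proof (cases "z \<le> R")
    case False
    then have "R ^ k \<le> z ^ k" using R by (intro power_mono) auto
    then have "z ^ k * R ^ k \<le> z ^ k * z ^ k" using that by (intro mult_left_mono) auto
    then have "z ^ k \<le> z ^ (2 * k) / R ^ k"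
      using R by (simp add: pos_le_divide_eq mult_2 power_add)
    then show ?thesis using R by (simp add: add_increasing)
  qed (use that R in auto)
  then have "(\<integral>z. z ^ k \<partial>M) \<le> (\<integral>z. max 0 (min z R) ^ k + z ^ (2 * k) / R ^ k \<partial>M)"
    using nn by (intro integral_mono_AE int Bochner_Integration.integrable_add int')
      (auto elim!: eventually_mono intro!: int)
  also have "\<dots> = (\<integral>z. max 0 (min z R) ^ k \<partial>M) + (\<integral>z. z ^ (2 * k) \<partial>M) / R ^ k"
    using int int' by simp
  finally show "(\<integral>z. z ^ k \<partial>M) - (\<integral>z. z ^ (2 * k) \<partial>M) / R ^ k \<le> (\<integral>z. max 0 (min z R) ^ k \<partial>M)"
    by simp
qed

text \<open>Clipped moments pass to the weak limit. Since the moments of order k and 2k converge,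
  the clipped moment of \<open>\<nu>\<close> lies between m k - m (2k) / R^k and m k. Letting R
  grow, monotone convergence yields both integrability and the exact value.\<close>

lemma moments_of_weak_limit:
  fixes m :: "nat \<Rightarrow> real"
  assumes D: "\<And>n. real_distribution (D n)" and nn: "\<And>n. AE z in D n. 0 \<le> z"
    and int: "\<And>n k. integrable (D n) (\<lambda>z. z ^ k)"
    and lim: "\<And>k. (\<lambda>n. \<integral>z. z ^ k \<partial>D n) \<longlonglongrightarrow> m k"
    and \<nu>: "real_distribution \<nu>" and weak: "weak_conv_m D \<nu>"
  shows "AE z in \<nu>. 0 \<le> z" "integrable \<nu> (\<lambda>z. z ^ k)" "(\<integral>z. z ^ k \<partial>\<nu>) = m k"
proof -
  interpret \<nu>: real_distribution \<nu> by fact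
  have conv: "(\<lambda>n. \<integral>z. g z \<partial>D n) \<longlonglongrightarrow> (\<integral>z. g z \<partial>\<nu>)"
    if "continuous_on UNIV g" "\<And>z. norm (g z) \<le> B" for g :: "real \<Rightarrow> real" and B
    using weak_conv_imp_integral_bdd_continuous_conv[OF D \<nu> weak, of g B] that
    by (simp add: continuous_on_eq_continuous_at)
  show nn_\<nu>: "AE z in \<nu>. 0 \<le> z"
  proof -
    \<comment> \<open>The negative part, capped at 1: a bounded continuous function that vanishes
      exactly on the nonnegative half-line.\<close>
    define g where "g z = max 0 (min (- z) (1::real))" for z
    have [measurable]: "g \<in> borel_measurable borel"
      unfolding g_def by measurable
    have "(\<lambda>n. \<integral>z. g z \<partial>D n) \<longlonglongrightarrow> (\<integral>z. g z \<partial>\<nu>)"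
      by (rule conv[of _ 1]) (auto simp: g_def intro!: continuous_intros)
    moreover have "(\<integral>z. g z \<partial>D n) = 0" for n
      using nn[of n] by (intro integral_eq_zero_AE) (auto simp: g_def elim!: eventually_mono)
    ultimately have "(\<integral>z. g z \<partial>\<nu>) = 0"
      by (simp add: LIMSEQ_const_iff)
    moreover have "integrable \<nu> g"
      by (rule \<nu>.integrable_const_bound[of _ 1]) (auto simp: g_def)
    ultimately have "AE z in \<nu>. g z = 0"
      by (subst (asm) integral_nonneg_eq_0_iff_AE) (auto simp: g_def)
    then show ?thesis by eventually_elim (auto simp: g_def max_def min_def split: if_splits)
  qed
  define g where "g R z = max 0 (min z R) ^ k" for R z :: real
  have [measurable]: "g R \<in> borel_measurable borel" for R
    unfolding g_def by measurable
  have g_conv: "(\<lambda>n. \<integral>z. g R z \<partial>D n) \<longlonglongrightarrow> (\<integral>z. g R z \<partial>\<nu>)" if "0 < R" for R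
    by (rule conv[of _ "R ^ k"]) (use that in \<open>auto simp: g_def intro!: continuous_intros power_mono\<close>)
  have D_trunc: "(\<integral>z. g R z \<partial>D n) \<le> (\<integral>z. z ^ k \<partial>D n)"
    "(\<integral>z. z ^ k \<partial>D n) - (\<integral>z. z ^ (2 * k) \<partial>D n) / R ^ k \<le> (\<integral>z. g R z \<partial>D n)" if "0 < R" for R n
    unfolding g_def
    by (rule real_distribution.truncated_moment[OF D that nn int int])+
  have upper: "(\<integral>z. g R z \<partial>\<nu>) \<le> m k" if "0 < R" for R
    using g_conv[OF that] lim[of k] D_trunc(1)[OF that] by (intro LIMSEQ_le) auto
  have lower: "m k - m (2 * k) / R ^ k \<le> (\<integral>z. g R z \<partial>\<nu>)" if "0 < R" for R
    using g_conv[OF that] D_trunc(2)[OF that]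
    by (intro LIMSEQ_le[OF tendsto_diff[OF lim[of k] tendsto_divide[OF lim[of "2 * k"] tendsto_const]]])
      (use that in auto)
  have int_g: "integrable \<nu> (g R)" if "0 < R" for R
    by (rule \<nu>.integrable_const_bound[of _ "R ^ k"])
      (use that in \<open>auto simp: g_def intro!: power_mono\<close>)
  have g_lim: "(\<lambda>r. g (real (Suc r)) z) \<longlonglongrightarrow> z ^ k" if "0 \<le> z" for z
  proof -
    obtain r0 where "z \<le> real r0" using real_arch_simple by blast
    then have "\<forall>\<^sub>F r in sequentially. g (real (Suc r)) z = z ^ k"
      using that unfolding eventually_sequentially by (intro exI[of _ r0]) (auto simp: g_def)
    then show ?thesis by (rule tendsto_eventually)
  qed
  have g_mono: "g (real (Suc r)) z \<le> g (real (Suc r')) z" if "r \<le> r'" for r r' z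
    unfolding g_def using that by (intro power_mono) auto
  have bdd: "Bseq (\<lambda>r. \<integral>z. g (real (Suc r)) z \<partial>\<nu>)"
    by (intro BseqI'[of _ "m k"]) (use upper in \<open>auto simp: g_def\<close>)
  have mono: "incseq (\<lambda>r. \<integral>z. g (real (Suc r)) z \<partial>\<nu>)"
    by (intro monoI integral_mono int_g g_mono) auto
  obtain L where L: "(\<lambda>r. \<integral>z. g (real (Suc r)) z \<partial>\<nu>) \<longlonglongrightarrow> L"
    using Bseq_mono_convergent[OF bdd] mono unfolding incseq_def convergent_def by blast
  have "has_bochner_integral \<nu> (\<lambda>z. z ^ k) L"
  proof (rule has_bochner_integral_monotone_convergence[OF _ _ _ L])
    show "AE z in \<nu>. mono (\<lambda>r. g (real (Suc r)) z)"
      using g_mono by (auto simp: mono_def)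
    show "AE z in \<nu>. (\<lambda>r. g (real (Suc r)) z) \<longlonglongrightarrow> z ^ k"
      using nn_\<nu> g_lim by (auto elim!: eventually_mono)
  qed (auto intro: int_g)
  moreover have "L = m k"
  \<comment> \<open>For k = 0 the error m 0 / R^0 does not tend to 0 as R grows; the total mass 1
    settles this case.\<close>
  proof (cases "k = 0")
    case True
    have "(\<integral>z. g (real (Suc r)) z \<partial>\<nu>) = 1" for r
      using True \<nu>.prob_space by (simp add: g_def)
    with L have "L = 1" by (simp add: LIMSEQ_const_iff)
    moreover have "(\<integral>z. z ^ k \<partial>D n) = 1" for n
      using True D[of n] by (simp add: prob_space.prob_space real_distribution_def)
    then have "m k = 1" using lim[of k] by (simp add: LIMSEQ_const_iff)
    ultimately show ?thesis by simp
  next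
    case False
    have "filterlim (\<lambda>r. real (Suc r) ^ k) at_top sequentially"
      using False by (intro filterlim_pow_at_top filterlim_compose[OF filterlim_real_sequentially filterlim_Suc]) auto
    then have "(\<lambda>r. m (2 * k) / real (Suc r) ^ k) \<longlonglongrightarrow> 0"
      by (rule tendsto_divide_0[OF tendsto_const filterlim_at_top_imp_at_infinity])
    from tendsto_diff[OF tendsto_const[of "m k"] this]
    have "(\<lambda>r. m k - m (2 * k) / real (Suc r) ^ k) \<longlonglongrightarrow> m k" by simp
    from LIMSEQ_le[OF this L] lower have "m k \<le> L" by auto
    moreover have "L \<le> m k"
      by (rule LIMSEQ_le_const2[OF L]) (use upper in auto)
    ultimately show ?thesis by simp
  qed
  ultimately show "integrable \<nu> (\<lambda>z. z ^ k)" "(\<integral>z. z ^ k \<partial>\<nu>) = m k"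
    by (auto simp: has_bochner_integral_iff)
qed

text \<open>The means are bounded because they converge, and Markov's inequality turns a bound K
  into an upper tail of at most K / b, which is \<epsilon> / 2 for the chosen b. On the left any
  negative end point loses no mass.\<close>

lemma tight_if_moments_converge:
  assumes D: "\<And>n. real_distribution (D n)" and nn: "\<And>n. AE z in D n. 0 \<le> z"
    and int: "\<And>n. integrable (D n) (\<lambda>z. z)"
    and lim: "(\<lambda>n. \<integral>z. z \<partial>D n) \<longlonglongrightarrow> m"
  shows "tight D"
  unfolding tight_def
proof (intro conjI allI impI D)
  fix \<epsilon> :: real assume \<epsilon>: "0 < \<epsilon>"
  from lim have "Bseq (\<lambda>n. \<integral>z. z \<partial>D n)"
    by (intro convergent_imp_Bseq) (auto simp: convergent_def)
  then obtain K where K: "0 < K" "\<And>n. norm (\<integral>z. z \<partial>D n) \<le> K"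
    unfolding Bseq_def by blast
  define b where "b = 2 * K / \<epsilon>"
  have b: "0 < b" using K \<epsilon> by (simp add: b_def)
  have "1 - \<epsilon> < measure (D n) {-1<..b}" for n
  proof -
    interpret real_distribution "D n" by fact
    have "prob {z \<in> space (D n). z \<ge> b} \<le> (\<integral>z. z \<partial>D n) / b"
      using integral_Markov_inequality_measure[OF int, of "{}" n b] nn[of n] b by simp
    also have "\<dots> \<le> K / b" using K(2)[of n] b by (intro divide_right_mono) auto
    also have "\<dots> < \<epsilon>" using K \<epsilon> by (simp add: b_def)
    finally have "prob {b..} < \<epsilon>" by (simp add: atLeast_def)
    moreover have "1 \<le> prob {-1<..b} + prob {b..}"
    proof -
      have "1 = prob ({-1<..b} \<union> {b..})"
        using nn[of n] by (subst eq_commute, subst prob_eq_1) (auto elim!: eventually_mono)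
      also have "\<dots> \<le> prob {-1<..b} + prob {b..}"
        by (intro measure_Un_le) auto
      finally show ?thesis .
    qed
    ultimately show ?thesis by simp
  qed
  then show "\<exists>a b. a < b \<and> (\<forall>n. 1 - \<epsilon> < measure (D n) {a<..b})"
    using b by (intro exI[of _ "-1"] exI[of _ b]) auto
qed

lemma AE_nonneg_abs_moment:
  assumes "AE z in (\<nu> :: real measure). 0 \<le> z" and [measurable_cong]: "sets \<nu> = sets borel"
  shows "integrable \<nu> (\<lambda>z. \<bar>z\<bar> ^ k) \<longleftrightarrow> integrable \<nu> (\<lambda>z. z ^ k)"
    and "(\<integral>z. \<bar>z\<bar> ^ k \<partial>\<nu>) = (\<integral>z. z ^ k \<partial>\<nu>)"
  by (intro integrable_cong_AE integral_cong_AE; use assms(1) in \<open>auto elim!: eventually_mono\<close>)+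

text \<open>By tightness there are weak limits along subsequences. Each of them inherits the moments
  m, and the growth bound k! forces them all to coincide, so the whole sequence converges. The law
  \<open>\<nu>\<close> comes out of compactness; no law with these moments has to be exhibited
  beforehand.\<close>

theorem method_of_moments:
  fixes m :: "nat \<Rightarrow> real"
  assumes D: "\<And>n. real_distribution (D n)" and nn: "\<And>n. AE z in D n. 0 \<le> z"
    and int: "\<And>n k. integrable (D n) (\<lambda>z. z ^ k)"
    and lim: "\<And>k. (\<lambda>n. \<integral>z. z ^ k \<partial>D n) \<longlonglongrightarrow> m k"
    and m: "\<And>k. m k \<le> fact k"
  obtains \<nu> where "real_distribution \<nu>" "AE z in \<nu>. 0 \<le> z" "\<And>k. integrable \<nu> (\<lambda>z. z ^ k)"
    "\<And>k. (\<integral>z. z ^ k \<partial>\<nu>) = m k" "weak_conv_m D \<nu>"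
proof -
  have tight: "tight D"
    using tight_if_moments_converge[of D "m 1", OF D nn] int[of _ 1] lim[of 1] by simp
  have sub: "AE z in \<nu>. 0 \<le> z" "\<And>k. integrable \<nu> (\<lambda>z. z ^ k)" "\<And>k. (\<integral>z. z ^ k \<partial>\<nu>) = m k"
    if "strict_mono s" "real_distribution \<nu>" "weak_conv_m (D \<circ> s) \<nu>" for s \<nu>
  proof -
    have w: "weak_conv_m (\<lambda>n. D (s n)) \<nu>" using that(3) by (simp add: o_def)
    have lim': "(\<lambda>n. \<integral>z. z ^ k \<partial>D (s n)) \<longlonglongrightarrow> m k" for k
      using LIMSEQ_subseq_LIMSEQ[OF lim that(1)] by (simp add: o_def)
    note * = moments_of_weak_limit[of "\<lambda>n. D (s n)", OF D nn int lim' that(2) w]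
    show "AE z in \<nu>. 0 \<le> z" by (rule *)
    show "integrable \<nu> (\<lambda>z. z ^ k)" "(\<integral>z. z ^ k \<partial>\<nu>) = m k" for k by (rule *)+
  qed
  obtain r \<nu> where r: "strict_mono r" and \<nu>: "real_distribution \<nu>" and w: "weak_conv_m (D \<circ> r) \<nu>"
    using tight_imp_convergent_subsubsequence[OF tight strict_mono_id] by auto
  have "weak_conv_m D \<nu>"
  proof (rule tight_subseq_weak_converge[OF D \<nu> tight])
    fix s \<nu>' assume s: "strict_mono s" and \<nu>': "real_distribution \<nu>'" and w': "weak_conv_m (D \<circ> s) \<nu>'"
    have "\<nu>' = \<nu>"
      using sub[OF s \<nu>' w'] sub[OF r \<nu> w] m
      by (intro moments_determine_distribution \<nu> \<nu>')
        (auto simp: AE_nonneg_abs_moment real_distribution.events_eq_borel \<nu> \<nu>')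
    with w' show "weak_conv_m (D \<circ> s) \<nu>" by simp
  qed
  with sub[OF r \<nu> w] \<nu> that show ?thesis by blast
qed

subsection \<open>Lebesgue points\<close>

lemma finite_borel_outer_approx:
  fixes N :: "'a::{second_countable_topology, complete_space} measure" and \<epsilon> :: real
  assumes "sets N = sets borel" "emeasure N (space N) \<noteq> \<infinity>" "A \<in> sets borel" "0 < \<epsilon>"
  obtains U where "open U" "A \<subseteq> U" "emeasure N (U - A) < \<epsilon>"
proof -
  interpret finite_measure N by standard (use assms in auto)
  have "emeasure N A < ennreal (measure N A + \<epsilon>)"
    using assms(4) by (simp add: emeasure_eq_measure ennreal_less_iff)
  then have "(INF U \<in> {U. A \<subseteq> U \<and> open U}. emeasure N U) < ennreal (measure N A + \<epsilon>)"
    using outer_regular[OF assms(1,2,3)] by simp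
  then obtain U where U: "A \<subseteq> U" "open U" "emeasure N U < ennreal (measure N A + \<epsilon>)"
    unfolding INF_less_iff by auto
  have "measure N (U - A) = measure N U - measure N A"
    using U assms by (intro finite_measure_Diff) auto
  also have "\<dots> < \<epsilon>"
    using U(3) by (simp add: emeasure_eq_measure ennreal_less_iff)
  finally have "emeasure N (U - A) < \<epsilon>"
    using assms(4) by (simp add: emeasure_eq_measure ennreal_less_iff)
  with U that show ?thesis by blast
qed

lemma balls_borel [measurable]:
  "ball (a::'a::euclidean_space) r \<in> sets borel" "cball a r \<in> sets borel"
  by auto

text \<open>Cover the exceptional set by disjoint balls of density above \<open>q\<close> inside an open \<open>U \<supseteq> A\<close> with
  small integral of \<open>g\<close> over \<open>U - A\<close>; since \<open>g < p\<close> on \<open>A\<close>, their total volume is small.\<close>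

lemma negligible_upper_density_gt:
  fixes g :: "'a::euclidean_space \<Rightarrow> real"
  assumes [measurable]: "g \<in> borel_measurable borel" and g: "\<And>x. 0 \<le> g x"
    and fin: "(\<integral>\<^sup>+x. g x \<partial>lborel) < \<infinity>" and pq: "0 \<le> p" "p < q"
  shows "negligible {x \<in> ball 0 N. g x < p \<and>
      (\<forall>\<delta>>0. \<exists>r. 0 < r \<and> r < \<delta> \<and> ennreal q * emeasure lborel (cball x r) < (\<integral>\<^sup>+y\<in>cball x r. g y \<partial>lborel))}"
    (is "negligible ?E")
proof -
  define \<nu> where "\<nu> = density lborel (\<lambda>x. ennreal (g x))"
  have [measurable_cong]: "sets \<nu> = sets borel" by (simp add: \<nu>_def)
  have \<nu>_eq: "emeasure \<nu> A = (\<integral>\<^sup>+y\<in>A. g y \<partial>lborel)" if "A \<in> sets borel" for A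
    using that by (simp add: \<nu>_def emeasure_density)
  define A where "A = {x \<in> ball 0 N. g x < p}"
  have [measurable]: "A \<in> sets borel"
  proof -
    have "A = ball 0 N \<inter> {x \<in> space borel. g x < p}" by (auto simp: A_def)
    then show ?thesis by simp
  qed
  have "\<exists>T. ?E \<subseteq> T \<and> T \<in> lmeasurable \<and> measure lebesgue T \<le> e" if e: "0 < e" for e :: real
  proof -
    have pos: "0 < e * (q - p)" using e pq by simp
    have "emeasure \<nu> (space \<nu>) \<noteq> \<infinity>" using fin by (simp add: \<nu>_def emeasure_density)
    from finite_borel_outer_approx[OF _ this _ pos, of A]
    obtain U0 where U0: "open U0" "A \<subseteq> U0" "emeasure \<nu> (U0 - A) < ennreal (e * (q - p))"
      by (auto simp: \<nu>_def)
    \<comment> \<open>Staying inside the ball keeps volumes finite, so that p times the volume of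
      \<open>D\<close> can be subtracted at the end.\<close>
    define U where "U = U0 \<inter> ball 0 N"
    have U: "open U" "A \<subseteq> U" "emeasure \<nu> (U - A) < ennreal (e * (q - p))" "U \<subseteq> ball 0 N"
    proof -
      have "emeasure \<nu> (U - A) \<le> emeasure \<nu> (U0 - A)"
        unfolding U_def using U0(1) by (intro emeasure_mono) auto
      with U0 show "emeasure \<nu> (U - A) < ennreal (e * (q - p))" by simp
    qed (use U0 in \<open>auto simp: U_def A_def\<close>)
    define K where "K = {(x::'a, r). 0 < r \<and> cball x r \<subseteq> U \<and>
        ennreal q * emeasure lborel (cball x r) < emeasure \<nu> (cball x r)}"
    obtain C where C: "countable C" "C \<subseteq> K"
      "pairwise (\<lambda>i j. disjnt (cball (fst i) (snd i)) (cball (fst j) (snd j))) C"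
      "negligible (?E - (\<Union>i\<in>C. cball (fst i) (snd i)))"
    proof (rule Vitali_covering_theorem_cballs[of K snd ?E fst])
      fix x and d :: real assume x: "x \<in> ?E" and d: "0 < d"
      then have "x \<in> U" using U(2) by (auto simp: A_def)
      then obtain \<delta> where \<delta>: "0 < \<delta>" "cball x \<delta> \<subseteq> U"
        using U(1) open_contains_cball by blast
      obtain r where r: "0 < r" "r < min d \<delta>"
        "ennreal q * emeasure lborel (cball x r) < (\<integral>\<^sup>+y\<in>cball x r. g y \<partial>lborel)"
      proof -
        have "0 < min d \<delta>" using d \<delta>(1) by simp
        with x that show ?thesis unfolding mem_Collect_eq by blast
      qed
      have "cball x r \<subseteq> U" using r \<delta> by (auto simp: subset_iff)
      with r have "(x, r) \<in> K" by (simp add: K_def \<nu>_eq)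
      then show "\<exists>i. i \<in> K \<and> x \<in> cball (fst i) (snd i) \<and> snd i < d"
        using r by (intro exI[of _ "(x, r)"]) auto
    qed (auto simp: K_def)
    define D where "D = (\<Union>i\<in>C. cball (fst i) (snd i))"
    have D_sub: "D \<subseteq> U" using C(2) unfolding D_def K_def by fastforce
    have [measurable]: "D \<in> sets borel" unfolding D_def using C(1) by (intro sets.countable_UN') auto
    have disj: "disjoint_family_on (\<lambda>i. cball (fst i) (snd i)) C"
      using C(3) by (auto simp: disjoint_family_on_def pairwise_def disjnt_def)
    have D_fin: "emeasure lborel D < \<infinity>"
    proof (rule le_less_trans)
      show "emeasure lborel D \<le> emeasure lborel (ball (0::'a) N)"
        using D_sub U(4) by (intro emeasure_mono order_trans[OF D_sub U(4)]) auto
      show "emeasure lborel (ball (0::'a) N) < \<infinity>"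
        using emeasure_lborel_ball_finite[of "0::'a" N] by simp
    qed
    then have D_eq: "emeasure lborel D = ennreal (measure lborel D)"
      by (simp add: emeasure_eq_ennreal_measure)
    \<comment> \<open>The selected balls give q * vol D \<le> \<nu> D, and splitting
      \<open>D\<close> along \<open>A\<close> gives \<nu> D \<le> p * vol D + e * (q - p). The
      tolerance carries the factor q - p so that vol D \<le> e results.\<close>
    have "ennreal q * emeasure lborel D = (\<integral>\<^sup>+i. ennreal q * emeasure lborel (cball (fst i) (snd i)) \<partial>count_space C)"
      unfolding D_def using C(1) disj
      by (subst emeasure_UN_countable) (auto simp: nn_integral_cmult)
    also have "\<dots> \<le> (\<integral>\<^sup>+i. emeasure \<nu> (cball (fst i) (snd i)) \<partial>count_space C)"
      using C(2) by (intro nn_integral_mono) (auto simp: K_def less_imp_le)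
    also have "\<dots> = emeasure \<nu> D"
      unfolding D_def using C(1) disj by (subst emeasure_UN_countable) auto
    also have "\<dots> \<le> emeasure \<nu> (D \<inter> A) + emeasure \<nu> (U - A)"
      using D_sub U(1) by (intro order_trans[OF _ emeasure_subadditive] emeasure_mono) auto
    also have "emeasure \<nu> (D \<inter> A) \<le> ennreal p * emeasure lborel D"
    proof -
      have "emeasure \<nu> (D \<inter> A) = (\<integral>\<^sup>+y\<in>D \<inter> A. g y \<partial>lborel)" by (simp add: \<nu>_eq)
      also have "\<dots> \<le> (\<integral>\<^sup>+y. ennreal p * indicator D y \<partial>lborel)"
        by (intro nn_integral_mono) (auto simp: A_def indicator_def intro!: ennreal_leI)
      also have "\<dots> = ennreal p * emeasure lborel D" by (simp add: nn_integral_cmult)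
      finally show ?thesis .
    qed
    also have "emeasure \<nu> (U - A) \<le> ennreal (e * (q - p))" using U(3) by simp
    finally have "ennreal (q * measure lborel D) \<le> ennreal (p * measure lborel D + e * (q - p))"
      using pq e by (simp add: D_eq ennreal_mult[symmetric] ennreal_plus[symmetric] del: ennreal_plus add: add_mono)
    then have "q * measure lborel D \<le> p * measure lborel D + e * (q - p)"
      using pq e by (subst (asm) ennreal_le_iff) auto
    then have "(q - p) * measure lborel D \<le> (q - p) * e" by (simp add: algebra_simps)
    then have D_le: "measure lborel D \<le> e" using pq by simp
    define T where "T = D \<union> (?E - D)"
    have neg: "negligible (?E - D)" using C(4) by (simp add: D_def)
    have "D \<in> lmeasurable" using D_fin by (simp add: fmeasurable_def)
    then have "T \<in> lmeasurable" unfolding T_def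
      using negligible_imp_measurable[OF neg] by (rule fmeasurable.Un)
    moreover have "measure lebesgue T \<le> measure lebesgue D + measure lebesgue (?E - D)"
      unfolding T_def using neg by (intro measure_Un_le) (auto simp: negligible_imp_sets)
    then have "measure lebesgue T \<le> e"
      using neg D_le by (simp add: negligible_imp_measure0)
    ultimately show ?thesis by (intro exI[of _ T]) (auto simp: T_def)
  qed
  then show ?thesis unfolding negligible_outer_le by blast
qed

text \<open>The average is multiplied out and the integral is an extended nonnegative one: no
  division by a volume occurs, and no integrability of the difference has to be carried
  along.\<close>

definition lebesgue_point :: "('a::euclidean_space \<Rightarrow> real) \<Rightarrow> 'a \<Rightarrow> bool" where
  "lebesgue_point f x \<longleftrightarrow> (\<forall>\<epsilon>>0. \<exists>\<delta>>0. \<forall>r. 0 < r \<and> r < \<delta> \<longrightarrow>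
    (\<integral>\<^sup>+y\<in>cball x r. ennreal \<bar>f y - f x\<bar> \<partial>lborel) \<le> ennreal \<epsilon> * emeasure lborel (cball x r))"

text \<open>For each rational q, at almost every point where |f - q| is small its upper density is
  small as well. Countably many triples (q, s, t) cover all cases, and a q close to f x turns
  averages of |f - q| into averages of |f - f x|.\<close>

lemma AE_lebesgue_point:
  fixes f :: "'a::euclidean_space \<Rightarrow> real"
  assumes [measurable]: "f \<in> borel_measurable borel" and f: "\<And>x. 0 \<le> f x"
    and fin: "(\<integral>\<^sup>+x. f x \<partial>lborel) < \<infinity>"
  shows "AE x in lborel. lebesgue_point f x"
proof -
  \<comment> \<open>The cutoff makes |f - q| integrable. It sits at radius N + 1 so that balls of
    radius below 1 around points of norm below N do not notice it.\<close>
  define g where "g q N y = \<bar>f y - q\<bar> * indicator (ball 0 (real N + 1)) y" for q :: real and N y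
  have [measurable]: "g q N \<in> borel_measurable borel" for q N
    unfolding g_def by (intro borel_measurable_times borel_measurable_indicator) auto
  define E where "E q N s t = {x \<in> ball 0 (real N). g q N x < s \<and>
      (\<forall>\<delta>>0. \<exists>r. 0 < r \<and> r < \<delta> \<and> ennreal t * emeasure lborel (cball x r) < (\<integral>\<^sup>+y\<in>cball x r. g q N y \<partial>lborel))}"
    for q N s t
  have neg: "negligible (E q N s t)" if "0 \<le> s" "s < t" for q N s t
    unfolding E_def
  proof (rule negligible_upper_density_gt)
    have "(\<integral>\<^sup>+x. g q N x \<partial>lborel) \<le> (\<integral>\<^sup>+x. ennreal (f x) + ennreal \<bar>q\<bar> * indicator (ball 0 (real N + 1)) x \<partial>lborel)"
      using f by (intro nn_integral_mono)
        (auto simp: g_def indicator_def ennreal_plus[symmetric] simp del: ennreal_plus intro!: ennreal_leI abs_triangle_ineq4[THEN order_trans])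
    also have "\<dots> = (\<integral>\<^sup>+x. f x \<partial>lborel) + ennreal \<bar>q\<bar> * emeasure lborel (ball (0::'a) (real N + 1))"
      by (simp add: nn_integral_add nn_integral_cmult)
    also have "\<dots> < \<infinity>"
      using fin emeasure_lborel_ball_finite[of "0::'a" "real N + 1"] by (simp add: ennreal_mult_less_top)
    finally show "(\<integral>\<^sup>+x. g q N x \<partial>lborel) < \<infinity>" .
  qed (use that in \<open>auto simp: g_def\<close>)
  define I where "I = {(q :: real, s, t). q \<in> \<rat> \<and> s \<in> \<rat> \<and> t \<in> \<rat> \<and> 0 \<le> s \<and> s < (t::real)}"
  have "countable I"
    by (rule countable_subset[of _ "\<rat> \<times> \<rat> \<times> \<rat>"]) (auto simp: I_def countable_rat)
  then have "negligible (\<Union>(q, s, t) \<in> I. \<Union>N. E q N s t)"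
    by (intro negligible_countable_Union) (auto simp: I_def neg intro!: negligible_countable_Union)
  then have "AE x in lebesgue. x \<notin> (\<Union>(q, s, t) \<in> I. \<Union>N. E q N s t)"
    unfolding negligible_iff_null_sets by (rule AE_not_in)
  then have "AE x in lborel. x \<notin> (\<Union>(q, s, t) \<in> I. \<Union>N. E q N s t)"
    by (simp add: AE_completion_iff)
  then show ?thesis
  proof eventually_elim
    case (elim x)
    show ?case
      unfolding lebesgue_point_def
    proof (intro allI impI)
      fix \<epsilon> :: real assume \<epsilon>: "0 < \<epsilon>"
      \<comment> \<open>The error budget is |f x - q| < \<epsilon> / 4 < s < t < \<epsilon> / 2.
        Replacing q by f x inside the integral costs a further \<epsilon> / 4, and t + \<epsilon> /
        4 < \<epsilon>.\<close>
      obtain q where q: "q \<in> \<rat>" "f x < q" "q < f x + \<epsilon> / 4"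
        using Rats_dense_in_real[of "f x" "f x + \<epsilon> / 4"] \<epsilon> by auto
      obtain s where s: "s \<in> \<rat>" "\<epsilon> / 4 < s" "s < \<epsilon> / 2"
        using Rats_dense_in_real[of "\<epsilon> / 4" "\<epsilon> / 2"] \<epsilon> by auto
      obtain t where t: "t \<in> \<rat>" "s < t" "t < \<epsilon> / 2"
        using Rats_dense_in_real[OF s(3)] by auto
      obtain N where N: "norm x < real N" using reals_Archimedean2 by blast
      have "(q, s, t) \<in> I" using q s t \<epsilon> by (auto simp: I_def)
      with elim have "x \<notin> E q N s t" by blast
      moreover have "x \<in> ball 0 (real N)" "g q N x < s"
        using N q s by (auto simp: g_def indicator_def)
      ultimately obtain \<delta> where \<delta>: "0 < \<delta>" "\<And>r. 0 < r \<Longrightarrow> r < \<delta> \<Longrightarrow>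
          (\<integral>\<^sup>+y\<in>cball x r. g q N y \<partial>lborel) \<le> ennreal t * emeasure lborel (cball x r)"
        unfolding E_def mem_Collect_eq not_less[symmetric] by blast
      show "\<exists>\<delta>>0. \<forall>r. 0 < r \<and> r < \<delta> \<longrightarrow>
          (\<integral>\<^sup>+y\<in>cball x r. ennreal \<bar>f y - f x\<bar> \<partial>lborel) \<le> ennreal \<epsilon> * emeasure lborel (cball x r)"
      proof (intro exI[of _ "min \<delta> 1"] conjI allI impI)
        fix r assume r: "0 < r \<and> r < min \<delta> 1"
        have in_ball: "y \<in> ball 0 (real N + 1)" if "y \<in> cball x r" for y
        proof -
          have "norm y \<le> norm x + norm (y - x)" by (metis add.commute diff_add_cancel norm_triangle_ineq)
          with that r N show ?thesis by (auto simp: dist_norm norm_minus_commute)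
        qed
        have "(\<integral>\<^sup>+y\<in>cball x r. ennreal \<bar>f y - f x\<bar> \<partial>lborel) \<le>
            (\<integral>\<^sup>+y. ennreal (g q N y) * indicator (cball x r) y + ennreal (\<epsilon> / 4) * indicator (cball x r) y \<partial>lborel)"
        proof (intro nn_integral_mono)
          fix y
          have "ennreal \<bar>f y - f x\<bar> \<le> ennreal (g q N y) + ennreal (\<epsilon> / 4)" if "y \<in> cball x r"
            using in_ball[OF that] q \<epsilon>
            by (auto simp: g_def indicator_def ennreal_plus[symmetric] simp del: ennreal_plus intro!: ennreal_leI)
          then show "ennreal \<bar>f y - f x\<bar> * indicator (cball x r) y \<le>
              ennreal (g q N y) * indicator (cball x r) y + ennreal (\<epsilon> / 4) * indicator (cball x r) y"
            by (auto simp: indicator_def)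
        qed
        also have "\<dots> = (\<integral>\<^sup>+y\<in>cball x r. g q N y \<partial>lborel) + ennreal (\<epsilon> / 4) * emeasure lborel (cball x r)"
          by (simp add: nn_integral_add nn_integral_cmult)
        also have "\<dots> \<le> ennreal t * emeasure lborel (cball x r) + ennreal (\<epsilon> / 4) * emeasure lborel (cball x r)"
          using \<delta>(2)[of r] r by (intro add_right_mono) auto
        also have "\<dots> = ennreal (t + \<epsilon> / 4) * emeasure lborel (cball x r)"
          using \<epsilon> s t by (simp add: distrib_right)
        also have "\<dots> \<le> ennreal \<epsilon> * emeasure lborel (cball x r)"
          using t \<epsilon> by (intro mult_right_mono ennreal_leI) auto
        finally show "(\<integral>\<^sup>+y\<in>cball x r. ennreal \<bar>f y - f x\<bar> \<partial>lborel) \<le> ennreal \<epsilon> * emeasure lborel (cball x r)" .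
      qed (use \<delta> in auto)
    qed
  qed
qed

subsection \<open>Product measures and linear similarities\<close>

text \<open>Both sides agree on boxes. The measures of interest are built on Lebesgue measure, which
  is infinite, so the argument rests on sigma-finiteness; it is assumed separately for the image
  because a pushforward can lose it.\<close>

lemma PiM_distr_sigma_finite:
  fixes M :: "'a measure" and N :: "'b measure"
  assumes fin: "finite J" and M: "sigma_finite_measure M" and D: "sigma_finite_measure (distr M N T)"
    and T[measurable]: "T \<in> measurable M N"
  shows "PiM J (\<lambda>_. distr M N T) = distr (PiM J (\<lambda>_. M)) (PiM J (\<lambda>_. N)) (\<lambda>v. \<lambda>j\<in>J. T (v j))"
proof (rule sym)
  interpret M: sigma_finite_measure M by fact
  interpret M: product_sigma_finite "\<lambda>_. M" by standard
  interpret D: sigma_finite_measure "distr M N T" by fact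
  interpret D: product_sigma_finite "\<lambda>_. distr M N T" by standard
  show "distr (PiM J (\<lambda>_. M)) (PiM J (\<lambda>_. N)) (\<lambda>v. \<lambda>j\<in>J. T (v j)) = PiM J (\<lambda>_. distr M N T)"
  proof (rule D.PiM_eqI[OF fin])
    show "sets (distr (PiM J (\<lambda>_. M)) (PiM J (\<lambda>_. N)) (\<lambda>v. \<lambda>j\<in>J. T (v j))) =
        sets (PiM J (\<lambda>_. distr M N T))"
      by (simp cong: sets_PiM_cong)
    fix A assume A: "\<And>j. j \<in> J \<Longrightarrow> A j \<in> sets (distr M N T)"
    have "(\<lambda>v. \<lambda>j\<in>J. T (v j)) -` Pi\<^sub>E J A \<inter> space (PiM J (\<lambda>_. M)) = (\<Pi>\<^sub>E j\<in>J. T -` A j \<inter> space M)"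
      by (auto simp: space_PiM PiE_iff)
    then show "emeasure (distr (PiM J (\<lambda>_. M)) (PiM J (\<lambda>_. N)) (\<lambda>v. \<lambda>j\<in>J. T (v j))) (Pi\<^sub>E J A) =
        (\<Prod>j\<in>J. emeasure (distr M N T) (A j))"
      using A fin by (subst emeasure_distr)
        (auto simp: emeasure_distr M.emeasure_PiM intro!: prod.cong sets_PiM_I_finite)
  qed
qed

lemma PiM_density_sigma_finite:
  fixes M :: "'a measure"
  assumes fin: "finite J" and M: "sigma_finite_measure M" and D: "sigma_finite_measure (density M g)"
    and g[measurable]: "g \<in> borel_measurable M"
  shows "PiM J (\<lambda>_. density M g) = density (PiM J (\<lambda>_. M)) (\<lambda>v. \<Prod>j\<in>J. g (v j))"
proof (rule sym)
  interpret M: sigma_finite_measure M by fact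
  interpret M: product_sigma_finite "\<lambda>_. M" by standard
  interpret D: sigma_finite_measure "density M g" by fact
  interpret D: product_sigma_finite "\<lambda>_. density M g" by standard
  show "density (PiM J (\<lambda>_. M)) (\<lambda>v. \<Prod>j\<in>J. g (v j)) = PiM J (\<lambda>_. density M g)"
  proof (rule D.PiM_eqI[OF fin])
    show "sets (density (PiM J (\<lambda>_. M)) (\<lambda>v. \<Prod>j\<in>J. g (v j))) = sets (PiM J (\<lambda>_. density M g))"
      by (simp cong: sets_PiM_cong)
    fix A assume "\<And>j. j \<in> J \<Longrightarrow> A j \<in> sets (density M g)"
    then have A[measurable]: "\<And>j. j \<in> J \<Longrightarrow> A j \<in> sets M" by simp
    have "emeasure (density (PiM J (\<lambda>_. M)) (\<lambda>v. \<Prod>j\<in>J. g (v j))) (Pi\<^sub>E J A) =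
        (\<integral>\<^sup>+v. (\<Prod>j\<in>J. g (v j)) * indicator (Pi\<^sub>E J A) v \<partial>PiM J (\<lambda>_. M))"
      using A fin by (intro emeasure_density) (auto intro!: sets_PiM_I_finite)
    also have "\<dots> = (\<integral>\<^sup>+v. (\<Prod>j\<in>J. g (v j) * indicator (A j) (v j)) \<partial>PiM J (\<lambda>_. M))"
    proof (intro nn_integral_cong)
      fix v assume "v \<in> space (PiM J (\<lambda>_. M))"
      then show "(\<Prod>j\<in>J. g (v j)) * indicator (Pi\<^sub>E J A) v = (\<Prod>j\<in>J. g (v j) * indicator (A j) (v j))"
        using fin by (auto simp: prod.distrib indicator_def space_PiM PiE_iff prod_zero_iff split: if_splits)
    qed
    also have "\<dots> = (\<Prod>j\<in>J. \<integral>\<^sup>+x. g x * indicator (A j) x \<partial>M)"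
      using fin by (intro M.product_nn_integral_prod) auto
    also have "\<dots> = (\<Prod>j\<in>J. emeasure (density M g) (A j))"
      by (intro prod.cong) (auto simp: emeasure_density)
    finally show "emeasure (density (PiM J (\<lambda>_. M)) (\<lambda>v. \<Prod>j\<in>J. g (v j))) (Pi\<^sub>E J A) =
      (\<Prod>j\<in>J. emeasure (density M g) (A j))" .
  qed
qed

lemma distr_PiM_permute:
  assumes M: "sigma_finite_measure M" and fin: "finite J" and \<pi>: "\<pi> permutes J"
  shows "distr (PiM J (\<lambda>_. M)) (PiM J (\<lambda>_. M)) (\<lambda>u. \<lambda>j\<in>J. u (\<pi> j)) = PiM J (\<lambda>_. M)"
proof -
  interpret M: sigma_finite_measure M by fact
  interpret M: product_sigma_finite "\<lambda>_. M" by standard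
  have \<pi>J: "\<pi> j \<in> J \<longleftrightarrow> j \<in> J" for j using \<pi> by (rule permutes_in_image)
  have [measurable]: "(\<lambda>u. \<lambda>j\<in>J. u (\<pi> j)) \<in> measurable (PiM J (\<lambda>_. M)) (PiM J (\<lambda>_. M))"
    by (intro measurable_restrict measurable_component_singleton) (simp add: \<pi>J)
  show ?thesis
  proof (rule M.PiM_eqI[OF fin])
    fix A assume A: "\<And>j. j \<in> J \<Longrightarrow> A j \<in> sets M"
    have "(\<lambda>u. \<lambda>j\<in>J. u (\<pi> j)) -` Pi\<^sub>E J A \<inter> space (PiM J (\<lambda>_. M)) = (\<Pi>\<^sub>E j\<in>J. A (inv \<pi> j))"
    proof (intro set_eqI iffI)
      fix u assume u: "u \<in> (\<lambda>u. \<lambda>j\<in>J. u (\<pi> j)) -` Pi\<^sub>E J A \<inter> space (PiM J (\<lambda>_. M))"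
      have "u j \<in> A (inv \<pi> j)" if "j \<in> J" for j
      proof -
        have "inv \<pi> j \<in> J" using that \<pi>J[of "inv \<pi> j"] permutes_inverses[OF \<pi>] by simp
        then have "u (\<pi> (inv \<pi> j)) \<in> A (inv \<pi> j)" using u by (auto simp: PiE_iff)
        then show ?thesis by (simp add: permutes_inverses[OF \<pi>])
      qed
      then show "u \<in> (\<Pi>\<^sub>E j\<in>J. A (inv \<pi> j))" using u by (auto simp: space_PiM PiE_iff)
    next
      fix u assume u: "u \<in> (\<Pi>\<^sub>E j\<in>J. A (inv \<pi> j))"
      have "u (\<pi> j) \<in> A j" if "j \<in> J" for j
        using u that \<pi>J[of j] permutes_inverses[OF \<pi>] by (force simp: PiE_iff)
      moreover have "inv \<pi> j \<in> J" if "j \<in> J" for j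
        using that \<pi>J[of "inv \<pi> j"] permutes_inverses[OF \<pi>] by simp
      ultimately show "u \<in> (\<lambda>u. \<lambda>j\<in>J. u (\<pi> j)) -` Pi\<^sub>E J A \<inter> space (PiM J (\<lambda>_. M))"
        using u sets.sets_into_space[OF A] by (auto simp: space_PiM PiE_iff) blast
    qed
    moreover have "(\<Prod>j\<in>J. emeasure M (A (inv \<pi> j))) = (\<Prod>j\<in>J. emeasure M (A j))"
      using prod.permute[OF permutes_inv[OF \<pi>], of "\<lambda>j. emeasure M (A j)"] by (simp add: o_def)
    moreover have "A (inv \<pi> j) \<in> sets M" if "j \<in> J" for j
      using A that \<pi>J[of "inv \<pi> j"] permutes_inverses[OF \<pi>] by simp
    ultimately show "emeasure (distr (PiM J (\<lambda>_. M)) (PiM J (\<lambda>_. M)) (\<lambda>u. \<lambda>j\<in>J. u (\<pi> j))) (Pi\<^sub>E J A) =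
        (\<Prod>j\<in>J. emeasure M (A j))"
      using A fin by (subst emeasure_distr) (auto simp: M.emeasure_PiM intro!: sets_PiM_I_finite)
  qed simp
qed

section \<open>Lebesgue measure under similarities and in radial form\<close>

lemma emeasure_cball_eq:
  fixes c :: "'a::euclidean_space"
  assumes "0 \<le> r"
  shows "emeasure lborel (cball c r) = ennreal (measure lborel (cball (0::'a) 1) * r ^ DIM('a))"
  using content_cball[OF assms, of c] content_cball[of 1 "0::'a"] emeasure_lborel_cball_finite[of c r]
  by (simp add: emeasure_eq_ennreal_measure top.not_eq_extremum)

text \<open>A linear similarity maps balls to balls, and by Vitali every open set is a countable
  disjoint union of balls up to a null set.\<close>

lemma emeasure_lborel_similarity:
  fixes T :: "'a::euclidean_space \<Rightarrow> 'a"
  assumes T: "linear T" and r: "0 < r" and norm_T: "\<And>v. norm (T v) = r * norm v"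
  shows "lborel = density (distr lborel borel T) (\<lambda>_. ennreal (r ^ DIM('a)))"
proof -
  have T_cont[measurable]: "T \<in> borel_measurable borel"
    using T by (intro borel_measurable_continuous_onI linear_continuous_on) (simp add: linear_conv_bounded_linear)
  have "inj T"
    using norm_T r by (auto simp: linear_injective_0[OF T]) (metis mult_eq_0_iff norm_eq_zero less_irrefl)
  then obtain S where S: "linear S" "S \<circ> T = id" "T \<circ> S = id"
    using linear_injective_isomorphism[OF T] by (metis (no_types) comp_def eq_id_iff)
  have TS: "T (S y) = y" "S (T y) = y" for y using S by (auto simp: fun_eq_iff)
  have norm_S: "norm (S y) = norm y / r" for y
    using norm_T[of "S y"] r by (simp add: TS)
  have dist_T: "dist (T a) (T b) = r * dist a b" for a b
    by (simp add: dist_norm norm_T flip: linear_diff[OF T])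
  have vim_cball: "T -` cball a \<rho> = cball (S a) (\<rho> / r)" for a \<rho>
  proof -
    have "dist a (T v) = r * dist (S a) v" for v using dist_T[of "S a" v] by (simp add: TS)
    then show ?thesis using r by (auto simp: field_simps)
  qed
  define N where "N = density (distr lborel borel T) (\<lambda>_. ennreal (r ^ DIM('a)))"
  have N_eq: "emeasure N A = ennreal (r ^ DIM('a)) * emeasure lborel (T -` A)" if "A \<in> sets borel" for A
    using that by (simp add: N_def emeasure_density nn_integral_cmult emeasure_distr nn_integral_distr)
  have N_cball: "emeasure N (cball a \<rho>) = emeasure lborel (cball a \<rho>)" if "0 \<le> \<rho>" for a \<rho>
    using that r by (simp add: N_eq vim_cball emeasure_cball_eq ennreal_mult[symmetric] power_divide)
  \<comment> \<open>The Vitali covering leaves a null remainder, which \<open>N\<close> must not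
    charge either. The preimage under \<open>T\<close> is the image under the inverse map, and
    linear images of null sets are null.\<close>
  have null: "emeasure N A = 0" if A: "A \<in> sets borel" "emeasure lborel A = 0" for A
  proof -
    have "negligible A" using A by (simp add: negligible_iff_null_sets null_sets_completionI null_setsI)
    then have "negligible (S ` A)" using S(1)
      by (intro negligible_differentiable_image_negligible)
        (auto simp: linear_conv_bounded_linear intro!: bounded_linear_imp_differentiable_on)
    moreover have "S ` A = T -` A" by (auto simp: TS image_iff) (metis TS(2))
    moreover have "T -` A \<in> sets borel" using measurable_sets[OF T_cont A(1)] by simp
    ultimately have "emeasure lborel (T -` A) = 0"
      by (simp add: negligible_iff_null_sets null_sets_def)
    then show ?thesis by (simp add: N_eq A)
  qed
  have eq_open: "emeasure N A = emeasure lborel A" if A: "open A" for A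
  proof -
    define K where "K = {(x::'a, \<rho>::real). 0 < \<rho> \<and> cball x \<rho> \<subseteq> A}"
    obtain C where C: "countable C" "C \<subseteq> K"
      "pairwise (\<lambda>i j. disjnt (cball (fst i) (snd i)) (cball (fst j) (snd j))) C"
      "negligible (A - (\<Union>i\<in>C. cball (fst i) (snd i)))"
    proof (rule Vitali_covering_theorem_cballs[of K snd A fst])
      fix x and d :: real assume "x \<in> A" "0 < d"
      then obtain \<delta> where \<delta>: "0 < \<delta>" "cball x \<delta> \<subseteq> A" using A open_contains_cball by blast
      have "cball x (min \<delta> (d / 2)) \<subseteq> A" using \<delta> by (auto simp: subset_iff)
      then have "(x, min \<delta> (d / 2)) \<in> K" using \<delta> \<open>0 < d\<close> by (simp add: K_def)
      then show "\<exists>i. i \<in> K \<and> x \<in> cball (fst i) (snd i) \<and> snd i < d"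
        using \<delta> \<open>0 < d\<close> by (intro exI[of _ "(x, min \<delta> (d / 2))"]) auto
    qed (auto simp: K_def)
    define D where "D = (\<Union>i\<in>C. cball (fst i) (snd i))"
    have D[measurable]: "D \<in> sets borel" unfolding D_def using C(1) by (intro sets.countable_UN') auto
    have A'[measurable]: "A \<in> sets borel" using A by simp
    have sub: "D \<subseteq> A" using C(2) unfolding D_def K_def by fastforce
    have disj: "disjoint_family_on (\<lambda>i. cball (fst i) (snd i)) C"
      using C(3) by (auto simp: disjoint_family_on_def pairwise_def disjnt_def)
    have nn: "0 \<le> snd i" if "i \<in> C" for i using that C(2) by (auto simp: K_def)
    have "emeasure N D = (\<integral>\<^sup>+i. emeasure N (cball (fst i) (snd i)) \<partial>count_space C)"
      unfolding D_def using C(1) disj by (intro emeasure_UN_countable) (auto simp: N_def)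
    also have "\<dots> = (\<integral>\<^sup>+i. emeasure lborel (cball (fst i) (snd i)) \<partial>count_space C)"
      by (intro nn_integral_cong) (simp add: N_cball nn)
    also have "\<dots> = emeasure lborel D"
      unfolding D_def using C(1) disj by (subst emeasure_UN_countable) auto
    finally have D_eq: "emeasure N D = emeasure lborel D" .
    have "emeasure lborel (A - D) = 0"
      using C(4) by (simp add: D_def[symmetric] negligible_iff_null_sets null_sets_def)
    then have "emeasure N (A - D) = 0" "emeasure lborel (A - D) = 0" by (auto intro: null)
    then show ?thesis
      using D_eq emeasure_Un_null_set[of D N "A - D"] emeasure_Un_null_set[of D lborel "A - D"] sub
      by (simp add: Un_absorb1 N_def null_sets_def)
  qed
  have "lborel = N"
  proof (rule measure_eqI_generator_eq[where E = "{S. open S}" and \<Omega> = UNIV and A = "\<lambda>n. ball 0 (real n)"])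
    show "Int_stable {S::'a set. open S}" by (auto simp: Int_stable_def)
    show "(\<Union>n. ball (0::'a) (real n)) = UNIV" by (auto simp: reals_Archimedean2)
    show "emeasure lborel (ball (0::'a) (real n)) \<noteq> \<infinity>" for n
      using emeasure_lborel_ball_finite[of "0::'a" "real n"] by simp
    show "sets lborel = sigma_sets UNIV {S::'a set. open S}" "sets N = sigma_sets UNIV {S::'a set. open S}"
      by (auto simp: N_def borel_def)
  qed (auto simp: eq_open)
  then show ?thesis by (simp add: N_def)
qed

text \<open>This replaces polar coordinates: the points with V * |u|^d at most t form a ball of
  volume t. The volume of the centred ball through u thus serves as a radial coordinate.\<close>

lemma distr_lborel_radial:
  defines "V \<equiv> measure lborel (cball (0::'a::euclidean_space) 1)"
  shows "distr lborel borel (\<lambda>u::'a. V * norm u ^ DIM('a)) = density lborel (indicator {0..})"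
proof (rule measure_eqI_generator_eq[where E = "range atMost" and \<Omega> = UNIV and A = "\<lambda>n. {..real n}"])
  have V: "0 < V" unfolding V_def using content_cball_pos[of 1 "0::'a"] by simp
  show eq: "emeasure (distr lborel borel (\<lambda>u::'a. V * norm u ^ DIM('a))) X =
      emeasure (density lborel (indicator {0..})) X" if "X \<in> range atMost" for X
  proof -
    from that obtain t where t: "X = {..t}" by (auto elim!: rangeE)
    define \<rho> where "\<rho> = root DIM('a) (t / V)"
    have "(\<lambda>u::'a. V * norm u ^ DIM('a)) -` {..t} = (if 0 \<le> t then cball 0 \<rho> else {})"
    proof (cases "0 \<le> t")
      case True
      then have "\<rho> ^ DIM('a) = t / V" "0 \<le> \<rho>" using V by (auto simp: \<rho>_def)
      moreover from this have "t = V * \<rho> ^ DIM('a)" using V by simp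
      ultimately have "V * norm u ^ DIM('a) \<le> t \<longleftrightarrow> norm u \<le> \<rho>" for u :: 'a
        using V power_mono_iff[of "norm u" \<rho> "DIM('a)"] by simp
      with True show ?thesis by auto
    next
      case False
      moreover have "0 \<le> V * norm u ^ DIM('a)" for u :: 'a
        using V by simp
      ultimately have "\<not> V * norm u ^ DIM('a) \<le> t" for u :: 'a
        by (meson order_trans)
      with False show ?thesis by auto
    qed
    then have "emeasure (distr lborel borel (\<lambda>u::'a. V * norm u ^ DIM('a))) X = ennreal (if 0 \<le> t then t else 0)"
      using V by (auto simp: t emeasure_distr emeasure_cball_eq V_def[symmetric] \<rho>_def)
    also have "\<dots> = emeasure lborel {0..t}" by auto
    also have "\<dots> = emeasure (density lborel (indicator {0..})) X"
      by (simp add: t emeasure_density) (simp add: indicator_inter_arith[symmetric] atLeastAtMost_def)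
    finally show ?thesis .
  qed
  show "Int_stable (range atMost :: real set set)"
    by (auto simp: Int_stable_def)
  show "emeasure (distr lborel borel (\<lambda>u::'a. V * norm u ^ DIM('a))) {..real n} \<noteq> \<infinity>" for n
    using eq[of "{..real n}"]
    by (simp add: emeasure_density) (simp add: indicator_inter_arith[symmetric] atLeastAtMost_def[symmetric])
  show "(\<Union>n. {..real n}) = UNIV" by (auto simp: real_arch_simple)
qed (auto simp: borel_eq_atMost)

text \<open>Here \<open>c\<close> is the Jacobian factor of \<open>T\<close>. The statement serves
  two substitutions: the rotation and scaling adapted to the farthest point, with g = 1, and the
  blow-up around x, with g the density. Finite values of g keep the densities sigma-finite.\<close>

lemma nn_integral_PiM_change_of_variables:
  fixes g :: "'a::euclidean_space \<Rightarrow> ennreal"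
  assumes J: "finite J" and T[measurable]: "T \<in> borel_measurable borel"
    and lb: "lborel = density (distr lborel borel T) (\<lambda>_. ennreal c)"
    and g[measurable]: "g \<in> borel_measurable borel" and g_fin: "\<And>x. g x < \<infinity>"
    and F[measurable]: "F \<in> borel_measurable (PiM J (\<lambda>_. borel))"
  shows "(\<integral>\<^sup>+y. F y \<partial>PiM J (\<lambda>_. density lborel g)) =
    (\<integral>\<^sup>+v. (\<Prod>j\<in>J. ennreal c * g (T (v j))) * F (\<lambda>j\<in>J. T (v j)) \<partial>PiM J (\<lambda>_. lborel))"
proof -
  define h where "h v = ennreal c * g (T v)" for v
  have [measurable]: "h \<in> borel_measurable borel" unfolding h_def by measurable
  have "density lborel g = density (density (distr lborel borel T) (\<lambda>_. ennreal c)) g"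
    using lb by simp
  also have "\<dots> = distr (density lborel h) borel T"
    by (simp add: density_density_eq density_distr h_def[abs_def])
  finally have eq: "density lborel g = distr (density lborel h) borel T" .
  have sf: "sigma_finite_measure (density lborel g)" "sigma_finite_measure (density lborel h)"
    using g_fin by (auto simp: sigma_finite_measure.sigma_finite_iff_density_finite[OF lborel.sigma_finite_measure_axioms]
        h_def ennreal_mult_eq_top_iff less_top)
  have [measurable_cong]: "sets (PiM J (\<lambda>_. lborel :: 'a measure)) = sets (PiM J (\<lambda>_. borel))"
    "sets (PiM J (\<lambda>_. density lborel h)) = sets (PiM J (\<lambda>_. borel))"
    by (auto cong: sets_PiM_cong)
  have "(\<integral>\<^sup>+y. F y \<partial>PiM J (\<lambda>_. density lborel g)) =
      (\<integral>\<^sup>+y. F y \<partial>distr (PiM J (\<lambda>_. density lborel h)) (PiM J (\<lambda>_. borel)) (\<lambda>v. \<lambda>j\<in>J. T (v j)))"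
    unfolding eq by (subst PiM_distr_sigma_finite[OF J sf(2)]) (use sf eq in auto)
  also have "\<dots> = (\<integral>\<^sup>+v. F (\<lambda>j\<in>J. T (v j)) \<partial>PiM J (\<lambda>_. density lborel h))"
    by (rule nn_integral_distr) measurable
  also have "\<dots> = (\<integral>\<^sup>+v. F (\<lambda>j\<in>J. T (v j)) \<partial>density (PiM J (\<lambda>_. lborel)) (\<lambda>v. \<Prod>j\<in>J. h (v j)))"
    by (subst PiM_density_sigma_finite[OF J lborel.sigma_finite_measure_axioms sf(2)]) auto
  also have "\<dots> = (\<integral>\<^sup>+v. (\<Prod>j\<in>J. h (v j)) * F (\<lambda>j\<in>J. T (v j)) \<partial>PiM J (\<lambda>_. lborel))"
    by (rule nn_integral_density) measurable
  finally show ?thesis by (simp add: h_def)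
qed

text \<open>With all coordinates other than a fixed, a tie confines \<open>u a\<close> to a sphere,
  which is null. Ties for the farthest point can therefore be ignored.\<close>

lemma AE_PiM_lborel_norm_neq:
  assumes J: "finite J" "a \<in> J" "b \<in> J" "a \<noteq> b"
  shows "AE u in PiM J (\<lambda>_. lborel :: 'a::euclidean_space measure). norm (u a) \<noteq> norm (u b)"
proof -
  interpret product_sigma_finite "\<lambda>_. lborel :: 'a measure" by standard
  define S where "S = {u \<in> space (PiM J (\<lambda>_. lborel :: 'a measure)). norm (u a) = norm (u b)}"
  have [measurable]: "(\<lambda>u. u a) \<in> borel_measurable (PiM J (\<lambda>_. lborel :: 'a measure))"
    "(\<lambda>u. u b) \<in> borel_measurable (PiM J (\<lambda>_. lborel :: 'a measure))"
    using J measurable_component_singleton[of _ J "\<lambda>_. lborel :: 'a measure"] by auto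
  have S[measurable]: "S \<in> sets (PiM J (\<lambda>_. lborel))" unfolding S_def by measurable
  have J': "insert a (J - {a}) = J" using J by auto
  have "emeasure (PiM J (\<lambda>_. lborel)) S = (\<integral>\<^sup>+u. indicator S u \<partial>PiM (insert a (J - {a})) (\<lambda>_. lborel))"
    unfolding J' by simp
  also have "\<dots> = (\<integral>\<^sup>+u. (\<integral>\<^sup>+v. indicator S (u(a := v)) \<partial>lborel) \<partial>PiM (J - {a}) (\<lambda>_. lborel))"
    using J S by (intro product_nn_integral_insert) (auto simp only: J' borel_measurable_indicator finite_Diff)
  also have "\<dots> \<le> (\<integral>\<^sup>+u. (\<integral>\<^sup>+v. indicator (sphere (0::'a) (norm (u b))) v \<partial>lborel) \<partial>PiM (J - {a}) (\<lambda>_. lborel :: 'a measure))"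
    using J by (intro nn_integral_mono) (auto simp: S_def indicator_def intro!: nn_integral_mono)
  also have "\<dots> = 0"
  proof -
    have "emeasure lborel (sphere (0::'a) \<rho>) = 0" for \<rho>
      using negligible_sphere[of "0::'a" \<rho>] by (simp add: negligible_iff_null_sets null_sets_def)
    then show ?thesis by simp
  qed
  finally have "S \<in> null_sets (PiM J (\<lambda>_. lborel))" by (simp add: null_sets_def)
  then show ?thesis by (rule AE_I') (auto simp: S_def)
qed

lemma borel_measurable_indicator_argmax:
  assumes "finite J" "i \<in> J"
  shows "(\<lambda>u. indicator {w. \<forall>j\<in>J. norm (w j) \<le> norm (w i)} u :: ennreal)
    \<in> borel_measurable (PiM J (\<lambda>_. borel :: 'a::euclidean_space measure))"
proof -
  have comp: "(\<lambda>u. norm (u j)) \<in> borel_measurable (PiM J (\<lambda>_. borel :: 'a measure))" if "j \<in> J" for j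
    using measurable_compose[OF measurable_component_singleton[OF that, of "\<lambda>_. borel :: 'a measure"] borel_measurable_norm]
    by simp
  have "Measurable.pred (PiM J (\<lambda>_. borel)) (\<lambda>u. \<forall>j\<in>J. norm (u j :: 'a) \<le> norm (u i))"
  proof (intro pred_intros_finite assms)
    fix j assume "j \<in> J"
    then show "Measurable.pred (PiM J (\<lambda>_. borel)) (\<lambda>u. norm (u j :: 'a) \<le> norm (u i))"
      unfolding pred_def using assms by (intro borel_measurable_le comp)
  qed
  then have "(\<lambda>u. if \<forall>j\<in>J. norm (u j) \<le> norm (u i) then 1 else 0 :: ennreal)
      \<in> borel_measurable (PiM J (\<lambda>_. borel :: 'a measure))"
    by (intro measurable_If) auto
  then show ?thesis unfolding indicator_def of_bool_def mem_Collect_eq .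
qed

text \<open>Almost everywhere exactly one coordinate has the largest norm, so the k regions
  "coordinate i is farthest" partition the space up to a null set. The transposition of 0 and i
  carries region i to region 0 and preserves both the measure and \<Phi>.\<close>

lemma nn_integral_symmetric_argmax:
  fixes \<Phi> :: "(nat \<Rightarrow> 'a::euclidean_space) \<Rightarrow> ennreal"
  assumes k: "1 \<le> k" and [measurable]: "\<Phi> \<in> borel_measurable (PiM {..<k} (\<lambda>_. borel))"
    and sym: "\<And>\<pi> u. \<pi> permutes {..<k} \<Longrightarrow> \<Phi> (\<lambda>j\<in>{..<k}. u (\<pi> j)) = \<Phi> u"
  shows "(\<integral>\<^sup>+u. \<Phi> u \<partial>PiM {..<k} (\<lambda>_. lborel)) =
    of_nat k * (\<integral>\<^sup>+u. \<Phi> u * indicator {u. \<forall>j\<in>{..<k}. norm (u j) \<le> norm (u 0)} u \<partial>PiM {..<k} (\<lambda>_. lborel))"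
proof -
  let ?M = "PiM {..<k} (\<lambda>_. lborel :: 'a measure)"
  define A where "A i = {u :: nat \<Rightarrow> 'a. \<forall>j\<in>{..<k}. norm (u j) \<le> norm (u i)}" for i
  have [measurable_cong]: "sets ?M = sets (PiM {..<k} (\<lambda>_. borel))"
    by (auto cong: sets_PiM_cong)
  have [measurable]: "(\<lambda>u. indicator (A i) u :: ennreal) \<in> borel_measurable (PiM {..<k} (\<lambda>_. borel))" if "i < k" for i
    unfolding A_def using that by (intro borel_measurable_indicator_argmax) auto
  have one: "AE u in ?M. (\<Sum>i<k. indicator (A i) u) = (1 :: ennreal)"
  proof -
    have "AE u in ?M. \<forall>a\<in>{..<k}. \<forall>b\<in>{..<k}. a \<noteq> b \<longrightarrow> norm (u a) \<noteq> norm (u b)"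
      by (intro AE_finite_allI) (auto intro: AE_PiM_lborel_norm_neq)
    then show ?thesis
    proof eventually_elim
      case (elim u)
      have "finite ((\<lambda>j. norm (u j)) ` {..<k})" "(\<lambda>j. norm (u j)) ` {..<k} \<noteq> {}" using k by (auto simp: lessThan_empty_iff)
      from Max_in[OF this] obtain m where m: "m < k" "norm (u m) = Max ((\<lambda>j. norm (u j)) ` {..<k})" by auto
      have max: "norm (u j) \<le> norm (u m)" if "j < k" for j
        unfolding m(2) using that by (intro Max_ge) auto
      have "indicator (A i) u = (if i = m then 1 else 0 :: ennreal)" if "i < k" for i
      proof (cases "i = m")
        case True
        then show ?thesis using max by (auto simp: A_def indicator_def)
      next
        case False
        then have "norm (u i) \<noteq> norm (u m)" using elim that m(1) by blast
        then have "\<not> norm (u m) \<le> norm (u i)" using max[OF that] by simp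
        then have "u \<notin> A i" using m(1) by (auto simp: A_def)
        then show ?thesis using False by simp
      qed
      then show ?case using m(1) by simp
    qed
  qed
  have swap: "(\<integral>\<^sup>+u. \<Phi> u * indicator (A i) u \<partial>?M) = (\<integral>\<^sup>+u. \<Phi> u * indicator (A 0) u \<partial>?M)" if i: "i < k" for i
  proof -
    define \<pi> where "\<pi> = Transposition.transpose 0 i"
    have \<pi>: "\<pi> permutes {..<k}" unfolding \<pi>_def using i k by (intro permutes_swap_id) auto
    have perm: "(\<lambda>u. \<lambda>j\<in>{..<k}. u (\<pi> j)) \<in> measurable ?M ?M"
      using permutes_in_image[OF \<pi>] by (intro measurable_restrict measurable_component_singleton) auto
    have F: "(\<lambda>u. \<Phi> u * indicator (A i) u) \<in> borel_measurable ?M"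
      using i by measurable
    have "(\<integral>\<^sup>+u. \<Phi> u * indicator (A i) u \<partial>?M) =
        (\<integral>\<^sup>+u. \<Phi> u * indicator (A i) u \<partial>distr ?M ?M (\<lambda>u. \<lambda>j\<in>{..<k}. u (\<pi> j)))"
      by (subst distr_PiM_permute[OF lborel.sigma_finite_measure_axioms _ \<pi>]) auto
    also have "\<dots> = (\<integral>\<^sup>+u. \<Phi> (\<lambda>j\<in>{..<k}. u (\<pi> j)) * indicator (A i) (\<lambda>j\<in>{..<k}. u (\<pi> j)) \<partial>?M)"
      by (rule nn_integral_distr[OF perm]) (use F in simp)
    also have "\<dots> = (\<integral>\<^sup>+u. \<Phi> u * indicator (A 0) u \<partial>?M)"
    proof (intro nn_integral_cong)
      fix u :: "nat \<Rightarrow> 'a"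
      have "(\<lambda>j\<in>{..<k}. u (\<pi> j)) \<in> A i \<longleftrightarrow> (\<forall>j\<in>{..<k}. norm (u (\<pi> j)) \<le> norm (u 0))"
        using i by (auto simp: A_def \<pi>_def)
      also have "\<dots> \<longleftrightarrow> (\<forall>j\<in>\<pi> ` {..<k}. norm (u j) \<le> norm (u 0))" by simp
      also have "\<dots> \<longleftrightarrow> u \<in> A 0" unfolding permutes_image[OF \<pi>] by (auto simp: A_def)
      finally show "\<Phi> (\<lambda>j\<in>{..<k}. u (\<pi> j)) * indicator (A i) (\<lambda>j\<in>{..<k}. u (\<pi> j)) = \<Phi> u * indicator (A 0) u"
        by (simp add: sym[OF \<pi>] indicator_def)
    qed
    finally show ?thesis .
  qed
  have "(\<Sum>i<k. \<integral>\<^sup>+u. \<Phi> u * indicator (A i) u \<partial>?M) = (\<Sum>i<k. \<integral>\<^sup>+u. \<Phi> u * indicator (A 0) u \<partial>?M)"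
    by (intro sum.cong refl swap) simp
  also have "\<dots> = of_nat k * (\<integral>\<^sup>+u. \<Phi> u * indicator (A 0) u \<partial>?M)"
    by simp
  finally have "(\<Sum>i<k. \<integral>\<^sup>+u. \<Phi> u * indicator (A i) u \<partial>?M) = of_nat k * (\<integral>\<^sup>+u. \<Phi> u * indicator (A 0) u \<partial>?M)" .
  moreover have "(\<integral>\<^sup>+u. \<Phi> u \<partial>?M) = (\<integral>\<^sup>+u. (\<Sum>i<k. \<Phi> u * indicator (A i) u) \<partial>?M)"
    using one by (intro nn_integral_cong_AE) (auto simp: sum_distrib_left[symmetric] elim!: eventually_mono)
  moreover have "\<dots> = (\<Sum>i<k. \<integral>\<^sup>+u. \<Phi> u * indicator (A i) u \<partial>?M)"
    by (intro nn_integral_sum) auto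
  ultimately show ?thesis unfolding A_def by simp
qed

subsection \<open>The limiting moments\<close>

text \<open>A sample point in the ball around \<open>y j\<close> is strictly closer to
  \<open>y j\<close> than x is, hence expels \<open>y j\<close> from the cell of x. The balls are
  open because x holds index 1 and wins every tie.\<close>

definition ball_union :: "'a::euclidean_space \<Rightarrow> 'i set \<Rightarrow> ('i \<Rightarrow> 'a) \<Rightarrow> 'a set" where
  "ball_union x J y = (\<Union>j\<in>J. ball (y j) (norm (y j - x)))"

lemma open_ball_union: "open (ball_union x J y)"
  unfolding ball_union_def by auto

lemma ball_union_borel [measurable]: "ball_union x J y \<in> sets borel"
  by (intro borel_open open_ball_union)

lemma ball_union_cong: "(\<And>j. j \<in> J \<Longrightarrow> y j = z j) \<Longrightarrow> ball_union x J y = ball_union x J z"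
  by (simp add: ball_union_def)

text \<open>The unions are the sections of one measurable set of pairs, described by finitely many
  strict inequalities; the mass of a section depends measurably on the base point.\<close>

lemma borel_measurable_emeasure_ball_union:
  fixes J :: "'i set" and x :: "'a::euclidean_space"
  assumes J: "finite J" and N: "sigma_finite_measure N" "sets N = sets borel"
  shows "(\<lambda>y. emeasure N (ball_union x J y)) \<in> borel_measurable (PiM J (\<lambda>_. borel))"
proof -
  let ?M = "PiM J (\<lambda>_. borel) :: ('i \<Rightarrow> 'a) measure"
  note [measurable_cong] = N(2)
  define Q where "Q = {p \<in> space (?M \<Otimes>\<^sub>M N). \<exists>j\<in>J. norm (fst p j - snd p) < norm (fst p j - x)}"
  have "Measurable.pred (?M \<Otimes>\<^sub>M N) (\<lambda>p. \<exists>j\<in>J. norm (fst p j - snd p) < norm (fst p j - x))"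
    using J by (intro pred_intros_finite) auto
  then have "Q \<in> sets (?M \<Otimes>\<^sub>M N)" unfolding Q_def by measurable
  then have "(\<lambda>y. emeasure N (Pair y -` Q)) \<in> borel_measurable ?M"
    by (rule sigma_finite_measure.measurable_emeasure_Pair[OF N(1)])
  moreover have "Pair y -` Q = ball_union x J y" if "y \<in> space ?M" for y
    using that sets_eq_imp_space_eq[OF N(2)]
    by (auto simp: Q_def ball_union_def space_pair_measure dist_norm)
  ultimately show ?thesis by (simp cong: measurable_cong)
qed

lemma ball_union_bounded: "finite J \<Longrightarrow> bounded (ball_union x J y)"
  unfolding ball_union_def by auto

section \<open>The uniform sample and the volume ratio \<open>W\<close>\<close>

lemma uniform_unit_ball_eq:
  "uniform_measure lborel (cball (0::'a::euclidean_space) 1) =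
    density lborel (\<lambda>x. indicator (cball 0 1) x / ennreal (measure lborel (cball (0::'a) 1)))"
  using emeasure_lborel_cball_finite[of "0::'a" 1]
  by (simp add: uniform_measure_def emeasure_eq_ennreal_measure less_top[symmetric])

lemma measure_unit_ball_pos: "0 < measure lborel (cball (0::'a::euclidean_space) 1)"
  using content_cball_pos[of 1 "0::'a"] by simp

lemma prob_space_uniform_unit_ball: "prob_space (uniform_measure lborel (cball (0::'a::euclidean_space) 1))"
  using measure_unit_ball_pos[where 'a = 'a] emeasure_lborel_cball_finite[of "0::'a" 1]
  by (intro prob_space_uniform_measure) (auto simp: emeasure_eq_ennreal_measure less_top[symmetric])

lemma prob_space_unit_ball_sample: "prob_space (unit_ball_sample k :: (nat \<Rightarrow> real^'d) measure)"
  unfolding unit_ball_sample_def by (intro prob_space_PiM prob_space_uniform_unit_ball)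

lemma sets_unit_ball_sample [measurable_cong]:
  "sets (unit_ball_sample k :: (nat \<Rightarrow> real^'d) measure) = sets (PiM {1..<k} (\<lambda>_. borel))"
  unfolding unit_ball_sample_def by (intro sets_PiM_cong) auto

text \<open>Open and closed balls differ by spheres, which are null. Index 0, free in a sample
  indexed by 1, ..., k - 1, is given to the fixed unit vector, whose ball through the origin has
  radius 1.\<close>

lemma W_eq_ball_union:
  fixes Y :: "nat \<Rightarrow> real^'d"
  assumes k: "1 \<le> k"
  shows "W i k Y = measure lborel (ball_union 0 {..<k} (Y(0 := axis i 1))) / measure lborel (cball (0::real^'d) 1)"
proof -
  let ?Y = "Y(0 := axis i 1)"
  let ?C = "\<Union>j\<in>{..<k}. cball (?Y j) (norm (?Y j))"
  have "{..<k} = insert 0 {1..<k}" using k by auto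
  then have C: "cball (axis i 1) 1 \<union> (\<Union>j\<in>{1..<k}. cball (Y j) (norm (Y j))) = ?C"
    by auto
  have "sphere a \<rho> \<in> null_sets lborel" for a :: "real^'d" and \<rho>
    using negligible_sphere[of a \<rho>] by (simp add: negligible_iff_null_sets null_sets_def)
  then have "(\<Union>j\<in>{..<k}. sphere (?Y j) (norm (?Y j))) \<in> null_sets lborel"
    by (intro null_sets_UN') auto
  from emeasure_Un_null_set[OF _ this, of "ball_union 0 {..<k} ?Y"]
  have "emeasure lborel (ball_union 0 {..<k} ?Y \<union> (\<Union>j\<in>{..<k}. sphere (?Y j) (norm (?Y j)))) =
      emeasure lborel (ball_union 0 {..<k} ?Y)" by simp
  moreover have "ball_union 0 {..<k} ?Y \<union> (\<Union>j\<in>{..<k}. sphere (?Y j) (norm (?Y j))) = ?C"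
  proof -
    have "ball a \<rho> \<union> sphere a \<rho> = cball a \<rho>" for a :: "real^'d" and \<rho> by auto
    then show ?thesis unfolding ball_union_def UN_Un_distrib[symmetric] by simp
  qed
  ultimately show ?thesis unfolding W_def C by (simp add: measure_def)
qed

lemma W_ge_1:
  fixes Y :: "nat \<Rightarrow> real^'d"
  shows "1 \<le> W i k Y"
proof -
  let ?U = "cball (axis i 1) 1 \<union> (\<Union>j\<in>{1..<k}. cball (Y j) (norm (Y j)))"
  have "bounded ?U" by auto
  then have "?U \<in> fmeasurable lborel"
    using emeasure_bounded_finite[of ?U] by (intro fmeasurableI) auto
  then have "measure lborel (cball (axis i 1 :: real^'d) 1) \<le> measure lborel ?U"
    by (intro measure_mono_fmeasurable) auto
  moreover have "measure lborel (cball (axis i 1 :: real^'d) 1) = measure lborel (cball (0 :: real^'d) 1)"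
    using content_cball[of 1 "axis i 1 :: real^'d"] content_cball[of 1 "0 :: real^'d"] by simp
  ultimately show ?thesis
    using measure_unit_ball_pos[where 'a = "real^'d"] by (simp add: W_def)
qed

lemma borel_measurable_measure_ball_union:
  assumes "finite J" "sigma_finite_measure N" "sets N = sets borel"
  shows "(\<lambda>y. measure N (ball_union x J y)) \<in> borel_measurable (PiM J (\<lambda>_. borel))"
  unfolding measure_def using borel_measurable_emeasure_ball_union[OF assms, of x] by simp

lemma fun_upd_measurable:
  fixes k :: nat
  assumes "1 \<le> k"
  shows "(\<lambda>(u, Y). Y(0 := u)) \<in> measurable (borel \<Otimes>\<^sub>M PiM {1..<k} (\<lambda>_. borel)) (PiM {..<k} (\<lambda>_. borel :: 'a::euclidean_space measure))"
proof -
  have "{..<k} = insert 0 {1..<k}" using assms by auto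
  moreover have "(\<lambda>p. (snd p)(0 := fst p)) \<in> measurable (borel \<Otimes>\<^sub>M PiM {1..<k} (\<lambda>_. borel))
      (PiM (insert 0 {1..<k}) (\<lambda>_. borel :: 'a measure))"
    by (intro measurable_fun_upd[where J = "{1..<k}"]) auto
  ultimately show ?thesis by (simp add: case_prod_beta')
qed

lemma borel_measurable_W [measurable]:
  assumes k: "1 \<le> k"
  shows "W (i::'d::finite) k \<in> borel_measurable (unit_ball_sample k)"
proof -
  have "(\<lambda>Y. Y(0 := axis i 1)) \<in> measurable (PiM {1..<k} (\<lambda>_. borel)) (PiM {..<k} (\<lambda>_. borel :: (real^'d) measure))"
    using measurable_compose[OF measurable_Pair1' fun_upd_measurable[OF k, where 'a = "real^'d"], of "axis i 1"]
    by simp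
  from measurable_compose[OF this borel_measurable_measure_ball_union[OF _ lborel.sigma_finite_measure_axioms, of _ 0]]
  have "(\<lambda>Y. measure lborel (ball_union 0 {..<k} (Y(0 := axis i 1 :: real^'d)))) \<in> borel_measurable (PiM {1..<k} (\<lambda>_. borel))"
    by simp
  then show ?thesis
    unfolding W_eq_ball_union[OF k, abs_def]
    by (subst measurable_cong_sets[OF sets_unit_ball_sample refl])
      (intro borel_measurable_divide borel_measurable_const)
qed

lemma W_moment_bounds:
  fixes i :: "'d::finite"
  assumes k: "1 \<le> k"
  shows "integrable (unit_ball_sample k) (\<lambda>Y. fact k / W i k Y ^ k)"
    and "(\<integral>Y. fact k / W i k Y ^ k \<partial>unit_ball_sample k) \<le> fact k"
proof -
  interpret prob_space "unit_ball_sample k :: (nat \<Rightarrow> real^'d) measure" by (rule prob_space_unit_ball_sample)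
  have le: "fact k / W i k Y ^ k \<le> fact k" for Y :: "nat \<Rightarrow> real^'d"
    using W_ge_1[of i k Y] by (simp add: divide_le_eq one_le_power)
  have nn: "0 \<le> fact k / W i k Y ^ k" for Y :: "nat \<Rightarrow> real^'d"
    using W_ge_1[of i k Y] by simp
  note [measurable] = borel_measurable_W[OF k, of i]
  show int: "integrable (unit_ball_sample k) (\<lambda>Y. fact k / W i k Y ^ k)"
  proof (rule integrable_const_bound)
    show "AE Y in unit_ball_sample k. norm (fact k / W i k Y ^ k) \<le> fact k"
      using le nn by (intro AE_I2) (simp only: real_norm_def abs_of_nonneg)
  qed measurable
  show "(\<integral>Y. fact k / W i k Y ^ k \<partial>unit_ball_sample k) \<le> fact k"
    using integral_mono[OF int _ le] by (simp add: prob_space)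
qed

text \<open>In the coordinate t = V * |u|^d this is c^k times the integral of t^(k-1) * exp (- c * w
  * t) over the half-line, a gamma integral with value (k-1)! / (c * w)^k. The power of c cancels
  here, which frees the limit law from f x.\<close>

lemma nn_integral_gamma_radial:
  fixes c w :: real
  defines "V \<equiv> measure lborel (cball (0::'a::euclidean_space) 1)"
  assumes "0 < c" "0 < w" "1 \<le> k"
  shows "(\<integral>\<^sup>+u. ennreal (c ^ k * (V * norm (u::'a) ^ DIM('a)) ^ (k - 1) * exp (- c * (V * norm u ^ DIM('a)) * w)) \<partial>lborel)
    = ennreal (fact (k - 1) / w ^ k)"
proof -
  define l where "l = c * w"
  have l: "0 < l" using assms by (simp add: l_def)
  define g where "g t = ennreal (c ^ k * t ^ (k - 1) * exp (- c * t * w))" for t :: real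
  have [measurable]: "g \<in> borel_measurable borel" unfolding g_def by measurable
  have "(\<integral>\<^sup>+u. g (V * norm (u::'a) ^ DIM('a)) \<partial>lborel) =
      (\<integral>\<^sup>+t. g t \<partial>distr lborel borel (\<lambda>u::'a. V * norm u ^ DIM('a)))"
    by (intro nn_integral_distr[symmetric]) auto
  also have "\<dots> = (\<integral>\<^sup>+t. indicator {0..} t * g t \<partial>lborel)"
    unfolding V_def distr_lborel_radial by (intro nn_integral_density) auto
  also have "\<dots> = (\<integral>\<^sup>+t. ennreal (fact (k - 1) / w ^ k) * ennreal (erlang_density (k - 1) l t) \<partial>lborel)"
  proof (intro nn_integral_cong)
    fix t :: real
    have "c ^ k * t ^ (k - 1) * exp (- c * t * w) = fact (k - 1) / w ^ k * erlang_density (k - 1) l t" if "0 \<le> t"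
      using that assms by (simp add: erlang_density_def l_def power_mult_distrib mult_ac)
    then show "indicator {0..} t * g t = ennreal (fact (k - 1) / w ^ k) * ennreal (erlang_density (k - 1) l t)"
      using assms l by (auto simp: g_def indicator_def ennreal_mult[symmetric] erlang_density_def)
  qed
  also have "\<dots> = ennreal (fact (k - 1) / w ^ k)"
    using nn_integral_erlang_ith_moment[OF l, of "k - 1" 0] by (simp add: nn_integral_cmult)
  finally show ?thesis by (simp add: g_def)
qed


text \<open>Since \<open>T\<close> multiplies all distances by r and fixes the origin, the preimage
  of the union at the points \<open>T (y j)\<close> is the union at the \<open>y j\<close>; the
  Jacobian gives the factor.\<close>

lemma ball_union_similarity:
  fixes T :: "'a::euclidean_space \<Rightarrow> 'a"
  assumes T: "linear T" and r: "0 < r" and norm_T: "\<And>v. norm (T v) = r * norm v"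
  shows "measure lborel (ball_union 0 J (\<lambda>j. T (y j))) = r ^ DIM('a) * measure lborel (ball_union 0 J y)"
proof -
  have T_cont[measurable]: "T \<in> borel_measurable borel"
    using T by (intro borel_measurable_continuous_onI linear_continuous_on) (simp add: linear_conv_bounded_linear)
  have "dist (T a) (T b) = r * dist a b" for a b
    by (simp add: dist_norm norm_T flip: linear_diff[OF T])
  then have "T -` ball_union 0 J (\<lambda>j. T (y j)) = ball_union 0 J y"
    using r by (auto simp: ball_union_def norm_T)
  moreover have "emeasure (density (distr lborel borel T) (\<lambda>_. ennreal (r ^ DIM('a)))) A =
      ennreal (r ^ DIM('a)) * emeasure lborel (T -` A)" if "A \<in> sets borel" for A
    using that by (simp add: emeasure_density nn_integral_cmult emeasure_distr nn_integral_distr)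
  ultimately have "emeasure lborel (ball_union 0 J (\<lambda>j. T (y j))) =
      ennreal (r ^ DIM('a)) * emeasure lborel (ball_union 0 J y)"
    using emeasure_lborel_similarity[OF T r norm_T] by (metis ball_union_borel)
  then show ?thesis using r by (simp add: measure_def enn2real_mult)
qed

text \<open>Scaling and rotating so that the farthest point becomes \<open>axis i 1\<close>, the other points
  become uniform in the unit ball.\<close>

lemma nn_integral_exp_ball_union_farthest:
  fixes u :: "real^'d" and i :: 'd and k :: nat
  defines "V \<equiv> measure lborel (cball (0::real^'d) 1)"
  assumes u: "u \<noteq> 0" and c: "0 < c" and k: "1 \<le> k"
  shows "(\<integral>\<^sup>+Y. ennreal (c ^ k * exp (- c * measure lborel (ball_union 0 {..<k} (Y(0 := u))))) *
      indicator {w. \<forall>j\<in>{..<k}. norm (w j) \<le> norm (w 0)} (Y(0 := u)) \<partial>PiM {1..<k} (\<lambda>_. lborel)) =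
    (\<integral>\<^sup>+Y. ennreal (c ^ k * (V * norm u ^ CARD('d)) ^ (k - 1) * exp (- c * (V * norm u ^ CARD('d)) * W i k Y))
      \<partial>unit_ball_sample k)"
proof -
  define r where "r = norm u"
  define e :: "real^'d" where "e = axis i 1"
  have r: "0 < r" using u by (simp add: r_def)
  have V: "0 < V" unfolding V_def by (rule measure_unit_ball_pos)
  have insert: "{..<k} = insert 0 {1..<k}" using k by auto
  have "norm e = norm ((1 / r) *\<^sub>R u)" using r by (simp add: e_def r_def)
  then obtain Q where Q: "orthogonal_transformation Q" "Q e = (1 / r) *\<^sub>R u"
    using orthogonal_transformation_exists by blast
  \<comment> \<open>\<open>T\<close> carries the unit vector \<open>e\<close> to u and the unit ball
    to the ball of radius \<open>norm u\<close>, the region left to the other points when u is the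
    farthest.\<close>
  define T where "T v = r *\<^sub>R Q v" for v
  have T: "linear T" unfolding T_def using orthogonal_transformation_linear[OF Q(1)]
    by (intro linear_compose_scale_right)
  have norm_T: "norm (T v) = r * norm v" for v
    using r orthogonal_transformation_norm[OF Q(1), of v] by (simp add: T_def)
  have Te: "T e = u" using r by (simp add: T_def Q)
  have T_cont[measurable]: "T \<in> borel_measurable borel"
    using T by (intro borel_measurable_continuous_onI linear_continuous_on) (simp add: linear_conv_bounded_linear)
  define \<Phi> where "\<Phi> w = ennreal (c ^ k * exp (- c * measure lborel (ball_union 0 {..<k} w))) *
    indicator {w. \<forall>j\<in>{..<k}. norm (w j) \<le> norm (w 0)} w" for w :: "nat \<Rightarrow> real^'d"
  define F where "F Y = ennreal (c ^ k * exp (- c * measure lborel (ball_union 0 {..<k} (Y(0 := u))))) *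
      indicator (Pi\<^sub>E {1..<k} (\<lambda>_. cball 0 r)) Y" for Y :: "nat \<Rightarrow> real^'d"
  have upd: "(\<lambda>Y. Y(0 := u)) \<in> measurable (PiM {1..<k} (\<lambda>_. borel)) (PiM {..<k} (\<lambda>_. borel))"
    using measurable_compose[OF measurable_Pair1' fun_upd_measurable[OF k, where 'a = "real^'d"], of u] by simp
  have [measurable]: "(\<lambda>Y. measure lborel (ball_union 0 {..<k} (Y(0 := u)))) \<in> borel_measurable (PiM {1..<k} (\<lambda>_. borel))"
    using measurable_compose[OF upd borel_measurable_measure_ball_union[OF _ lborel.sigma_finite_measure_axioms]] by simp
  have "(\<lambda>Y. ennreal (c ^ k * exp (- c * measure lborel (ball_union 0 {..<k} (Y(0 := u))))))
      \<in> borel_measurable (PiM {1..<k} (\<lambda>_. borel))"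
    by measurable
  then have F_meas: "F \<in> borel_measurable (PiM {1..<k} (\<lambda>_. borel))"
    unfolding F_def
    by (rule borel_measurable_times_ennreal) (intro borel_measurable_indicator sets_PiM_I_finite; simp)
  have "(\<integral>\<^sup>+Y. \<Phi> (Y(0 := u)) \<partial>PiM {1..<k} (\<lambda>_. lborel)) = (\<integral>\<^sup>+Y. F Y \<partial>PiM {1..<k} (\<lambda>_. lborel))"
    by (intro nn_integral_cong)
      (auto simp: \<Phi>_def F_def insert r_def space_PiM PiE_iff indicator_def)
  also have "\<dots> = (\<integral>\<^sup>+Y. F Y \<partial>PiM {1..<k} (\<lambda>_. density lborel (\<lambda>_. 1)))"
    by (simp add: density_1)
  also have "\<dots> = (\<integral>\<^sup>+v. (\<Prod>j\<in>{1..<k}. ennreal (r ^ DIM(real^'d)) * 1) * F (\<lambda>j\<in>{1..<k}. T (v j)) \<partial>PiM {1..<k} (\<lambda>_. lborel))"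
    by (rule nn_integral_PiM_change_of_variables[OF _ T_cont emeasure_lborel_similarity[OF T r norm_T] _ _ F_meas]) auto
  \<comment> \<open>The k - 1 Jacobians r^d, together with the factor V^(k-1) that compensates the
    normalisation of the uniform densities, make up (V * r^d)^(k-1).\<close>
  also have "\<dots> = (\<integral>\<^sup>+v. (\<Prod>j\<in>{1..<k}. indicator (cball 0 1) (v j) / ennreal V) *
      ennreal (c ^ k * (V * r ^ CARD('d)) ^ (k - 1) * exp (- c * (V * r ^ CARD('d)) * W i k v)) \<partial>PiM {1..<k} (\<lambda>_. lborel))"
  proof (intro nn_integral_cong)
    fix v :: "nat \<Rightarrow> real^'d"
    have "ball_union 0 {..<k} ((\<lambda>j\<in>{1..<k}. T (v j))(0 := u)) = ball_union 0 {..<k} (\<lambda>j. T ((v(0 := e)) j))"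
      by (intro ball_union_cong) (auto simp: Te insert)
    then have m: "measure lborel (ball_union 0 {..<k} ((\<lambda>j\<in>{1..<k}. T (v j))(0 := u))) = r ^ CARD('d) * (V * W i k v)"
      unfolding ball_union_similarity[OF T r norm_T] \<open>ball_union 0 {..<k} _ = _\<close>
      using V by (simp add: W_eq_ball_union[OF k] V_def[symmetric] e_def del: fun_upd_apply)
    show "(\<Prod>j\<in>{1..<k}. ennreal (r ^ DIM(real^'d)) * 1) * F (\<lambda>j\<in>{1..<k}. T (v j)) =
        (\<Prod>j\<in>{1..<k}. indicator (cball 0 1) (v j) / ennreal V) *
        ennreal (c ^ k * (V * r ^ CARD('d)) ^ (k - 1) * exp (- c * (V * r ^ CARD('d)) * W i k v))"
    proof (cases "\<forall>j\<in>{1..<k}. v j \<in> cball 0 1")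
      case True
      then have "F (\<lambda>j\<in>{1..<k}. T (v j)) = ennreal (c ^ k * exp (- c * (r ^ CARD('d) * (V * W i k v))))"
        using r unfolding F_def m by (auto simp: norm_T indicator_def PiE_iff)
      moreover have "(\<Prod>j\<in>{1..<k}. indicator (cball 0 1) (v j) / ennreal V) = ennreal ((1 / V) ^ (k - 1))"
        using True V by (simp add: divide_ennreal[symmetric] ennreal_power[symmetric])
      moreover have "(\<Prod>j\<in>{1..<k}. ennreal (r ^ DIM(real^'d)) * 1) = ennreal ((r ^ CARD('d)) ^ (k - 1))"
        using r by (simp add: ennreal_power)
      ultimately show ?thesis
        using V r c by (simp add: ennreal_mult[symmetric] power_mult_distrib power_divide mult_ac)
    next
      case False
      then obtain j where j: "j \<in> {1..<k}" "v j \<notin> cball 0 1" by blast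
      then have "F (\<lambda>j\<in>{1..<k}. T (v j)) = 0"
        using r by (auto simp: F_def norm_T indicator_def PiE_iff intro!: bexI[of _ j])
      moreover have "(\<Prod>j\<in>{1..<k}. indicator (cball 0 1) (v j) / ennreal V) = 0"
        using j by (intro prod_zero) (auto intro!: bexI[of _ j])
      ultimately show ?thesis by simp
    qed
  qed
  also have "\<dots> = (\<integral>\<^sup>+Y. ennreal (c ^ k * (V * r ^ CARD('d)) ^ (k - 1) * exp (- c * (V * r ^ CARD('d)) * W i k Y))
      \<partial>density (PiM {1..<k} (\<lambda>_. lborel)) (\<lambda>v. \<Prod>j\<in>{1..<k}. indicator (cball 0 1) (v j) / ennreal V))"
  proof (intro nn_integral_density[symmetric])
    have "W i k \<in> borel_measurable (PiM {1..<k} (\<lambda>_. lborel))"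
      using borel_measurable_W[OF k, of i] unfolding unit_ball_sample_def
      by (subst (asm) measurable_cong_sets[OF sets_PiM_cong[OF refl, of _ _ "\<lambda>_. lborel"] refl]) auto
    note [measurable] = this
    show "(\<lambda>Y. ennreal (c ^ k * (V * r ^ CARD('d)) ^ (k - 1) * exp (- c * (V * r ^ CARD('d)) * W i k Y)))
      \<in> borel_measurable (PiM {1..<k} (\<lambda>_. lborel))" by measurable
  qed measurable
  also have "density (PiM {1..<k} (\<lambda>_. lborel :: (real^'d) measure)) (\<lambda>v. \<Prod>j\<in>{1..<k}. indicator (cball 0 1) (v j) / ennreal V) =
      unit_ball_sample k"
    unfolding unit_ball_sample_def uniform_unit_ball_eq V_def
    by (rule PiM_density_sigma_finite[symmetric,
          where g = "\<lambda>x. indicator (cball 0 1) x / ennreal (measure lborel (cball (0::real^'d) 1))"])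
      (auto simp flip: uniform_unit_ball_eq intro!: prob_space_imp_sigma_finite prob_space_uniform_unit_ball
        lborel.sigma_finite_measure_axioms)
  finally show ?thesis unfolding \<Phi>_def r_def .
qed

text \<open>By symmetry, demanding that u 0 be the farthest point is paid for by a factor k. After
  the substitution \<open>W i k Y\<close> no longer depends on u, so exchanging the integrals
  reduces the inner one to the radial gamma integral with w = \<open>W i k Y\<close>.\<close>

lemma nn_integral_exp_ball_union:
  fixes i :: "'d::finite"
  assumes k: "1 \<le> k" and c: "0 < c"
  shows "(\<integral>\<^sup>+u. ennreal (c ^ k * exp (- c * measure lborel (ball_union (0::real^'d) {..<k} u))) \<partial>PiM {..<k} (\<lambda>_. lborel)) =
    ennreal (\<integral>Y. fact k / W i k Y ^ k \<partial>unit_ball_sample k)"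
proof -
  interpret P: product_sigma_finite "\<lambda>_. lborel :: (real^'d) measure" by standard
  interpret S: prob_space "unit_ball_sample k :: (nat \<Rightarrow> real^'d) measure" by (rule prob_space_unit_ball_sample)
  interpret pair_sigma_finite "lborel :: (real^'d) measure" "unit_ball_sample k :: (nat \<Rightarrow> real^'d) measure" by standard
  define V where "V = measure lborel (cball (0::real^'d) 1)"
  have V: "0 < V" unfolding V_def by (rule measure_unit_ball_pos)
  define A where "A = {w :: nat \<Rightarrow> real^'d. \<forall>j\<in>{..<k}. norm (w j) \<le> norm (w 0)}"
  define \<Phi> where "\<Phi> u = ennreal (c ^ k * exp (- c * measure lborel (ball_union 0 {..<k} u)))" for u :: "nat \<Rightarrow> real^'d"
  have insert: "{..<k} = insert 0 {1..<k}" using k by auto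
  have [measurable_cong]: "sets (PiM {..<k} (\<lambda>_. lborel :: (real^'d) measure)) = sets (PiM {..<k} (\<lambda>_. borel))"
    by (auto cong: sets_PiM_cong)
  have m: "(\<lambda>y. measure lborel (ball_union (0::real^'d) {..<k} y)) \<in> borel_measurable (PiM {..<k} (\<lambda>_. borel))"
    by (intro borel_measurable_measure_ball_union lborel.sigma_finite_measure_axioms) auto
  have \<Phi>_meas[measurable]: "\<Phi> \<in> borel_measurable (PiM {..<k} (\<lambda>_. borel))"
    unfolding \<Phi>_def using m by measurable
  have A_meas[measurable]: "(indicator A :: _ \<Rightarrow> ennreal) \<in> borel_measurable (PiM {..<k} (\<lambda>_. borel))"
    unfolding A_def using k by (intro borel_measurable_indicator_argmax) auto
  have sym: "\<Phi> (\<lambda>j\<in>{..<k}. u (\<pi> j)) = \<Phi> u" if "\<pi> permutes {..<k}" for \<pi> u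
  proof -
    have "ball_union 0 {..<k} (\<lambda>j\<in>{..<k}. u (\<pi> j)) = (\<Union>j\<in>\<pi> ` {..<k}. ball (u j) (norm (u j - 0)))"
      by (auto simp: ball_union_def)
    also have "\<dots> = ball_union 0 {..<k} u"
      unfolding permutes_image[OF that] by (simp add: ball_union_def)
    finally show ?thesis by (simp add: \<Phi>_def)
  qed
  have "(\<integral>\<^sup>+u. \<Phi> u \<partial>PiM {..<k} (\<lambda>_. lborel)) =
      of_nat k * (\<integral>\<^sup>+u. \<Phi> u * indicator A u \<partial>PiM {..<k} (\<lambda>_. lborel))"
    unfolding A_def by (intro nn_integral_symmetric_argmax k \<Phi>_meas sym)
  also have "(\<integral>\<^sup>+u. \<Phi> u * indicator A u \<partial>PiM {..<k} (\<lambda>_. lborel)) =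
      (\<integral>\<^sup>+u. (\<integral>\<^sup>+Y. \<Phi> (Y(0 := u)) * indicator A (Y(0 := u)) \<partial>PiM {1..<k} (\<lambda>_. lborel)) \<partial>lborel)"
  proof -
    have "(\<lambda>u. \<Phi> u * indicator A u) \<in> borel_measurable (PiM (insert 0 {1..<k}) (\<lambda>_. lborel))"
      unfolding insert[symmetric] by measurable
    then show ?thesis unfolding insert by (intro P.product_nn_integral_insert_rev) auto
  qed
  also have "\<dots> = (\<integral>\<^sup>+u. (\<integral>\<^sup>+Y. ennreal (c ^ k * (V * norm u ^ CARD('d)) ^ (k - 1) *
      exp (- c * (V * norm u ^ CARD('d)) * W i k Y)) \<partial>unit_ball_sample k) \<partial>(lborel :: (real^'d) measure))"
  proof (intro nn_integral_cong_AE)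
    \<comment> \<open>The rotation needs a direction of u, so the origin is discarded as a null
      set.\<close>
    have "AE u in lborel. u \<noteq> (0 :: real^'d)"
      by (rule AE_lborel_singleton)
    then show "AE u in lborel. (\<integral>\<^sup>+Y. \<Phi> (Y(0 := u)) * indicator A (Y(0 := u)) \<partial>PiM {1..<k} (\<lambda>_. lborel)) =
        (\<integral>\<^sup>+Y. ennreal (c ^ k * (V * norm u ^ CARD('d)) ^ (k - 1) *
          exp (- c * (V * norm u ^ CARD('d)) * W i k Y)) \<partial>unit_ball_sample k)"
      unfolding \<Phi>_def A_def V_def
      by eventually_elim (rule nn_integral_exp_ball_union_farthest[OF _ c k])
  qed
  also have "\<dots> = (\<integral>\<^sup>+Y. (\<integral>\<^sup>+u. ennreal (c ^ k * (V * norm u ^ CARD('d)) ^ (k - 1) *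
      exp (- c * (V * norm u ^ CARD('d)) * W i k Y)) \<partial>(lborel :: (real^'d) measure)) \<partial>unit_ball_sample k)"
  proof (rule Fubini'[symmetric])
    note [measurable] = borel_measurable_W[OF k, of i]
    show "(\<lambda>(u, Y). ennreal (c ^ k * (V * norm u ^ CARD('d)) ^ (k - 1) * exp (- c * (V * norm u ^ CARD('d)) * W i k Y)))
      \<in> borel_measurable ((lborel :: (real^'d) measure) \<Otimes>\<^sub>M unit_ball_sample k)"
      by measurable
  qed
  also have "\<dots> = (\<integral>\<^sup>+Y. ennreal (fact (k - 1) / W i k Y ^ k) \<partial>unit_ball_sample k)"
    using nn_integral_gamma_radial[where 'a = "real^'d", OF c _ k] W_ge_1[of i k]
    by (intro nn_integral_cong) (simp add: V_def less_le_trans[OF zero_less_one])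
  also have "of_nat k * (\<integral>\<^sup>+Y. ennreal (fact (k - 1) / W i k Y ^ k) \<partial>unit_ball_sample k) =
      (\<integral>\<^sup>+Y. ennreal (fact k / W i k Y ^ k) \<partial>unit_ball_sample k)"
  proof -
    note [measurable] = borel_measurable_W[OF k, of i]
    have "of_nat k * (\<integral>\<^sup>+Y. ennreal (fact (k - 1) / W i k Y ^ k) \<partial>unit_ball_sample k) =
      (\<integral>\<^sup>+Y. ennreal (real k) * ennreal (fact (k - 1) / W i k Y ^ k) \<partial>unit_ball_sample k)"
      by (subst nn_integral_cmult) (auto simp: ennreal_of_nat_eq_real_of_nat)
    also have "\<dots> = (\<integral>\<^sup>+Y. ennreal (fact k / W i k Y ^ k) \<partial>unit_ball_sample k)"
      using k W_ge_1[of i k]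
      by (intro nn_integral_cong) (simp add: ennreal_mult'[symmetric] fact_reduce[of k])
    finally show ?thesis .
  qed
  also have "\<dots> = ennreal (\<integral>Y. fact k / W i k Y ^ k \<partial>unit_ball_sample k)"
    by (intro nn_integral_eq_integral W_moment_bounds k AE_I2 divide_nonneg_nonneg zero_le_power)
      (use W_ge_1 in \<open>auto intro: order_trans[OF zero_le_one]\<close>)
  finally show ?thesis by (simp add: \<Phi>_def)
qed

subsection \<open>The moments of the cell measure\<close>

text \<open>The tie-breaking clause is vacuous for index 1, and comparing index 1 with itself is
  trivial. Overwriting the first point by x expresses the conditioning on X 1 = x.\<close>

lemma voronoi_cell_first:
  assumes "1 \<le> n"
  shows "voronoi_cell n (Z(1 := x)) 1 = {y. \<forall>j\<in>{2..n}. norm (y - x) \<le> norm (y - Z j)}"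
proof -
  have "{1..n} = insert 1 {2..n}" using assms by auto
  then show ?thesis by (auto simp: voronoi_cell_def)
qed

lemma voronoi_cell_first_borel:
  "{y. \<forall>j\<in>J. norm (y - x) \<le> norm (y - Z j)} \<in> sets (borel :: 'a::euclidean_space measure)"
proof -
  have "{y. \<forall>j\<in>J. norm (y - x) \<le> norm (y - Z j)} = (\<Inter>j\<in>J. {y. norm (y - x) \<le> norm (y - Z j)})"
    by auto
  also have "closed \<dots>"
    by (intro closed_INT ballI closed_Collect_le continuous_intros)
  finally show ?thesis by simp
qed

lemma PiM_power_emeasure:
  fixes A :: "'a set"
  assumes "prob_space \<mu>" "A \<in> sets \<mu>"
  shows "emeasure \<mu> A ^ k = (\<integral>\<^sup>+y. (\<Prod>i<k. indicator A (y i)) \<partial>PiM {..<k::nat} (\<lambda>_. \<mu>))"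
proof -
  interpret prob_space \<mu> by fact
  interpret product_sigma_finite "\<lambda>_. \<mu>" by standard
  show ?thesis using assms(2) by (subst product_nn_integral_prod) auto
qed

context
  fixes \<mu> :: "(real^'d) measure" and M :: "'a measure" and X :: "nat \<Rightarrow> 'a \<Rightarrow> real^'d" and x :: "real^'d"
  assumes \<mu>: "prob_space \<mu>" and sets_\<mu>: "sets \<mu> = sets borel" and M: "prob_space M"
    and indep: "prob_space.indep_vars M (\<lambda>_. borel) X {1..}"
    and distr_X: "\<And>j. 1 \<le> j \<Longrightarrow> distr M borel (X j) = \<mu>"
begin

lemma X_measurable: "1 \<le> j \<Longrightarrow> X j \<in> measurable M borel"
  using indep M by (auto simp: prob_space.indep_vars_def)

lemma prob_avoid:
  assumes U: "U \<in> sets borel"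
  shows "emeasure M {\<omega>\<in>space M. \<forall>j\<in>{2..n}. X j \<omega> \<notin> U} = ennreal ((1 - measure \<mu> U) ^ (n - 1))"
proof -
  interpret M: prob_space M by (rule M)
  interpret \<mu>: prob_space \<mu> by (rule \<mu>)
  have one: "M.prob (X j -` (- U) \<inter> space M) = 1 - measure \<mu> U" if "1 \<le> j" for j
  proof -
    have "M.prob (X j -` (- U) \<inter> space M) = measure \<mu> (- U)"
      using measure_distr[OF X_measurable[OF that], of "- U"] U by (simp add: distr_X[OF that])
    moreover have "- U = space \<mu> - U"
      using sets_eq_imp_space_eq[OF sets_\<mu>] by auto
    then have "measure \<mu> (- U) = 1 - measure \<mu> U"
      using U by (simp add: \<mu>.prob_compl sets_\<mu>)
    ultimately show ?thesis by simp
  qed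
  have "M.prob {\<omega>\<in>space M. \<forall>j\<in>{2..n}. X j \<omega> \<notin> U} = (1 - measure \<mu> U) ^ (n - 1)"
  proof (cases "2 \<le> n")
    case True
    have "{\<omega>\<in>space M. \<forall>j\<in>{2..n}. X j \<omega> \<notin> U} = (\<Inter>j\<in>{2..n}. X j -` (- U) \<inter> space M)"
      using True by auto
    also have "M.prob \<dots> = (\<Prod>j\<in>{2..n}. M.prob (X j -` (- U) \<inter> space M))"
      using True U by (intro M.indep_varsD[OF indep]) auto
    also have "\<dots> = (\<Prod>j\<in>{2..n}. 1 - measure \<mu> U)"
      by (intro prod.cong one) auto
    finally show ?thesis by simp
  next
    \<comment> \<open>With n \<le> 1 there are no other points; truncated subtraction makes the
      exponent 0, so both sides are 1.\<close>
    case False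
    then have "n - 1 = 0" "{2..n} = {}" by auto
    then show ?thesis by (simp add: M.prob_space)
  qed
  then show ?thesis by (simp add: M.emeasure_eq_measure)
qed

lemma voronoi_indicator_measurable:
  assumes "finite I"
  shows "(\<lambda>(\<omega>, y). \<Prod>i\<in>I. indicator {y. \<forall>j\<in>{2..n}. norm (y - x) \<le> norm (y - X j \<omega>)} (y i) :: ennreal)
    \<in> borel_measurable (M \<Otimes>\<^sub>M PiM I (\<lambda>_. \<mu>))"
proof -
  have s: "sets (M \<Otimes>\<^sub>M PiM I (\<lambda>_. \<mu>)) = sets (M \<Otimes>\<^sub>M PiM I (\<lambda>_. borel))"
    by (intro sets_pair_measure_cong sets_PiM_cong refl sets_\<mu>)
  have "Measurable.pred (M \<Otimes>\<^sub>M PiM I (\<lambda>_. borel)) (\<lambda>p. \<forall>j\<in>{2..n}. norm (snd p i - x) \<le> norm (snd p i - X j (fst p)))"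
    if i: "i \<in> I" for i
  proof (intro pred_intros_finite)
    fix j :: nat assume "j \<in> {2..n}"
    then have "X j \<in> measurable M borel" by (intro X_measurable) auto
    note [measurable] = this
    have [measurable]: "(\<lambda>p. snd p i) \<in> borel_measurable (M \<Otimes>\<^sub>M PiM I (\<lambda>_. borel :: (real^'d) measure))"
      using i by measurable
    show "Measurable.pred (M \<Otimes>\<^sub>M PiM I (\<lambda>_. borel)) (\<lambda>p. norm (snd p i - x) \<le> norm (snd p i - X j (fst p)))"
      by measurable
  qed simp
  then have "(\<lambda>p. if \<forall>j\<in>{2..n}. norm (snd p i - x) \<le> norm (snd p i - X j (fst p)) then 1 else 0 :: ennreal)
      \<in> borel_measurable (M \<Otimes>\<^sub>M PiM I (\<lambda>_. borel))" if "i \<in> I" for i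
    using that by (intro measurable_If) auto
  then show ?thesis
    unfolding case_prod_beta' indicator_def of_bool_def mem_Collect_eq measurable_cong_sets[OF s refl]
    by (intro borel_measurable_prod_ennreal) auto
qed

text \<open>Fubini fixes the test points before the sample. For fixed test points, lying in the cell
  becomes an avoidance event for independent sample points, whose probability is a pure
  power.\<close>

lemma nn_integral_voronoi_power:
  assumes n: "1 \<le> n"
  shows "(\<integral>\<^sup>+\<omega>. emeasure \<mu> (voronoi_cell n ((\<lambda>j. X j \<omega>)(1 := x)) 1) ^ k \<partial>M) =
    (\<integral>\<^sup>+y. ennreal ((1 - measure \<mu> (ball_union x {..<k} y)) ^ (n - 1)) \<partial>PiM {..<k} (\<lambda>_. \<mu>))"
proof -
  interpret M: prob_space M by (rule M)
  interpret P: prob_space "PiM {..<k} (\<lambda>_. \<mu>)" by (intro prob_space_PiM \<mu>)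
  interpret pair_sigma_finite M "PiM {..<k} (\<lambda>_. \<mu>)" by standard
  define S where "S \<omega> = {y. \<forall>j\<in>{2..n}. norm (y - x) \<le> norm (y - X j \<omega>)}" for \<omega>
  have S_sets: "S \<omega> \<in> sets \<mu>" for \<omega>
    unfolding S_def sets_\<mu> by (rule voronoi_cell_first_borel)
  have "(\<integral>\<^sup>+\<omega>. emeasure \<mu> (voronoi_cell n ((\<lambda>j. X j \<omega>)(1 := x)) 1) ^ k \<partial>M) =
      (\<integral>\<^sup>+\<omega>. (\<integral>\<^sup>+y. (\<Prod>i<k. indicator (S \<omega>) (y i)) \<partial>PiM {..<k} (\<lambda>_. \<mu>)) \<partial>M)"
    unfolding voronoi_cell_first[OF n] S_def[symmetric] by (simp add: PiM_power_emeasure[OF \<mu> S_sets])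
  also have "\<dots> = (\<integral>\<^sup>+y. (\<integral>\<^sup>+\<omega>. (\<Prod>i<k. indicator (S \<omega>) (y i)) \<partial>M) \<partial>PiM {..<k} (\<lambda>_. \<mu>))"
    using voronoi_indicator_measurable[of "{..<k}" n] unfolding S_def
    by (intro Fubini'[symmetric]) auto
  also have "\<dots> = (\<integral>\<^sup>+y. ennreal ((1 - measure \<mu> (ball_union x {..<k} y)) ^ (n - 1)) \<partial>PiM {..<k} (\<lambda>_. \<mu>))"
  proof (intro nn_integral_cong)
    fix y
    let ?A = "{\<omega>\<in>space M. \<forall>j\<in>{2..n}. X j \<omega> \<notin> ball_union x {..<k} y}"
    have A: "?A \<in> sets M"
    proof -
      have "X j -` (- ball_union x {..<k} y) \<inter> space M \<in> sets M" if "j \<in> {2..n}" for j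
        using that by (intro measurable_sets[OF X_measurable]) auto
      then have "{\<omega>\<in>space M. X j \<omega> \<notin> ball_union x {..<k} y} \<in> sets M" if "j \<in> {2..n}" for j
        using that by (simp add: vimage_def Int_def conj_commute)
      then show ?thesis by (intro sets.sets_Collect_finite_All) auto
    qed
    have "(\<integral>\<^sup>+\<omega>. (\<Prod>i<k. indicator (S \<omega>) (y i)) \<partial>M) = (\<integral>\<^sup>+\<omega>. indicator ?A \<omega> \<partial>M)"
    proof (intro nn_integral_cong)
      fix \<omega> assume \<omega>: "\<omega> \<in> space M"
      have "(\<Prod>i<k. indicator (S \<omega>) (y i)) = (indicator {\<omega>. \<forall>i<k. y i \<in> S \<omega>} \<omega> :: ennreal)"
        by (auto simp: indicator_def intro!: prod_zero)
      \<comment> \<open>Negating the non-strict inequality that defines the cell gives exactly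
        membership in the open ball around \<open>y i\<close> through x.\<close>
      moreover have "(\<forall>i<k. y i \<in> S \<omega>) \<longleftrightarrow> \<omega> \<in> ?A"
        using \<omega> by (auto simp: S_def ball_union_def dist_norm not_less)
      ultimately show "(\<Prod>i<k. indicator (S \<omega>) (y i)) = (indicator ?A \<omega> :: ennreal)"
        by (simp add: indicator_def)
    qed
    then show "(\<integral>\<^sup>+\<omega>. (\<Prod>i<k. indicator (S \<omega>) (y i)) \<partial>M) = ennreal ((1 - measure \<mu> (ball_union x {..<k} y)) ^ (n - 1))"
      using A by (simp add: prob_avoid)
  qed
  finally show ?thesis .
qed

text \<open>The cell is a random set, so measurability of its mass is obtained by integrating the
  jointly measurable indicator of a single test point. For n = 0 the factor n makes the function
  constant.\<close>

lemma voronoi_measure_measurable: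
  "(\<lambda>\<omega>. real n * measure \<mu> (voronoi_cell n ((\<lambda>j. X j \<omega>)(1 := x)) 1)) \<in> borel_measurable M"
proof (cases "1 \<le> n")
  case True
  interpret P: prob_space "PiM {..<1::nat} (\<lambda>_. \<mu>)" by (intro prob_space_PiM \<mu>)
  have S_sets: "{y. \<forall>j\<in>{2..n}. norm (y - x) \<le> norm (y - X j \<omega>)} \<in> sets \<mu>" for \<omega>
    unfolding sets_\<mu> by (rule voronoi_cell_first_borel)
  have "(\<lambda>\<omega>. \<integral>\<^sup>+y. (\<Prod>i<1. indicator {y. \<forall>j\<in>{2..n}. norm (y - x) \<le> norm (y - X j \<omega>)} (y i)) \<partial>PiM {..<1::nat} (\<lambda>_. \<mu>))
      \<in> borel_measurable M"
    by (intro P.borel_measurable_nn_integral voronoi_indicator_measurable finite_lessThan)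
  then have "(\<lambda>\<omega>. emeasure \<mu> (voronoi_cell n ((\<lambda>j. X j \<omega>)(1 := x)) 1)) \<in> borel_measurable M"
    unfolding voronoi_cell_first[OF True] PiM_power_emeasure[OF \<mu> S_sets, where k = 1, symmetric] power_one_right .
  then show ?thesis unfolding measure_def by measurable
next
  case False
  then have "n = 0" by simp
  then show ?thesis by simp
qed

end

subsection \<open>Convergence of the moments\<close>

lemma ennreal_tendsto_0I:
  fixes X :: "nat \<Rightarrow> ennreal"
  assumes "\<And>e::real. 0 < e \<Longrightarrow> \<forall>\<^sub>F n in sequentially. X n \<le> ennreal e"
  shows "X \<longlonglongrightarrow> 0"
proof (rule order_tendstoI)
  fix l :: ennreal assume "0 < l"
  then obtain l' where l': "0 < l'" "l' < l" using dense by blast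
  then obtain e where e: "l' = ennreal e" "0 < e"
    by (cases l') (auto simp: top.not_eq_extremum ennreal_less_zero_iff)
  show "\<forall>\<^sub>F n in sequentially. X n < l"
    using assms[OF e(2)] l' e by (auto elim!: eventually_mono intro: le_less_trans)
qed simp

text \<open>Subtraction of extended nonnegative reals truncates, so closeness of X and Y is stated
  by two additive inequalities. The perturbation is eventually below 1, hence finite, and can then
  be cancelled.\<close>

lemma ennreal_tendsto_perturb:
  fixes X Y e :: "nat \<Rightarrow> ennreal"
  assumes up: "\<forall>\<^sub>F n in sequentially. X n \<le> Y n + e n"
    and low: "\<forall>\<^sub>F n in sequentially. Y n \<le> X n + e n"
    and e: "e \<longlonglongrightarrow> 0" and Y: "Y \<longlonglongrightarrow> y" and y: "y < \<infinity>"
  shows "X \<longlonglongrightarrow> y"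
proof (rule tendsto_sandwich)
  show "\<forall>\<^sub>F n in sequentially. Y n - e n \<le> X n"
    using order_tendstoD(2)[OF e zero_less_one] low
  proof eventually_elim
    case (elim n)
    have "Y n - e n \<le> (X n + e n) - e n" using elim by (intro ennreal_minus_mono) auto
    also have "\<dots> = X n" using elim by (intro ennreal_add_diff_cancel_right) auto
    finally show ?case .
  qed
  show "\<forall>\<^sub>F n in sequentially. X n \<le> Y n + e n" by (rule up)
  show "(\<lambda>n. Y n - e n) \<longlonglongrightarrow> y" using tendsto_diff_ennreal[OF Y e] y by simp
  show "(\<lambda>n. Y n + e n) \<longlonglongrightarrow> y" using tendsto_add[OF Y e] by simp
qed

text \<open>For small s the logarithm of 1 - s lies between - s - 2 * s^2 and - s. Multiplied by n -
  1 the quadratic term vanishes in the limit because s itself tends to 0; for the same reason n - 1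
  may replace n.\<close>

lemma one_minus_power_tendsto_exp:
  fixes s :: "nat \<Rightarrow> real"
  assumes s: "\<And>n. 0 \<le> s n" and lim: "(\<lambda>n. real n * s n) \<longlonglongrightarrow> L"
  shows "(\<lambda>n. (1 - s n) ^ (n - 1)) \<longlonglongrightarrow> exp (- L)"
proof -
  have s0: "s \<longlonglongrightarrow> 0"
  proof -
    have "(\<lambda>n. (real n * s n) * (1 / real n)) \<longlonglongrightarrow> L * 0"
      by (intro tendsto_mult lim lim_1_over_n)
    moreover have "\<forall>\<^sub>F n in sequentially. (real n * s n) * (1 / real n) = s n"
      using eventually_gt_at_top[of 0] by eventually_elim simp
    ultimately show ?thesis by (simp add: tendsto_cong)
  qed
  have m: "(\<lambda>n. real (n - 1) * s n) \<longlonglongrightarrow> L"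
  proof -
    have "(\<lambda>n. real n * s n - s n) \<longlonglongrightarrow> L - 0" by (intro tendsto_diff lim s0)
    moreover have "\<forall>\<^sub>F n in sequentially. real n * s n - s n = real (n - 1) * s n"
      using eventually_ge_at_top[of 1] by eventually_elim (simp add: of_nat_diff algebra_simps)
    ultimately show ?thesis by (simp add: tendsto_cong)
  qed
  have ev: "\<forall>\<^sub>F n in sequentially. s n < 1/2"
    using s0 by (rule order_tendstoD) simp
  have "(\<lambda>n. real (n - 1) * ln (1 - s n)) \<longlonglongrightarrow> - L"
  proof (rule tendsto_sandwich)
    show "\<forall>\<^sub>F n in sequentially. - (real (n - 1) * s n) - 2 * (real (n - 1) * s n) * s n \<le> real (n - 1) * ln (1 - s n)"
      using ev
    proof eventually_elim
      case (elim n)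
      have "- s n - 2 * (s n)\<^sup>2 \<le> ln (1 - s n)"
        using elim s by (intro ln_one_minus_pos_lower_bound) (auto intro: less_imp_le)
      from mult_left_mono[OF this, of "real (n - 1)"] show ?case
        by (simp add: algebra_simps power2_eq_square)
    qed
    show "\<forall>\<^sub>F n in sequentially. real (n - 1) * ln (1 - s n) \<le> - (real (n - 1) * s n)"
      using ev
    proof eventually_elim
      case (elim n)
      have "ln (1 - s n) \<le> - s n" using ln_add_one_self_le_self2[of "- s n"] elim by simp
      from mult_left_mono[OF this, of "real (n - 1)"] show ?case by simp
    qed
    have "(\<lambda>n. - (real (n - 1) * s n) - 2 * (real (n - 1) * s n) * s n) \<longlonglongrightarrow> - L - 2 * L * 0"
      by (intro tendsto_intros m s0)
    then show "(\<lambda>n. - (real (n - 1) * s n) - 2 * (real (n - 1) * s n) * s n) \<longlonglongrightarrow> - L" by simp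
    show "(\<lambda>n. - (real (n - 1) * s n)) \<longlonglongrightarrow> - L" by (intro tendsto_intros m)
  qed
  then have "(\<lambda>n. exp (real (n - 1) * ln (1 - s n))) \<longlonglongrightarrow> exp (- L)" by (rule tendsto_exp)
  moreover have "\<forall>\<^sub>F n in sequentially. exp (real (n - 1) * ln (1 - s n)) = (1 - s n) ^ (n - 1)"
    using ev by eventually_elim (simp add: exp_of_nat_mult)
  ultimately show ?thesis by (simp add: tendsto_cong)
qed

lemma nn_integral_affine:
  fixes x :: "'a::euclidean_space"
  assumes [measurable]: "g \<in> borel_measurable borel" and a: "0 < a"
  shows "(\<integral>\<^sup>+y. g y \<partial>lborel) = ennreal (a ^ DIM('a)) * (\<integral>\<^sup>+v. g (x + a *\<^sub>R v) \<partial>lborel)"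
  using a by (subst lborel_affine[of a x])
    (simp_all add: nn_integral_density nn_integral_distr nn_integral_cmult)

text \<open>One factor is exchanged at a time. With P the product over the old indices and m their
  number, g v * P - c * c^m = g v * (P - c^m) + c^m * (g v - c). The induction hypothesis and the
  eventually bounded L1 norm of g n control the first summand, the assumed convergence the
  second.\<close>

lemma product_L1_tendsto:
  fixes g :: "nat \<Rightarrow> 'a \<Rightarrow> real"
  assumes N: "finite_measure N" and g[measurable]: "\<And>n. g n \<in> borel_measurable N"
    and nn: "\<And>n v. 0 \<le> g n v" "0 \<le> c"
    and lim: "(\<lambda>n. \<integral>\<^sup>+v. ennreal \<bar>g n v - c\<bar> \<partial>N) \<longlonglongrightarrow> 0" and I: "finite I"
  shows "(\<lambda>n. \<integral>\<^sup>+u. ennreal \<bar>(\<Prod>i\<in>I. g n (u i)) - c ^ card I\<bar> \<partial>PiM I (\<lambda>_. N)) \<longlonglongrightarrow> 0"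
  using I
proof (induction I rule: finite_induct)
  case empty
  then show ?case by simp
next
  case (insert i I)
  interpret N: finite_measure N by fact
  interpret product_sigma_finite "\<lambda>_. N" by standard
  interpret F: finite_product_sigma_finite "\<lambda>_. N" I by standard (rule insert)
  let ?D = "\<lambda>n u. ennreal \<bar>(\<Prod>i\<in>I. g n (u i)) - c ^ card I\<bar>"
  let ?P = "PiM I (\<lambda>_. N)"
  define T where "T = emeasure ?P (space ?P)"
  have T: "T = emeasure N (space N) ^ card I"
    using insert.hyps(1) by (simp add: T_def space_PiM emeasure_PiM)
  have T_fin: "T < \<infinity>" unfolding T
    by (simp only: power_less_top_ennreal infinity_ennreal_def) (simp add: less_top[symmetric])
  define A where "A n = (\<integral>\<^sup>+u. ?D n u \<partial>?P)" for n
  define B where "B n = (\<integral>\<^sup>+v. ennreal \<bar>g n v - c\<bar> \<partial>N)" for n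
  have bound: "(\<integral>\<^sup>+u. ennreal \<bar>(\<Prod>i\<in>insert i I. g n (u i)) - c ^ card (insert i I)\<bar> \<partial>PiM (insert i I) (\<lambda>_. N))
      \<le> (ennreal c * emeasure N (space N) + B n) * A n + ennreal (c ^ card I) * T * B n" for n
  proof -
    have "(\<integral>\<^sup>+u. ennreal \<bar>(\<Prod>i\<in>insert i I. g n (u i)) - c ^ card (insert i I)\<bar> \<partial>PiM (insert i I) (\<lambda>_. N)) =
        (\<integral>\<^sup>+v. (\<integral>\<^sup>+u. ennreal \<bar>(\<Prod>j\<in>insert i I. g n ((u(i := v)) j)) - c ^ card (insert i I)\<bar> \<partial>?P) \<partial>N)"
      using insert.hyps by (intro product_nn_integral_insert_rev) measurable
    also have "\<dots> \<le> (\<integral>\<^sup>+v. (\<integral>\<^sup>+u. ennreal (g n v) * ?D n u + ennreal (c ^ card I) * ennreal \<bar>g n v - c\<bar> \<partial>?P) \<partial>N)"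
    proof (intro nn_integral_mono)
      fix v u
      have p: "(\<Prod>j\<in>insert i I. g n ((u(i := v)) j)) = g n v * (\<Prod>j\<in>I. g n (u j))"
        using insert.hyps by (auto intro!: prod.cong)
      have "g n v * (\<Prod>j\<in>I. g n (u j)) - c ^ card (insert i I) =
          g n v * ((\<Prod>j\<in>I. g n (u j)) - c ^ card I) + c ^ card I * (g n v - c)"
        using insert.hyps by (simp add: algebra_simps)
      also have "\<bar>\<dots>\<bar> \<le> \<bar>g n v * ((\<Prod>j\<in>I. g n (u j)) - c ^ card I)\<bar> + \<bar>c ^ card I * (g n v - c)\<bar>"
        by (rule abs_triangle_ineq)
      also have "\<dots> = g n v * \<bar>(\<Prod>j\<in>I. g n (u j)) - c ^ card I\<bar> + c ^ card I * \<bar>g n v - c\<bar>"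
        using nn by (simp add: abs_mult)
      finally have "\<bar>g n v * (\<Prod>j\<in>I. g n (u j)) - c ^ card (insert i I)\<bar> \<le>
          g n v * \<bar>(\<Prod>j\<in>I. g n (u j)) - c ^ card I\<bar> + c ^ card I * \<bar>g n v - c\<bar>" .
      then show "ennreal \<bar>(\<Prod>j\<in>insert i I. g n ((u(i := v)) j)) - c ^ card (insert i I)\<bar> \<le>
          ennreal (g n v) * ?D n u + ennreal (c ^ card I) * ennreal \<bar>g n v - c\<bar>"
        unfolding p using nn
        by (simp add: ennreal_mult[symmetric] ennreal_plus[symmetric] ennreal_leI del: ennreal_plus)
    qed
    also have "\<dots> = (\<integral>\<^sup>+v. ennreal (g n v) * A n + ennreal (c ^ card I) * ennreal \<bar>g n v - c\<bar> * T \<partial>N)"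
      by (simp add: nn_integral_add nn_integral_cmult A_def T_def)
    also have "\<dots> = (\<integral>\<^sup>+v. ennreal (g n v) \<partial>N) * A n + ennreal (c ^ card I) * T * B n"
      by (simp add: nn_integral_add nn_integral_cmult nn_integral_multc B_def mult_ac)
    also have "(\<integral>\<^sup>+v. ennreal (g n v) \<partial>N) \<le> (\<integral>\<^sup>+v. ennreal c + ennreal \<bar>g n v - c\<bar> \<partial>N)"
      using nn by (intro nn_integral_mono) (simp add: ennreal_plus[symmetric] ennreal_leI del: ennreal_plus)
    also have "\<dots> = ennreal c * emeasure N (space N) + B n"
      by (simp add: nn_integral_add B_def)
    finally show ?thesis by (simp add: mult_right_mono add_right_mono)
  qed
  have B: "B \<longlonglongrightarrow> 0" using lim by (simp add: B_def[abs_def])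
  have A: "A \<longlonglongrightarrow> 0" using insert.IH by (simp add: A_def[abs_def])
  \<comment> \<open>Eventually \<open>B n\<close> is below 1, so the coefficient of
    \<open>A n\<close> may be replaced by a constant. Its finiteness matters, as an infinite
    multiple of a null sequence need not tend to 0.\<close>
  have "(\<lambda>n. (ennreal c * emeasure N (space N) + 1) * A n + ennreal (c ^ card I) * T * B n) \<longlonglongrightarrow>
      (ennreal c * emeasure N (space N) + 1) * 0 + ennreal (c ^ card I) * T * 0"
    using T_fin N.emeasure_finite
    by (intro tendsto_add ennreal_tendsto_cmult A B) (auto simp: ennreal_mult_eq_top_iff less_top[symmetric])
  then have up: "(\<lambda>n. (ennreal c * emeasure N (space N) + 1) * A n + ennreal (c ^ card I) * T * B n) \<longlonglongrightarrow> 0"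
    by simp
  show ?case
  proof (rule tendsto_sandwich[OF _ _ tendsto_const up])
    show "\<forall>\<^sub>F n in sequentially.
        (\<integral>\<^sup>+u. ennreal \<bar>(\<Prod>i\<in>insert i I. g n (u i)) - c ^ card (insert i I)\<bar> \<partial>PiM (insert i I) (\<lambda>_. N)) \<le>
        (ennreal c * emeasure N (space N) + 1) * A n + ennreal (c ^ card I) * T * B n"
      using order_tendstoD(2)[OF B zero_less_one]
    proof eventually_elim
      case (elim n)
      then show ?case
        by (intro order_trans[OF bound] add_mono mult_right_mono) auto
    qed
  qed simp
qed

lemma lebesgue_pointE:
  assumes "lebesgue_point f x" "0 < \<epsilon>"
  obtains \<delta> where "0 < \<delta>" "\<And>r. 0 < r \<Longrightarrow> r < \<delta> \<Longrightarrow>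
      (\<integral>\<^sup>+y\<in>cball x r. ennreal \<bar>f y - f x\<bar> \<partial>lborel) \<le> ennreal \<epsilon> * emeasure lborel (cball x r)"
proof -
  obtain \<delta> where "0 < \<delta>" and \<delta>: "\<forall>r. 0 < r \<and> r < \<delta> \<longrightarrow>
      (\<integral>\<^sup>+y\<in>cball x r. ennreal \<bar>f y - f x\<bar> \<partial>lborel) \<le> ennreal \<epsilon> * emeasure lborel (cball x r)"
    using assms(1)[unfolded lebesgue_point_def, rule_format, OF assms(2)] by (elim exE conjE)
  show thesis by (rule that[OF \<open>0 < \<delta>\<close>]) (intro \<delta>[rule_format] conjI)
qed

text \<open>Substituting y = x + a n * v gives an integral over the ball of radius a n * R around x.
  Its volume cancels the Jacobian up to V * R^d, which explains the choice of \<epsilon>.\<close>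

lemma lebesgue_point_tendsto:
  fixes x :: "'a::euclidean_space"
  assumes [measurable]: "f \<in> borel_measurable borel" and lp: "lebesgue_point f x"
    and a0: "a \<longlonglongrightarrow> 0" and a: "\<forall>\<^sub>F n in sequentially. 0 < a n" and R: "0 < R"
  shows "(\<lambda>n. \<integral>\<^sup>+v. ennreal \<bar>f (x + a n *\<^sub>R v) - f x\<bar> * indicator (cball 0 R) v \<partial>lborel) \<longlonglongrightarrow> 0"
proof (rule ennreal_tendsto_0I)
  fix e :: real assume e: "0 < e"
  define V where "V = measure lborel (cball (0::'a) 1)"
  have V: "0 < V" unfolding V_def by (rule measure_unit_ball_pos)
  define \<epsilon> where "\<epsilon> = e / (V * R ^ DIM('a))"
  have \<epsilon>: "0 < \<epsilon>" using e V R by (simp add: \<epsilon>_def)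
  obtain \<delta> where \<delta>: "0 < \<delta>" "\<And>r. 0 < r \<Longrightarrow> r < \<delta> \<Longrightarrow>
      (\<integral>\<^sup>+y\<in>cball x r. ennreal \<bar>f y - f x\<bar> \<partial>lborel) \<le> ennreal \<epsilon> * emeasure lborel (cball x r)"
    by (fact lebesgue_pointE[OF lp \<epsilon>])
  have "\<forall>\<^sub>F n in sequentially. a n < \<delta> / R"
    using a0 \<delta>(1) R by (intro order_tendstoD) auto
  then show "\<forall>\<^sub>F n in sequentially.
      (\<integral>\<^sup>+v. ennreal \<bar>f (x + a n *\<^sub>R v) - f x\<bar> * indicator (cball 0 R) v \<partial>lborel) \<le> ennreal e"
    using a
  proof eventually_elim
    case (elim n)
    let ?J = "\<integral>\<^sup>+v. ennreal \<bar>f (x + a n *\<^sub>R v) - f x\<bar> * indicator (cball 0 R) v \<partial>lborel"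
    have r: "0 < a n * R" "a n * R < \<delta>" using elim R by (auto simp: field_simps)
    have an: "0 < a n ^ DIM('a)" using elim by simp
    have ind: "indicator (cball x (a n * R)) (x + a n *\<^sub>R v) = (indicator (cball 0 R) v :: ennreal)" for v
      using elim by (auto simp: indicator_def dist_norm)
    have "ennreal (a n ^ DIM('a)) * ?J = (\<integral>\<^sup>+y\<in>cball x (a n * R). ennreal \<bar>f y - f x\<bar> \<partial>lborel)"
      using elim by (subst nn_integral_affine[where a = "a n" and x = x]) (simp_all add: ind)
    also have "\<dots> \<le> ennreal \<epsilon> * emeasure lborel (cball x (a n * R))"
      by (intro \<delta>(2) r)
    also have "\<dots> = ennreal (\<epsilon> * (V * (a n * R) ^ DIM('a)))"
      using r \<epsilon> by (simp add: emeasure_cball_eq V_def ennreal_mult')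
    also have "\<epsilon> * (V * (a n * R) ^ DIM('a)) = a n ^ DIM('a) * e"
      using V R by (simp add: \<epsilon>_def power_mult_distrib)
    also have "ennreal \<dots> = ennreal (a n ^ DIM('a)) * ennreal e"
      using e an by (simp add: ennreal_mult)
    finally show ?case
      using elim by (subst (asm) ennreal_mult_le_mult_iff) auto
  qed
qed

text \<open>For y near x both masses are comparable to f x times the volumes. For distant y the ball
  around y still contains a ball of fixed radius with x on its boundary, whose mass is bounded
  below, while the ball around x has mass at most 1.\<close>

lemma lebesgue_point_ball_lower:
  fixes x :: "'a::euclidean_space"
  assumes [measurable]: "f \<in> borel_measurable borel" and f: "\<And>y. 0 \<le> f y" and lp: "lebesgue_point f x" and c: "0 < f x"
    and \<mu>: "\<mu> = density lborel (\<lambda>y. ennreal (f y))" "prob_space \<mu>"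
  obtains b where "0 < b" "\<And>y. b * measure \<mu> (cball x (norm (y - x))) \<le> measure \<mu> (ball y (norm (y - x)))"
proof -
  interpret prob_space \<mu> by (rule \<mu>(2))
  define c where "c = f x"
  define V where "V = measure lborel (cball (0::'a) 1)"
  have V: "0 < V" unfolding V_def by (rule measure_unit_ball_pos)
  \<comment> \<open>The ball around y lies in the ball of radius 2 * r around x, of 2^d times the
    volume. The additional factor 2 makes the error consume only half of c.\<close>
  define \<epsilon> where "\<epsilon> = c / 2 ^ (DIM('a) + 1)"
  have c0: "0 < c" using c by (simp add: c_def)
  have \<epsilon>: "0 < \<epsilon>" "\<epsilon> \<le> c" using c0 one_le_power[of "2::real" "DIM('a) + 1"]
    by (simp_all add: \<epsilon>_def divide_le_eq)
  obtain \<delta> where \<delta>: "0 < \<delta>" "\<And>r. 0 < r \<Longrightarrow> r < \<delta> \<Longrightarrow>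
      (\<integral>\<^sup>+y\<in>cball x r. ennreal \<bar>f y - f x\<bar> \<partial>lborel) \<le> ennreal \<epsilon> * emeasure lborel (cball x r)"
    by (fact lebesgue_pointE[OF lp \<epsilon>(1)])
  have ball_eq: "emeasure lborel (ball z r) = ennreal (V * r ^ DIM('a))" if "0 \<le> r" for z :: 'a and r
    using content_ball[OF that, of z] content_cball[of 1 "0::'a"] emeasure_lborel_ball_finite[of z r] V
    by (simp add: emeasure_eq_ennreal_measure top.not_eq_extremum V_def)
  have em: "emeasure \<mu> A = (\<integral>\<^sup>+y. ennreal (f y) * indicator A y \<partial>lborel)" if "A \<in> sets borel" for A
    using that by (simp add: \<mu>(1) emeasure_density)
  have lower: "c * V * r ^ DIM('a) / 2 \<le> measure \<mu> (ball y r)" if r: "0 < r" "2 * r < \<delta>" and y: "norm (y - x) = r" for y r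
  proof -
    have "ennreal c * emeasure lborel (ball y r) = (\<integral>\<^sup>+z. ennreal c * indicator (ball y r) z \<partial>lborel)"
      by (simp add: nn_integral_cmult)
    also have "\<dots> \<le> (\<integral>\<^sup>+z. ennreal (f z) * indicator (ball y r) z + ennreal \<bar>f z - f x\<bar> * indicator (cball x (2 * r)) z \<partial>lborel)"
    proof (intro nn_integral_mono)
      fix z
      have "z \<in> cball x (2 * r)" if "z \<in> ball y r"
        using that y dist_triangle[of x z y] by (simp add: dist_norm norm_minus_commute)
      moreover have "ennreal c \<le> ennreal (f z) + ennreal \<bar>f z - f x\<bar>"
        using f by (simp add: c_def ennreal_plus[symmetric] ennreal_leI del: ennreal_plus)
      ultimately show "ennreal c * indicator (ball y r) z \<le>
          ennreal (f z) * indicator (ball y r) z + ennreal \<bar>f z - f x\<bar> * indicator (cball x (2 * r)) z"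
        by (cases "z \<in> ball y r") auto
    qed
    also have "\<dots> = emeasure \<mu> (ball y r) + (\<integral>\<^sup>+z\<in>cball x (2 * r). ennreal \<bar>f z - f x\<bar> \<partial>lborel)"
      by (subst nn_integral_add) (auto simp: em)
    also have "\<dots> \<le> emeasure \<mu> (ball y r) + ennreal \<epsilon> * emeasure lborel (cball x (2 * r))"
      using \<delta>(2)[of "2 * r"] r by (intro add_left_mono) auto
    finally have "ennreal (c * (V * r ^ DIM('a))) \<le> ennreal (measure \<mu> (ball y r) + \<epsilon> * (V * (2 * r) ^ DIM('a)))"
      using r \<epsilon> c0 V by (simp add: ball_eq emeasure_cball_eq V_def[symmetric] emeasure_eq_measure ennreal_mult')
    then have "c * (V * r ^ DIM('a)) \<le> measure \<mu> (ball y r) + \<epsilon> * (V * (2 * r) ^ DIM('a))"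
      using r \<epsilon> V by (subst (asm) ennreal_le_iff) auto
    also have "\<epsilon> * (V * (2 * r) ^ DIM('a)) = c * V * r ^ DIM('a) / 2"
      by (simp add: \<epsilon>_def power_mult_distrib)
    finally show ?thesis by simp
  qed
  have upper: "measure \<mu> (cball x r) \<le> 2 * (c * V * r ^ DIM('a))" if r: "0 \<le> r" "r < \<delta>" for r
  proof (cases "r = 0")
    case True
    have "emeasure \<mu> {x} = 0"
      by (subst em) (auto intro!: nn_integral_0_iff_AE[THEN iffD2] AE_I[of _ _ "{x}"])
    then show ?thesis using True c0 V by (simp add: measure_def)
  next
    case False
    then have r0: "0 < r" using r by simp
    have "emeasure \<mu> (cball x r) \<le> (\<integral>\<^sup>+z. ennreal c * indicator (cball x r) z + ennreal \<bar>f z - f x\<bar> * indicator (cball x r) z \<partial>lborel)"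
      using f c by (subst em)
        (auto intro!: nn_integral_mono simp: indicator_def c_def ennreal_plus[symmetric] ennreal_leI simp del: ennreal_plus)
    also have "\<dots> = ennreal c * emeasure lborel (cball x r) + (\<integral>\<^sup>+z\<in>cball x r. ennreal \<bar>f z - f x\<bar> \<partial>lborel)"
      by (subst nn_integral_add) (auto simp: nn_integral_cmult)
    also have "\<dots> \<le> ennreal c * emeasure lborel (cball x r) + ennreal \<epsilon> * emeasure lborel (cball x r)"
      using \<delta>(2)[of r] r r0 by (intro add_left_mono) auto
    also have "\<dots> \<le> ennreal c * emeasure lborel (cball x r) + ennreal c * emeasure lborel (cball x r)"
      using \<epsilon> by (intro add_left_mono mult_right_mono ennreal_leI) auto
    finally have "ennreal (measure \<mu> (cball x r)) \<le> ennreal (2 * (c * V * r ^ DIM('a)))"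
      using r0 c0 V by (simp add: emeasure_cball_eq V_def[symmetric] emeasure_eq_measure ennreal_mult[symmetric] ennreal_plus[symmetric] del: ennreal_plus)
        (simp add: algebra_simps)
    then show ?thesis using r0 c0 V by (subst (asm) ennreal_le_iff) auto
  qed
  define r0 where "r0 = \<delta> / 4"
  define \<beta> where "\<beta> = c * V * r0 ^ DIM('a) / 2"
  have r0: "0 < r0" "2 * r0 < \<delta>" using \<delta>(1) by (auto simp: r0_def)
  have \<beta>: "0 < \<beta>" using c0 V r0 by (simp add: \<beta>_def)
  show ?thesis
  proof (rule that)
    \<comment> \<open>The value 1/4 is the lower factor 1/2 divided by the upper factor 2 from the
      estimates near x; \<beta> bounds from below the mass of any ball of radius \<open>r0\<close>
      with x on its boundary.\<close>
    show "0 < min (1/4) \<beta>" using \<beta> by simp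
    fix y
    define r where "r = norm (y - x)"
    have r: "0 \<le> r" by (simp add: r_def)
    show "min (1/4) \<beta> * measure \<mu> (cball x (norm (y - x))) \<le> measure \<mu> (ball y (norm (y - x)))"
    proof (cases "2 * r < \<delta>")
      case True
      have up: "measure \<mu> (cball x r) \<le> 2 * (c * V * r ^ DIM('a))" using upper[OF r] True r by simp
      have low: "c * V * r ^ DIM('a) / 2 \<le> measure \<mu> (ball y r)"
      proof (cases "0 < r")
        case False
        then have "r ^ DIM('a) = 0" using r by simp
        then show ?thesis by (simp only: mult_zero_right div_0 measure_nonneg)
      next
        case pos: True
        show ?thesis by (rule lower[OF pos True r_def[symmetric]])
      qed
      have "min (1/4) \<beta> * measure \<mu> (cball x r) \<le> 1/4 * measure \<mu> (cball x r)"
        by (intro mult_right_mono) auto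
      with up low show ?thesis unfolding r_def[symmetric] by linarith
    next
      case False
      then have rr: "r0 \<le> r" "0 < r" using \<delta>(1) by (auto simp: r0_def)
      \<comment> \<open>The point at distance \<open>r0\<close> from x on the segment towards y. The
        ball of radius \<open>r0\<close> around it touches the ball around y from inside, at
        x.\<close>
      define z where "z = x + (r0 / r) *\<^sub>R (y - x)"
      have "norm (z - x) = r0" using rr r0 by (simp add: z_def r_def)
      from lower[OF r0 this] have "\<beta> \<le> measure \<mu> (ball z r0)" by (simp add: \<beta>_def)
      also have "\<dots> \<le> measure \<mu> (ball y r)"
      proof (rule finite_measure_mono)
        have "y - z = (1 - r0 / r) *\<^sub>R (y - x)" by (simp add: z_def algebra_simps)
        then have "norm (y - z) = \<bar>1 - r0 / r\<bar> * r" by (simp add: r_def)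
        also have "\<dots> = r - r0" using rr r0 by (simp add: abs_of_nonneg left_diff_distrib)
        finally have "norm (y - z) = r - r0" .
        then show "ball z r0 \<subseteq> ball y r" using dist_triangle[of y _ z]
          by (intro subsetI) (smt (verit) dist_norm mem_ball)
      qed (simp add: \<mu>(1))
      finally have "\<beta> \<le> measure \<mu> (ball y r)" .
      moreover have "min (1/4) \<beta> * measure \<mu> (cball x r) \<le> \<beta> * 1"
        using \<beta> by (intro mult_mono) auto
      ultimately show ?thesis by (simp add: r_def)
    qed
  qed
qed

section \<open>A tail bound uniform in the sample size\<close>

lemma measure_cball_norm_measurable:
  fixes x :: "'a::euclidean_space"
  assumes "sigma_finite_measure \<mu>" and s: "sets \<mu> = sets borel"
  shows "(\<lambda>y. measure \<mu> (cball x (norm (y - x)))) \<in> borel_measurable borel"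
proof -
  note [measurable_cong] = s
  define Q where "Q = {p \<in> space (borel \<Otimes>\<^sub>M \<mu>). norm (snd p - x) \<le> norm (fst p - x)}"
  have "Q \<in> sets (borel \<Otimes>\<^sub>M \<mu>)" unfolding Q_def by measurable
  then have "(\<lambda>y. emeasure \<mu> (Pair y -` Q)) \<in> borel_measurable borel"
    by (rule sigma_finite_measure.measurable_emeasure_Pair[OF assms(1)])
  moreover have "Pair y -` Q = cball x (norm (y - x))" for y
    using sets_eq_imp_space_eq[OF s]
    by (auto simp: Q_def space_pair_measure dist_norm norm_minus_commute)
  ultimately show ?thesis by (simp add: measure_def)
qed

text \<open>By inner regularity it suffices to bound compact subsets, on which the distance from \<open>x\<close>
  attains its maximum.\<close>

lemma measure_cball_norm_le:
  fixes x :: "'a::euclidean_space"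
  assumes \<mu>: "prob_space \<mu>" "sets \<mu> = sets borel" and t: "0 \<le> t"
  shows "emeasure \<mu> {y. measure \<mu> (cball x (norm (y - x))) \<le> t} \<le> ennreal t"
proof (rule ccontr)
  interpret prob_space \<mu> by (rule \<mu>(1))
  define A where "A = {y. measure \<mu> (cball x (norm (y - x))) \<le> t}"
  note [measurable] = measure_cball_norm_measurable[OF sigma_finite_measure_axioms \<mu>(2), of x]
  have A: "A \<in> sets borel"
  proof -
    have "{y \<in> space borel. measure \<mu> (cball x (norm (y - x))) \<le> t} \<in> sets borel" by measurable
    then show ?thesis by (simp add: A_def)
  qed
  assume "\<not> emeasure \<mu> {y. measure \<mu> (cball x (norm (y - x))) \<le> t} \<le> ennreal t"
  then have "ennreal t < (SUP K \<in> {K. K \<subseteq> A \<and> compact K}. emeasure \<mu> K)"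
    using inner_regular[OF \<mu>(2) _ A] by (simp add: A_def[symmetric])
  then obtain K where K: "K \<subseteq> A" "compact K" "ennreal t < emeasure \<mu> K"
    unfolding less_SUP_iff by auto
  have "K \<noteq> {}" using K(3) by auto
  then have "\<exists>y\<in>K. \<forall>z\<in>K. norm (z - x) \<le> norm (y - x)"
    by (intro continuous_attains_sup K(2) continuous_intros)
  then obtain y where y: "y \<in> K" "\<And>z. z \<in> K \<Longrightarrow> norm (z - x) \<le> norm (y - x)"
    by blast
  have "emeasure \<mu> K \<le> emeasure \<mu> (cball x (norm (y - x)))"
    using y \<mu>(2) by (intro emeasure_mono) (auto simp: dist_norm norm_minus_commute)
  also have "\<dots> \<le> ennreal t"
    using y(1) K(1) by (auto simp: A_def emeasure_eq_measure ennreal_leI)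
  finally show False using K(3) by simp
qed

text \<open>Half of the exponential decay absorbs the polynomial, leaving a geometric series in exp
  (- b / 4). The constant \<open>C\<close> comes from (y / k)^k \<le> exp y at y = b * (j + 1) / 4;
  the division by k is why k = 0 is treated apart.\<close>

lemma summable_exp_shells:
  fixes b :: real
  assumes b: "0 < b"
  shows "summable (\<lambda>j. exp (- b * real j / 2) * (real j + 1) ^ k)"
proof (cases "k = 0")
  case True
  have "summable (\<lambda>j. exp (- b / 2) ^ j)" using b by (intro summable_geometric) simp
  then show ?thesis using True by (simp add: exp_of_nat_mult[symmetric] mult_ac)
next
  case False
  define C where "C = (4 * real k / b) ^ k * exp (b / 4)"
  have le: "(real j + 1) ^ k \<le> C * exp (b * real j / 4)" for j
  proof -
    define y where "y = b * (real j + 1) / 4"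
    have y: "0 \<le> y" using b by (simp add: y_def)
    have "(y / real k) ^ k \<le> (1 + y / real k) ^ k" using y by (intro power_mono) auto
    also have "\<dots> \<le> exp y" using False y by (intro exp_ge_one_plus_x_over_n_power_n) auto
    finally have "(4 * real k / b) ^ k * (y / real k) ^ k \<le> (4 * real k / b) ^ k * exp y"
      using b by (intro mult_left_mono) auto
    moreover have "(4 * real k / b) ^ k * (y / real k) ^ k = (real j + 1) ^ k"
      using b False by (simp add: power_mult_distrib[symmetric] y_def)
    moreover have "exp y = exp (b / 4) * exp (b * real j / 4)"
      by (simp add: y_def exp_add[symmetric] field_simps)
    ultimately show ?thesis by (simp add: C_def)
  qed
  show ?thesis
  proof (rule summable_comparison_test')
    have "summable (\<lambda>j. exp (- b / 4) ^ j)" using b by (intro summable_geometric) simp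
    then show "summable (\<lambda>j. C * exp (- b / 4) ^ j)" by (rule summable_mult)
    fix j :: nat
    have "exp (- b * real j / 2) * (real j + 1) ^ k \<le> exp (- b * real j / 2) * (C * exp (b * real j / 4))"
      by (intro mult_left_mono le) auto
    also have "\<dots> = C * (exp (- b * real j / 2) * exp (b * real j / 4))" by simp
    also have "exp (- b * real j / 2) * exp (b * real j / 4) = exp (- b / 4) ^ j"
      by (simp add: exp_add[symmetric] exp_of_nat_mult[symmetric] field_simps)
    finally show "norm (exp (- b * real j / 2) * (real j + 1) ^ k) \<le> C * exp (- b / 4) ^ j"
      by simp
  qed
qed

text \<open>The largest value of \<open>n * F (y i)\<close> is localised in an interval \<open>[j + m, j + m + 1]\<close>; it costs a
  factor \<open>exp (- b * (j + m) / 2)\<close>, and it has probability at most \<open>((j + m + 1) / n) ^ card I\<close>.\<close>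

lemma voronoi_moment_tail:
  fixes x :: "'a::euclidean_space" and b :: real and I :: "'i set"
  assumes \<mu>: "prob_space \<mu>" "sets \<mu> = sets borel" and b: "0 < b"
    and dom: "\<And>y. b * measure \<mu> (cball x (norm (y - x))) \<le> measure \<mu> (ball y (norm (y - x)))"
    and I: "finite I" "I \<noteq> {}" and n: "2 \<le> n"
  shows "ennreal (real n ^ card I) * (\<integral>\<^sup>+y. indicator {y. \<exists>i\<in>I. real m \<le> real n * measure \<mu> (cball x (norm (y i - x)))} y *
      ennreal ((1 - measure \<mu> (ball_union x I y)) ^ (n - 1)) \<partial>PiM I (\<lambda>_. \<mu>)) \<le>
    ennreal (\<Sum>j. exp (- b * real (j + m) / 2) * (real (j + m) + 1) ^ card I)"
proof -
  interpret prob_space \<mu> by (rule \<mu>(1))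
  interpret product_sigma_finite "\<lambda>_. \<mu>" by standard
  define F where "F y = measure \<mu> (cball x (norm (y - x)))" for y
  define s where "s j = (real (j + m) + 1) / real n" for j
  define B where "B j = {y. F y \<le> s j}" for j
  define e where "e j = exp (- b * real (j + m) / 2)" for j
  have [measurable]: "F \<in> borel_measurable borel"
    unfolding F_def[abs_def] by (intro measure_cball_norm_measurable \<mu>(2) sigma_finite_measure_axioms)
  have B[measurable]: "B j \<in> sets \<mu>" for j
  proof -
    have "{y \<in> space borel. F y \<le> s j} \<in> sets borel" by measurable
    then show ?thesis by (simp add: B_def \<mu>(2))
  qed
  have s: "0 \<le> s j" for j by (simp add: s_def)
  have pointwise: "indicator {y. \<exists>i\<in>I. real m \<le> real n * F (y i)} y *
      ennreal ((1 - measure \<mu> (ball_union x I y)) ^ (n - 1)) \<le>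
      (\<Sum>j. ennreal (e j) * (\<Prod>i\<in>I. indicator (B j) (y i)))" for y :: "'i \<Rightarrow> 'a"
  proof (cases "\<exists>i\<in>I. real m \<le> real n * F (y i)")
    case True
    have "finite ((\<lambda>i. F (y i)) ` I)" "(\<lambda>i. F (y i)) ` I \<noteq> {}" using I by auto
    from Max_in[OF this] obtain i0 where i0: "i0 \<in> I" "F (y i0) = Max ((\<lambda>i. F (y i)) ` I)" by auto
    have max: "F (y i) \<le> F (y i0)" if "i \<in> I" for i
      unfolding i0(2) using that I by (intro Max_ge) auto
    define S where "S = F (y i0)"
    define J where "J = nat \<lfloor>real n * S\<rfloor>"
    have S: "0 \<le> S" "S \<le> 1" by (auto simp: S_def F_def)
    have "real m \<le> real n * S"
      using True max unfolding S_def by (meson mult_left_mono of_nat_0_le_iff order_trans)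
    then have mJ: "m \<le> J" unfolding J_def by linarith
    have J: "real J \<le> real n * S" "real n * S \<le> real J + 1"
      using S unfolding J_def by (auto simp: of_nat_nat)
    have "b * S \<le> measure \<mu> (ball (y i0) (norm (y i0 - x)))" using dom by (simp add: S_def F_def)
    also have "\<dots> \<le> measure \<mu> (ball_union x I y)"
    proof (rule finite_measure_mono)
      show "ball (y i0) (norm (y i0 - x)) \<subseteq> ball_union x I y"
        using i0(1) unfolding ball_union_def by blast
    qed (simp add: \<mu>(2))
    finally have "1 - measure \<mu> (ball_union x I y) \<le> exp (- (b * S))"
      using exp_ge_add_one_self[of "- (b * S)"] by linarith
    then have "(1 - measure \<mu> (ball_union x I y)) ^ (n - 1) \<le> exp (- (b * S)) ^ (n - 1)"
      by (intro power_mono) auto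
    also have "\<dots> = exp (- (b * S * real (n - 1)))" by (simp add: exp_of_nat_mult[symmetric] mult_ac)
    also have "\<dots> \<le> exp (- b * real J / 2)"
    proof -
      \<comment> \<open>For n \<ge> 2 the exponent n - 1 is at least n / 2; this is the origin of
        the factor 1/2 in \<open>e\<close>.\<close>
      have "real J / 2 \<le> S * (real n / 2)" using J(1) by (simp add: mult.commute)
      also have "\<dots> \<le> S * real (n - 1)" using n S by (intro mult_left_mono) (auto simp: of_nat_diff)
      finally have "b * (real J / 2) \<le> b * (S * real (n - 1))" using b by (intro mult_left_mono) auto
      then show ?thesis by (simp add: mult_ac)
    qed
    also have "\<dots> = e (J - m)" using mJ by (simp add: e_def)
    finally have "ennreal ((1 - measure \<mu> (ball_union x I y)) ^ (n - 1)) \<le> ennreal (e (J - m))"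
      by (rule ennreal_leI)
    moreover have "y i \<in> B (J - m)" if "i \<in> I" for i
    proof -
      have "F (y i) \<le> S" using max[OF that] by (simp add: S_def)
      also have "S \<le> s (J - m)" using J(2) mJ n by (simp add: s_def field_simps)
      finally show ?thesis by (simp add: B_def)
    qed
    then have "(\<Prod>i\<in>I. indicator (B (J - m)) (y i)) = (1 :: ennreal)" by (intro prod.neutral) auto
    ultimately have "indicator {y. \<exists>i\<in>I. real m \<le> real n * F (y i)} y *
      ennreal ((1 - measure \<mu> (ball_union x I y)) ^ (n - 1)) \<le>
      (\<Sum>j\<in>{J - m}. ennreal (e j) * (\<Prod>i\<in>I. indicator (B j) (y i)))"
      using True by simp
    also have "\<dots> \<le> (\<Sum>j. ennreal (e j) * (\<Prod>i\<in>I. indicator (B j) (y i)))"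
      by (intro sum_le_suminf) auto
    finally show ?thesis .
  qed simp
  have "(\<integral>\<^sup>+y. indicator {y. \<exists>i\<in>I. real m \<le> real n * F (y i)} y *
      ennreal ((1 - measure \<mu> (ball_union x I y)) ^ (n - 1)) \<partial>PiM I (\<lambda>_. \<mu>)) \<le>
      (\<integral>\<^sup>+y. (\<Sum>j. ennreal (e j) * (\<Prod>i\<in>I. indicator (B j) (y i))) \<partial>PiM I (\<lambda>_. \<mu>))"
    by (intro nn_integral_mono pointwise)
  also have "\<dots> = (\<Sum>j. \<integral>\<^sup>+y. ennreal (e j) * (\<Prod>i\<in>I. indicator (B j) (y i)) \<partial>PiM I (\<lambda>_. \<mu>))"
    by (intro nn_integral_suminf) measurable
  also have "\<dots> = (\<Sum>j. ennreal (e j) * emeasure \<mu> (B j) ^ card I)"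
  proof -
    have "(\<integral>\<^sup>+y. (\<Prod>i\<in>I. indicator (B j) (y i)) \<partial>PiM I (\<lambda>_. \<mu>)) = emeasure \<mu> (B j) ^ card I" for j
      using I by (subst product_nn_integral_prod) auto
    then show ?thesis by (simp add: nn_integral_cmult)
  qed
  \<comment> \<open>The mass of \<open>B j\<close> is at most \<open>s j\<close> for every law, so
    the behaviour of the density far from x does not enter.\<close>
  also have "\<dots> \<le> (\<Sum>j. ennreal (e j) * ennreal (s j) ^ card I)"
    using s unfolding B_def F_def
    by (intro suminf_le mult_left_mono power_mono measure_cball_norm_le \<mu>) auto
  also have "\<dots> = (\<Sum>j. ennreal (e j * s j ^ card I))"
    using s by (simp add: ennreal_power ennreal_mult e_def)
  finally have "ennreal (real n ^ card I) * (\<integral>\<^sup>+y. indicator {y. \<exists>i\<in>I. real m \<le> real n * F (y i)} y *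
      ennreal ((1 - measure \<mu> (ball_union x I y)) ^ (n - 1)) \<partial>PiM I (\<lambda>_. \<mu>)) \<le>
      ennreal (real n ^ card I) * (\<Sum>j. ennreal (e j * s j ^ card I))"
    by (rule mult_left_mono) simp
  also have "\<dots> = (\<Sum>j. ennreal (real n ^ card I * (e j * s j ^ card I)))"
    using s by (subst ennreal_suminf_cmult[symmetric]) (simp add: ennreal_mult e_def)
  also have "\<dots> = (\<Sum>j. ennreal (e j * (real (j + m) + 1) ^ card I))"
    using n by (intro arg_cong[where f = suminf] ext arg_cong[where f = ennreal]) (simp add: s_def power_divide)
  also have "\<dots> = ennreal (\<Sum>j. e j * (real (j + m) + 1) ^ card I)"
  proof (rule suminf_ennreal2)
    show "summable (\<lambda>j. e j * (real (j + m) + 1) ^ card I)"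
      unfolding e_def by (rule summable_ignore_initial_segment[OF summable_exp_shells[OF b]])
  qed (simp add: e_def)
  finally show ?thesis unfolding F_def e_def .
qed

lemma prod_indicator_eq:
  assumes "finite I"
  shows "(\<Prod>i\<in>I. indicator (A i) (u i) :: ennreal) = indicator {w. \<forall>i\<in>I. w i \<in> A i} u"
proof (cases "\<forall>i\<in>I. u i \<in> A i")
  case False
  then have "(\<Prod>i\<in>I. indicator (A i) (u i) :: ennreal) = 0"
    using assms by (intro prod_zero) (auto simp: indicator_def)
  with False show ?thesis by simp
qed simp

lemma prod_indicator_mult_le:
  assumes "finite I"
  shows "(\<Prod>i\<in>I. indicator (A i) (u i)) * (h :: ennreal) \<le> h"
  unfolding prod_indicator_eq[OF assms] by (simp add: indicator_def)

section \<open>Blow-up around a Lebesgue point at the scale n^(-1/d)\<close>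

context
  fixes f :: "'a::euclidean_space \<Rightarrow> real" and \<mu> and x :: 'a and a :: "nat \<Rightarrow> real"
  assumes f_meas[measurable]: "f \<in> borel_measurable borel" and f: "\<And>y. 0 \<le> f y"
    and \<mu>: "\<mu> = density lborel (\<lambda>y. ennreal (f y))" "prob_space \<mu>"
    and lp: "lebesgue_point f x" and fx: "0 < f x"
    and a: "\<And>n. 1 \<le> n \<Longrightarrow> 0 < a n" "\<And>n. 1 \<le> n \<Longrightarrow> a n ^ DIM('a) = 1 / real n" "a \<longlonglongrightarrow> 0"
begin

lemma scaled_emeasure:
  assumes n: "1 \<le> n" and A[measurable]: "A \<in> sets borel"
  shows "ennreal (real n) * emeasure \<mu> A = (\<integral>\<^sup>+v. ennreal (f (x + a n *\<^sub>R v)) * indicator A (x + a n *\<^sub>R v) \<partial>lborel)"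
proof -
  have "emeasure \<mu> A = (\<integral>\<^sup>+y. ennreal (f y) * indicator A y \<partial>lborel)"
    by (simp add: \<mu>(1) emeasure_density)
  also have "\<dots> = ennreal (1 / real n) * (\<integral>\<^sup>+v. ennreal (f (x + a n *\<^sub>R v)) * indicator A (x + a n *\<^sub>R v) \<partial>lborel)"
    using a(1,2)[OF n] by (subst nn_integral_affine[where a = "a n" and x = x]) auto
  finally show ?thesis
    using n by (simp add: mult.assoc[symmetric] ennreal_mult[symmetric])
qed

text \<open>A bounded A lies in some ball of radius R, and on that ball the rescaled density tends
  to f x in L1; the difference is absorbed as an additive perturbation.\<close>

lemma scaled_density_tendsto:
  assumes A[measurable]: "A \<in> sets borel" and bdd: "bounded A"
  shows "(\<lambda>n. \<integral>\<^sup>+v. ennreal (f (x + a n *\<^sub>R v)) * indicator A v \<partial>lborel) \<longlonglongrightarrow> ennreal (f x * measure lborel A)"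
proof -
  obtain R where R: "0 < R" "A \<subseteq> cball 0 R"
    using bdd bounded_pos[of A] by (auto simp: subset_iff)
  have fin: "emeasure lborel A < \<infinity>" using bdd emeasure_bounded_finite by auto
  let ?e = "\<lambda>n. \<integral>\<^sup>+v. ennreal \<bar>f (x + a n *\<^sub>R v) - f x\<bar> * indicator (cball 0 R) v \<partial>lborel"
  have ev: "\<forall>\<^sub>F n in sequentially. 0 < a n"
    using eventually_ge_at_top[of 1] by eventually_elim (rule a(1))
  have *: "(\<integral>\<^sup>+v. ennreal (g v) * indicator A v \<partial>lborel) \<le> (\<integral>\<^sup>+v. ennreal (h v) * indicator A v \<partial>lborel) + ?e n"
    if [measurable]: "g \<in> borel_measurable borel" "h \<in> borel_measurable borel"
      and h: "\<And>v. 0 \<le> h v" and gh: "\<And>v. g v \<le> h v + \<bar>f (x + a n *\<^sub>R v) - f x\<bar>" for g h n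
  proof -
    have "(\<integral>\<^sup>+v. ennreal (g v) * indicator A v \<partial>lborel) \<le>
        (\<integral>\<^sup>+v. ennreal (h v) * indicator A v + ennreal \<bar>f (x + a n *\<^sub>R v) - f x\<bar> * indicator (cball 0 R) v \<partial>lborel)"
    proof (intro nn_integral_mono)
      fix v
      have "ennreal (g v) \<le> ennreal (h v) + ennreal \<bar>f (x + a n *\<^sub>R v) - f x\<bar>"
        using gh[of v] h[of v] by (simp add: ennreal_plus[symmetric] ennreal_leI del: ennreal_plus)
      then show "ennreal (g v) * indicator A v \<le>
          ennreal (h v) * indicator A v + ennreal \<bar>f (x + a n *\<^sub>R v) - f x\<bar> * indicator (cball 0 R) v"
        using R(2) by (cases "v \<in> A") auto
    qed
    also have "\<dots> = (\<integral>\<^sup>+v. ennreal (h v) * indicator A v \<partial>lborel) + ?e n"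
      by (intro nn_integral_add) measurable
    finally show ?thesis .
  qed
  have c: "(\<integral>\<^sup>+v. ennreal (f x) * indicator A v \<partial>lborel) = ennreal (f x * measure lborel A)"
    using fin f by (simp add: nn_integral_cmult emeasure_eq_ennreal_measure ennreal_mult)
  show ?thesis
  proof (rule ennreal_tendsto_perturb[OF _ _ lebesgue_point_tendsto[OF f_meas lp a(3) ev R(1)] tendsto_const])
    show "\<forall>\<^sub>F n in sequentially. (\<integral>\<^sup>+v. ennreal (f (x + a n *\<^sub>R v)) * indicator A v \<partial>lborel) \<le>
        ennreal (f x * measure lborel A) + ?e n"
      unfolding c[symmetric] using f by (intro always_eventually allI *) auto
    show "\<forall>\<^sub>F n in sequentially. ennreal (f x * measure lborel A) \<le>
        (\<integral>\<^sup>+v. ennreal (f (x + a n *\<^sub>R v)) * indicator A v \<partial>lborel) + ?e n"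
      unfolding c[symmetric] using f by (intro always_eventually allI *) auto
  qed simp
qed

lemma scaled_measure_tendsto:
  assumes A: "A \<in> sets borel" "bounded A" and B: "\<And>n. B n \<in> sets borel"
    and BA: "\<And>n v. 1 \<le> n \<Longrightarrow> x + a n *\<^sub>R v \<in> B n \<longleftrightarrow> v \<in> A"
  shows "(\<lambda>n. real n * measure \<mu> (B n)) \<longlonglongrightarrow> f x * measure lborel A"
proof -
  interpret prob_space \<mu> by (rule \<mu>(2))
  have "\<forall>\<^sub>F n in sequentially.
      (\<integral>\<^sup>+v. ennreal (f (x + a n *\<^sub>R v)) * indicator A v \<partial>lborel) = ennreal (real n * measure \<mu> (B n))"
    using eventually_ge_at_top[of 1]
  proof eventually_elim
    case (elim n)
    then show ?case
      using scaled_emeasure[OF elim B[of n]] BA[OF elim]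
      by (simp add: indicator_def emeasure_eq_measure ennreal_mult)
  qed
  from Lim_transform_eventually[OF scaled_density_tendsto[OF A] this]
  show ?thesis using fx by (subst (asm) tendsto_ennreal_iff) auto
qed

text \<open>The configuration scales as a whole: the union at the points x + a n * u i is the affine
  image of the union at the u i. Hence n times its mass tends to f x times a fixed volume, and the
  power becomes an exponential.\<close>

lemma avoidance_tendsto:
  assumes "finite I"
  shows "(\<lambda>n. (1 - measure \<mu> (ball_union x I (\<lambda>i. x + a n *\<^sub>R u i))) ^ (n - 1)) \<longlonglongrightarrow>
    exp (- (f x * measure lborel (ball_union 0 I u)))"
proof (intro one_minus_power_tendsto_exp scaled_measure_tendsto ball_union_borel ball_union_bounded assms)
  fix n :: nat and v assume n: "1 \<le> n"
  have "dist (x + a n *\<^sub>R u i) (x + a n *\<^sub>R v) < norm (x + a n *\<^sub>R u i - x) \<longleftrightarrow> dist (u i) v < norm (u i - 0)" for i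
  proof -
    have "dist (x + a n *\<^sub>R u i) (x + a n *\<^sub>R v) = a n * dist (u i) v"
      using a(1)[OF n] by (simp add: dist_norm scaleR_diff_right[symmetric])
    then show ?thesis using a(1)[OF n] by simp
  qed
  then show "x + a n *\<^sub>R v \<in> ball_union x I (\<lambda>i. x + a n *\<^sub>R u i) \<longleftrightarrow> v \<in> ball_union 0 I u"
    by (simp add: ball_union_def)
qed simp

lemma borel_measurable_avoidance:
  assumes I: "finite I"
  shows "(\<lambda>y. ennreal ((1 - measure \<mu> (ball_union x I y)) ^ n)) \<in> borel_measurable (PiM I (\<lambda>_. borel))"
proof -
  have "(\<lambda>y. measure \<mu> (ball_union x I y)) \<in> borel_measurable (PiM I (\<lambda>_. borel))"
    using \<mu> by (intro borel_measurable_measure_ball_union I prob_space_imp_sigma_finite) auto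
  then show ?thesis by measurable
qed

text \<open>The two limits are separated. As the avoidance factor is at most 1, replacing the
  product of densities by its constant limit costs no more than their L1 distance; with the constant
  in place, dominated convergence handles the avoidance factor.\<close>

lemma avoidance_compact_tendsto:
  fixes I :: "'i set"
  assumes I: "finite I" and R: "0 < R"
  shows "(\<lambda>n. \<integral>\<^sup>+u. (\<Prod>i\<in>I. indicator (cball 0 R) (u i)) * (ennreal (\<Prod>i\<in>I. f (x + a n *\<^sub>R u i)) *
      ennreal ((1 - measure \<mu> (ball_union x I (\<lambda>i. x + a n *\<^sub>R u i))) ^ (n - 1))) \<partial>PiM I (\<lambda>_. lborel)) \<longlonglongrightarrow>
    (\<integral>\<^sup>+u. (\<Prod>i\<in>I. indicator (cball 0 R) (u i)) *
      ennreal (f x ^ card I * exp (- f x * measure lborel (ball_union (0::'a) I u))) \<partial>PiM I (\<lambda>_. lborel))"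
proof -
  interpret prob_space \<mu> by (rule \<mu>(2))
  \<comment> \<open>Restricting Lebesgue measure to the ball absorbs the product of indicators into
    a finite product measure, for which constants are integrable majorants.\<close>
  define N where "N = density lborel (indicator (cball (0::'a) R) :: 'a \<Rightarrow> ennreal)"
  have [measurable_cong]: "sets N = sets borel" by (simp add: N_def)
  have N_fin: "finite_measure N"
  proof
    show "emeasure N (space N) \<noteq> \<infinity>"
      using emeasure_lborel_cball_finite[of "0::'a" R] by (simp add: N_def emeasure_density)
  qed
  interpret N: finite_measure N by (rule N_fin)
  interpret product_sigma_finite "\<lambda>_. N" by standard
  have P_fin: "emeasure (PiM I (\<lambda>_. N)) (space (PiM I (\<lambda>_. N))) < \<infinity>"
    using I by (simp add: space_PiM emeasure_PiM power_less_top_ennreal less_top[symmetric] del: power_eq_top_ennreal_iff)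
       (simp add: power_eq_top_ennreal)
  have PN: "PiM I (\<lambda>_. N) = density (PiM I (\<lambda>_. lborel)) (\<lambda>u. \<Prod>i\<in>I. indicator (cball 0 R) (u i))"
    unfolding N_def
    by (rule PiM_density_sigma_finite[OF I lborel.sigma_finite_measure_axioms N.sigma_finite_measure_axioms[unfolded N_def]])
      measurable
  have s1[measurable_cong]: "sets (PiM I (\<lambda>_. N)) = sets (PiM I (\<lambda>_. borel))"
    by (intro sets_PiM_cong) (auto simp: N_def)
  have s2[measurable_cong]: "sets (PiM I (\<lambda>_. lborel :: 'a measure)) = sets (PiM I (\<lambda>_. borel))"
    by (intro sets_PiM_cong) auto
  define G where "G n u = (1 - measure \<mu> (ball_union x I (\<lambda>i. x + a n *\<^sub>R u i))) ^ (n - 1)" for n and u :: "'i \<Rightarrow> 'a"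
  define p where "p n u = (\<Prod>i\<in>I. f (x + a n *\<^sub>R u i))" for n and u :: "'i \<Rightarrow> 'a"
  define c where "c = f x ^ card I"
  define H where "H u = exp (- f x * measure lborel (ball_union 0 I u))" for u :: "'i \<Rightarrow> 'a"
  have c: "0 \<le> c" using fx by (simp add: c_def)
  have G01: "0 \<le> G n u" "G n u \<le> 1" for n u by (auto simp: G_def intro!: power_le_one)
  have p0: "0 \<le> p n u" for n u using f by (simp add: p_def prod_nonneg)
  have [measurable]: "(\<lambda>u. G n u) \<in> borel_measurable (PiM I (\<lambda>_. borel))" for n
  proof -
    have sc: "(\<lambda>u. \<lambda>i\<in>I. x + a n *\<^sub>R u i) \<in> measurable (PiM I (\<lambda>_. borel)) (PiM I (\<lambda>_. borel :: 'a measure))"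
      by measurable
    have "(\<lambda>y. measure \<mu> (ball_union x I y)) \<in> borel_measurable (PiM I (\<lambda>_. borel))"
      using \<mu>(1) by (intro borel_measurable_measure_ball_union I sigma_finite_measure_axioms) auto
    from measurable_compose[OF sc this]
    have "(\<lambda>u. measure \<mu> (ball_union x I (\<lambda>i\<in>I. x + a n *\<^sub>R u i))) \<in> borel_measurable (PiM I (\<lambda>_. borel))" .
    moreover have "ball_union x I (\<lambda>i\<in>I. x + a n *\<^sub>R u i) = ball_union x I (\<lambda>i. x + a n *\<^sub>R u i)" for u
      by (intro ball_union_cong) simp
    ultimately show ?thesis unfolding G_def by simp
  qed
  have [measurable]: "p n \<in> borel_measurable (PiM I (\<lambda>_. borel))" for n
    unfolding p_def[abs_def] by measurable
  have [measurable]: "H \<in> borel_measurable (PiM I (\<lambda>_. borel))"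
  proof -
    have "(\<lambda>y. measure lborel (ball_union 0 I y)) \<in> borel_measurable (PiM I (\<lambda>_. borel :: 'a measure))"
      by (intro borel_measurable_measure_ball_union I lborel.sigma_finite_measure_axioms) auto
    then show ?thesis unfolding H_def[abs_def] by measurable
  qed
  have to_N: "(\<integral>\<^sup>+u. (\<Prod>i\<in>I. indicator (cball 0 R) (u i)) * h u \<partial>PiM I (\<lambda>_. lborel)) = (\<integral>\<^sup>+u. h u \<partial>PiM I (\<lambda>_. N))"
    if [measurable]: "h \<in> borel_measurable (PiM I (\<lambda>_. borel))" for h
    unfolding PN by (intro nn_integral_density[symmetric]) measurable
  define e where "e n = (\<integral>\<^sup>+u. ennreal \<bar>p n u - c\<bar> \<partial>PiM I (\<lambda>_. N))" for n
  have e: "e \<longlonglongrightarrow> 0"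
    unfolding e_def[abs_def] p_def c_def
  proof (rule product_L1_tendsto[OF N_fin _ f less_imp_le[OF fx] _ I])
    have ev: "\<forall>\<^sub>F n in sequentially. 0 < a n"
      using eventually_ge_at_top[of 1] by eventually_elim (rule a(1))
    show "(\<lambda>n. \<integral>\<^sup>+v. ennreal \<bar>f (x + a n *\<^sub>R v) - f x\<bar> \<partial>N) \<longlonglongrightarrow> 0"
      using lebesgue_point_tendsto[OF f_meas lp a(3) ev R]
      by (simp add: N_def nn_integral_density mult.commute)
  qed measurable
  have lim_G: "(\<lambda>n. \<integral>\<^sup>+u. ennreal (c * G n u) \<partial>PiM I (\<lambda>_. N)) \<longlonglongrightarrow> (\<integral>\<^sup>+u. ennreal (c * H u) \<partial>PiM I (\<lambda>_. N))"
  proof (rule nn_integral_dominated_convergence[where w = "\<lambda>_. ennreal c"])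
    show "AE u in PiM I (\<lambda>_. N). (\<lambda>n. ennreal (c * G n u)) \<longlonglongrightarrow> ennreal (c * H u)"
      using avoidance_tendsto[OF I] unfolding G_def H_def
      by (intro AE_I2 tendsto_ennrealI tendsto_mult tendsto_const) simp
    show "(\<integral>\<^sup>+u. ennreal c \<partial>PiM I (\<lambda>_. N)) < \<infinity>"
      using P_fin by (simp add: ennreal_mult_less_top)
    show "AE u in PiM I (\<lambda>_. N). ennreal (c * G n u) \<le> ennreal c" for n
      using G01 c by (intro AE_I2 ennreal_leI mult_left_le) auto
  qed measurable
  have H_fin: "(\<integral>\<^sup>+u. ennreal (c * H u) \<partial>PiM I (\<lambda>_. N)) < \<infinity>"
  proof (rule le_less_trans)
    show "(\<integral>\<^sup>+u. ennreal (c * H u) \<partial>PiM I (\<lambda>_. N)) \<le> (\<integral>\<^sup>+u. ennreal c \<partial>PiM I (\<lambda>_. N))"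
      using fx c by (intro nn_integral_mono ennreal_leI mult_left_le) (auto simp: H_def)
    show "(\<integral>\<^sup>+u. ennreal c \<partial>PiM I (\<lambda>_. N)) < \<infinity>"
      using P_fin by (simp add: ennreal_mult_less_top)
  qed
  have perturb: "(\<integral>\<^sup>+u. ennreal (g u * G n u) \<partial>PiM I (\<lambda>_. N)) \<le> (\<integral>\<^sup>+u. ennreal (h u * G n u) \<partial>PiM I (\<lambda>_. N)) + e n"
    if [measurable]: "g \<in> borel_measurable (PiM I (\<lambda>_. borel))" "h \<in> borel_measurable (PiM I (\<lambda>_. borel))"
      and h: "\<And>u. 0 \<le> h u" and gh: "\<And>u. g u \<le> h u + \<bar>p n u - c\<bar>" for g h n
  proof -
    have "g u * G n u \<le> h u * G n u + \<bar>p n u - c\<bar>" for u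
    proof -
      have "g u * G n u \<le> (h u + \<bar>p n u - c\<bar>) * G n u" by (intro mult_right_mono gh G01)
      also have "\<dots> \<le> h u * G n u + \<bar>p n u - c\<bar>"
        using G01[of n u] by (simp add: distrib_right mult_left_le)
      finally show ?thesis .
    qed
    then have "(\<integral>\<^sup>+u. ennreal (g u * G n u) \<partial>PiM I (\<lambda>_. N)) \<le>
        (\<integral>\<^sup>+u. ennreal (h u * G n u) + ennreal \<bar>p n u - c\<bar> \<partial>PiM I (\<lambda>_. N))"
      using h G01 by (intro nn_integral_mono) (simp add: ennreal_plus[symmetric] ennreal_leI del: ennreal_plus)
    also have "\<dots> = (\<integral>\<^sup>+u. ennreal (h u * G n u) \<partial>PiM I (\<lambda>_. N)) + e n"
      unfolding e_def by (intro nn_integral_add) measurable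
    finally show ?thesis .
  qed
  have "(\<lambda>n. \<integral>\<^sup>+u. ennreal (p n u * G n u) \<partial>PiM I (\<lambda>_. N)) \<longlonglongrightarrow> (\<integral>\<^sup>+u. ennreal (c * H u) \<partial>PiM I (\<lambda>_. N))"
  proof (rule ennreal_tendsto_perturb[OF _ _ e lim_G H_fin])
    show "\<forall>\<^sub>F n in sequentially. (\<integral>\<^sup>+u. ennreal (p n u * G n u) \<partial>PiM I (\<lambda>_. N)) \<le>
        (\<integral>\<^sup>+u. ennreal (c * G n u) \<partial>PiM I (\<lambda>_. N)) + e n"
      using c by (intro always_eventually allI perturb) auto
    show "\<forall>\<^sub>F n in sequentially. (\<integral>\<^sup>+u. ennreal (c * G n u) \<partial>PiM I (\<lambda>_. N)) \<le>
        (\<integral>\<^sup>+u. ennreal (p n u * G n u) \<partial>PiM I (\<lambda>_. N)) + e n"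
      using p0 by (intro always_eventually allI perturb) auto
  qed
  moreover have "(\<integral>\<^sup>+u. (\<Prod>i\<in>I. indicator (cball 0 R) (u i)) * (ennreal (p n u) * ennreal (G n u)) \<partial>PiM I (\<lambda>_. lborel)) =
      (\<integral>\<^sup>+u. ennreal (p n u * G n u) \<partial>PiM I (\<lambda>_. N))" for n
    using p0 G01 by (subst to_N) (auto simp: ennreal_mult)
  moreover have "(\<integral>\<^sup>+u. (\<Prod>i\<in>I. indicator (cball 0 R) (u i)) * ennreal (c * H u) \<partial>PiM I (\<lambda>_. lborel)) =
      (\<integral>\<^sup>+u. ennreal (c * H u) \<partial>PiM I (\<lambda>_. N))"
    by (rule to_N) measurable
  ultimately have "(\<lambda>n. \<integral>\<^sup>+u. (\<Prod>i\<in>I. indicator (cball 0 R) (u i)) * (ennreal (p n u) * ennreal (G n u))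
        \<partial>PiM I (\<lambda>_. lborel)) \<longlonglongrightarrow>
      (\<integral>\<^sup>+u. (\<Prod>i\<in>I. indicator (cball 0 R) (u i)) * ennreal (c * H u) \<partial>PiM I (\<lambda>_. lborel))"
    by simp
  then show ?thesis unfolding p_def G_def c_def H_def .
qed

text \<open>Bounded regions converge by the local convergence of the density; the shell bound
  controls the rest uniformly in \<open>n\<close>.\<close>

lemma avoidance_tendsto_moment:
  fixes I :: "'i set"
  assumes I: "finite I" "I \<noteq> {}"
    and L_fin: "(\<integral>\<^sup>+u. ennreal (f x ^ card I * exp (- f x * measure lborel (ball_union (0::'a) I u))) \<partial>PiM I (\<lambda>_. lborel)) < \<infinity>"
  shows "(\<lambda>n. ennreal (real n ^ card I) *
      (\<integral>\<^sup>+y. ennreal ((1 - measure \<mu> (ball_union x I y)) ^ (n - 1)) \<partial>PiM I (\<lambda>_. \<mu>))) \<longlonglongrightarrow>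
    (\<integral>\<^sup>+u. ennreal (f x ^ card I * exp (- f x * measure lborel (ball_union (0::'a) I u))) \<partial>PiM I (\<lambda>_. lborel))"
    (is "?J \<longlonglongrightarrow> ?L")
proof -
  interpret prob_space \<mu> by (rule \<mu>(2))
  have sets_\<mu>[measurable_cong]: "sets \<mu> = sets borel" by (simp add: \<mu>(1))
  have [measurable_cong]: "sets (PiM I (\<lambda>_. \<mu>)) = sets (PiM I (\<lambda>_. borel))"
    "sets (PiM I (\<lambda>_. lborel :: 'a measure)) = sets (PiM I (\<lambda>_. borel))"
    by (intro sets_PiM_cong refl sets_\<mu>, intro sets_PiM_cong) auto
  obtain b where b: "0 < b" "\<And>y. b * measure \<mu> (cball x (norm (y - x))) \<le> measure \<mu> (ball y (norm (y - x)))"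
    using lebesgue_point_ball_lower[OF f_meas f lp fx \<mu>] by blast
  define V where "V = measure lborel (cball (0::'a) 1)"
  have V: "0 < V" unfolding V_def by (rule measure_unit_ball_pos)
  define h where "h u = ennreal (f x ^ card I * exp (- f x * measure lborel (ball_union 0 I u)))" for u :: "'i \<Rightarrow> 'a"
  define K where "K R u = (\<Prod>i\<in>I. indicator (cball 0 R) (u i) :: ennreal)" for R :: real and u :: "'i \<Rightarrow> 'a"
  define X where "X R n = (\<integral>\<^sup>+u. K R u * (ennreal (\<Prod>i\<in>I. f (x + a n *\<^sub>R u i)) *
      ennreal ((1 - measure \<mu> (ball_union x I (\<lambda>i. x + a n *\<^sub>R u i))) ^ (n - 1))) \<partial>PiM I (\<lambda>_. lborel))" for R n
  define L where "L R = (\<integral>\<^sup>+u. K R u * h u \<partial>PiM I (\<lambda>_. lborel))" for R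
  define \<tau> where "\<tau> m = (\<Sum>j. exp (- b * real (j + m) / 2) * (real (j + m) + 1) ^ card I)" for m
  define g where "g n y = ennreal ((1 - measure \<mu> (ball_union x I y)) ^ (n - 1))" for n y
  have X_lim: "X R \<longlonglongrightarrow> L R" if "0 < R" for R
    unfolding X_def[abs_def] L_def K_def h_def by (rule avoidance_compact_tendsto[OF I(1) that])
  have [measurable]: "g n \<in> borel_measurable (PiM I (\<lambda>_. borel))" for n
    unfolding g_def[abs_def] by (rule borel_measurable_avoidance[OF I(1)])
  have [measurable]: "h \<in> borel_measurable (PiM I (\<lambda>_. borel))"
  proof -
    have "(\<lambda>y. measure lborel (ball_union 0 I y)) \<in> borel_measurable (PiM I (\<lambda>_. borel :: 'a measure))"
      by (intro borel_measurable_measure_ball_union I lborel.sigma_finite_measure_axioms) auto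
    then show ?thesis unfolding h_def[abs_def] by measurable
  qed
  have [measurable]: "K R \<in> borel_measurable (PiM I (\<lambda>_. borel))" for R
    unfolding K_def[abs_def] by measurable
  \<comment> \<open>Each of the \<open>card I\<close> Jacobians is a n ^ d = 1 / n, so together they
    cancel the factor in front.\<close>
  have inner: "ennreal (real n ^ card I) *
      (\<integral>\<^sup>+y. (\<Prod>i\<in>I. indicator (cball x (a n * R)) (y i)) * g n y \<partial>PiM I (\<lambda>_. \<mu>)) = X R n" if n: "1 \<le> n" for n R
  proof -
    have T: "(\<lambda>v. x + a n *\<^sub>R v) \<in> borel_measurable borel" by measurable
    have lb: "lborel = density (distr lborel borel (\<lambda>v. x + a n *\<^sub>R v)) (\<lambda>_. ennreal (a n ^ DIM('a)))"
      using lborel_affine[of "a n" x] a(1)[OF n] by simp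
    have meas: "(\<lambda>y. (\<Prod>i\<in>I. indicator (cball x (a n * R)) (y i)) * g n y) \<in> borel_measurable (PiM I (\<lambda>_. borel))"
      by measurable
    have "(\<integral>\<^sup>+y. (\<Prod>i\<in>I. indicator (cball x (a n * R)) (y i)) * g n y \<partial>PiM I (\<lambda>_. \<mu>)) =
      (\<integral>\<^sup>+v. (\<Prod>i\<in>I. ennreal (a n ^ DIM('a)) * ennreal (f (x + a n *\<^sub>R v i))) *
        ((\<Prod>i\<in>I. indicator (cball x (a n * R)) ((\<lambda>i\<in>I. x + a n *\<^sub>R v i) i)) * g n (\<lambda>i\<in>I. x + a n *\<^sub>R v i)) \<partial>PiM I (\<lambda>_. lborel))"
      unfolding \<mu>(1) by (rule nn_integral_PiM_change_of_variables[OF I(1) T lb _ _ meas[unfolded \<mu>(1)]]) auto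
    also have "\<dots> = (\<integral>\<^sup>+v. ennreal ((1 / real n) ^ card I) * (K R v * (ennreal (\<Prod>i\<in>I. f (x + a n *\<^sub>R v i)) *
      ennreal ((1 - measure \<mu> (ball_union x I (\<lambda>i. x + a n *\<^sub>R v i))) ^ (n - 1)))) \<partial>PiM I (\<lambda>_. lborel))"
    proof (intro nn_integral_cong)
      fix v :: "'i \<Rightarrow> 'a"
      have "(\<Prod>i\<in>I. ennreal (a n ^ DIM('a)) * ennreal (f (x + a n *\<^sub>R v i))) =
          ennreal ((1 / real n) ^ card I) * ennreal (\<Prod>i\<in>I. f (x + a n *\<^sub>R v i))"
        using f by (simp add: prod.distrib a(2)[OF n] prod_ennreal ennreal_power)
      moreover have "(\<Prod>i\<in>I. indicator (cball x (a n * R)) ((\<lambda>i\<in>I. x + a n *\<^sub>R v i) i)) = K R v"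
        unfolding K_def using a(1)[OF n] by (intro prod.cong) (auto simp: indicator_def dist_norm)
      moreover have "ball_union x I (\<lambda>i\<in>I. x + a n *\<^sub>R v i) = ball_union x I (\<lambda>i. x + a n *\<^sub>R v i)"
        by (intro ball_union_cong) simp
      ultimately show "(\<Prod>i\<in>I. ennreal (a n ^ DIM('a)) * ennreal (f (x + a n *\<^sub>R v i))) *
        ((\<Prod>i\<in>I. indicator (cball x (a n * R)) ((\<lambda>i\<in>I. x + a n *\<^sub>R v i) i)) * g n (\<lambda>i\<in>I. x + a n *\<^sub>R v i)) =
        ennreal ((1 / real n) ^ card I) * (K R v * (ennreal (\<Prod>i\<in>I. f (x + a n *\<^sub>R v i)) *
        ennreal ((1 - measure \<mu> (ball_union x I (\<lambda>i. x + a n *\<^sub>R v i))) ^ (n - 1))))"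
        by (simp add: g_def mult_ac)
    qed
    also have "\<dots> = ennreal ((1 / real n) ^ card I) * X R n"
      unfolding X_def
    proof (rule nn_integral_cmult)
      have sc: "(\<lambda>u. \<lambda>i\<in>I. x + a n *\<^sub>R u i) \<in> measurable (PiM I (\<lambda>_. borel)) (PiM I (\<lambda>_. borel :: 'a measure))"
        by measurable
      have "(\<lambda>v. g n (\<lambda>i\<in>I. x + a n *\<^sub>R v i)) \<in> borel_measurable (PiM I (\<lambda>_. borel))"
        by (rule measurable_compose[OF sc]) measurable
      moreover have "ball_union x I (\<lambda>i\<in>I. x + a n *\<^sub>R v i) = ball_union x I (\<lambda>i. x + a n *\<^sub>R v i)" for v
        by (intro ball_union_cong) simp
      ultimately have [measurable]: "(\<lambda>v. ennreal ((1 - measure \<mu> (ball_union x I (\<lambda>i. x + a n *\<^sub>R v i))) ^ (n - 1)))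
          \<in> borel_measurable (PiM I (\<lambda>_. borel))"
        by (simp add: g_def)
      show "(\<lambda>v. K R v * (ennreal (\<Prod>i\<in>I. f (x + a n *\<^sub>R v i)) *
        ennreal ((1 - measure \<mu> (ball_union x I (\<lambda>i. x + a n *\<^sub>R v i))) ^ (n - 1)))) \<in> borel_measurable (PiM I (\<lambda>_. lborel))"
        by measurable
    qed
    finally show ?thesis
      using n by (simp add: mult.assoc[symmetric] ennreal_mult[symmetric] power_mult_distrib[symmetric])
  qed
  have J_ge: "X R n \<le> ?J n" if "1 \<le> n" for R n
    unfolding inner[OF that, symmetric] g_def[symmetric]
    by (intro mult_left_mono nn_integral_mono prod_indicator_mult_le I) simp
  \<comment> \<open>Once f x * V * R^d exceeds m, the ball of radius a n * R around x eventually has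
    mass above m / n. A configuration with a point outside this ball then belongs to the tail event,
    whose contribution is at most \<open>\<tau> m\<close> for all large n.\<close>
  have J_le: "\<forall>\<^sub>F n in sequentially. ?J n \<le> X R n + ennreal (\<tau> m)" if R: "0 < R" and mR: "real m < f x * (V * R ^ DIM('a))" for R m
  proof -
    have "(\<lambda>n. real n * measure \<mu> (cball x (a n * R))) \<longlonglongrightarrow> f x * measure lborel (cball (0::'a) R)"
    proof (rule scaled_measure_tendsto)
      fix n :: nat and v :: 'a assume "1 \<le> n"
      then show "x + a n *\<^sub>R v \<in> cball x (a n * R) \<longleftrightarrow> v \<in> cball 0 R"
        using a(1)[of n] by (simp add: dist_norm)
    qed auto
    moreover have "measure lborel (cball (0::'a) R) = V * R ^ DIM('a)"
      using emeasure_cball_eq[of R "0::'a"] R V by (simp add: V_def measure_def)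
    ultimately have "\<forall>\<^sub>F n in sequentially. real m < real n * measure \<mu> (cball x (a n * R))"
      using mR by (intro order_tendstoD(1)) auto
    then show ?thesis
      using eventually_ge_at_top[of 2]
    proof eventually_elim
      case (elim n)
      define Z where "Z y = indicator {y. \<exists>i\<in>I. real m \<le> real n * measure \<mu> (cball x (norm (y i - x)))} y * g n y" for y :: "'i \<Rightarrow> 'a"
      have [measurable]: "Z \<in> borel_measurable (PiM I (\<lambda>_. borel))"
      proof -
        note F = measure_cball_norm_measurable[OF sigma_finite_measure_axioms sets_\<mu>, of x]
        have "Measurable.pred (PiM I (\<lambda>_. borel :: 'a measure)) (\<lambda>y. \<exists>i\<in>I. real m \<le> real n * measure \<mu> (cball x (norm (y i - x))))"
        proof (intro pred_intros_finite I)
          fix i assume "i \<in> I"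
          from measurable_compose[OF measurable_component_singleton[OF this, of "\<lambda>_. borel"] F]
          have [measurable]: "(\<lambda>y. measure \<mu> (cball x (norm (y i - x)))) \<in> borel_measurable (PiM I (\<lambda>_. borel))"
            by simp
          show "Measurable.pred (PiM I (\<lambda>_. borel :: 'a measure)) (\<lambda>y. real m \<le> real n * measure \<mu> (cball x (norm (y i - x))))"
            unfolding pred_def by measurable
        qed
        then have "(\<lambda>y. if \<exists>i\<in>I. real m \<le> real n * measure \<mu> (cball x (norm (y i - x))) then 1 else 0 :: ennreal)
            \<in> borel_measurable (PiM I (\<lambda>_. borel :: 'a measure))"
          by (intro measurable_If) auto
        then show ?thesis unfolding Z_def[abs_def] indicator_def of_bool_def mem_Collect_eq
          by (rule borel_measurable_times_ennreal) measurable
      qed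
      have "g n y \<le> (\<Prod>i\<in>I. indicator (cball x (a n * R)) (y i)) * g n y + Z y" for y
      proof (cases "\<forall>i\<in>I. y i \<in> cball x (a n * R)")
        case True
        then have "(\<Prod>i\<in>I. indicator (cball x (a n * R)) (y i)) = (1 :: ennreal)" by (intro prod.neutral) auto
        then show ?thesis by simp
      next
        case False
        then obtain i where i: "i \<in> I" "a n * R < norm (y i - x)"
          by (auto simp: dist_norm norm_minus_commute not_le)
        have "measure \<mu> (cball x (a n * R)) \<le> measure \<mu> (cball x (norm (y i - x)))"
          using i by (intro finite_measure_mono) (auto simp: sets_\<mu>)
        then have "real n * measure \<mu> (cball x (a n * R)) \<le> real n * measure \<mu> (cball x (norm (y i - x)))"
          by (intro mult_left_mono) auto
        with elim(1) i(1) have "Z y = g n y" by (auto simp: Z_def indicator_def intro!: bexI[of _ i])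
        then show ?thesis by simp
      qed
      then have "(\<integral>\<^sup>+y. g n y \<partial>PiM I (\<lambda>_. \<mu>)) \<le>
          (\<integral>\<^sup>+y. (\<Prod>i\<in>I. indicator (cball x (a n * R)) (y i)) * g n y + Z y \<partial>PiM I (\<lambda>_. \<mu>))"
        by (intro nn_integral_mono)
      also have "\<dots> = (\<integral>\<^sup>+y. (\<Prod>i\<in>I. indicator (cball x (a n * R)) (y i)) * g n y \<partial>PiM I (\<lambda>_. \<mu>)) +
          (\<integral>\<^sup>+y. Z y \<partial>PiM I (\<lambda>_. \<mu>))"
        by (intro nn_integral_add) measurable
      finally have "?J n \<le> ennreal (real n ^ card I) *
          ((\<integral>\<^sup>+y. (\<Prod>i\<in>I. indicator (cball x (a n * R)) (y i)) * g n y \<partial>PiM I (\<lambda>_. \<mu>)) + (\<integral>\<^sup>+y. Z y \<partial>PiM I (\<lambda>_. \<mu>)))"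
        unfolding g_def by (rule mult_left_mono) simp
      also have "\<dots> = X R n + ennreal (real n ^ card I) * (\<integral>\<^sup>+y. Z y \<partial>PiM I (\<lambda>_. \<mu>))"
        using elim(2) by (simp add: distrib_left inner)
      also have "\<dots> \<le> X R n + ennreal (\<tau> m)"
        unfolding Z_def g_def \<tau>_def
        by (intro add_left_mono voronoi_moment_tail[OF \<mu>(2) sets_\<mu> b I elim(2)])
      finally show ?case .
    qed
  qed
  have L_mono: "L R \<le> L R'" if "R \<le> R'" for R R'
    unfolding L_def K_def prod_indicator_eq[OF I(1)] using that
    by (intro nn_integral_mono mult_right_mono) (auto simp: indicator_def)
  have L_le: "L R \<le> ?L" for R
    unfolding L_def K_def h_def[symmetric]
    by (intro nn_integral_mono prod_indicator_mult_le I)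
  have L_sup: "?L = (SUP r. L (real r))"
  proof -
    have "h u = (SUP r. K (real r) u * h u)" for u
    proof (rule antisym)
      obtain r where "Max ((\<lambda>i. norm (u i)) ` I) \<le> real r" using real_arch_simple by blast
      then have "\<forall>i\<in>I. norm (u i) \<le> real r" using I by simp
      then have "K (real r) u = 1" unfolding K_def by (intro prod.neutral) auto
      then show "h u \<le> (SUP r. K (real r) u * h u)" by (intro SUP_upper2[of r]) auto
      show "(SUP r. K (real r) u * h u) \<le> h u"
        unfolding K_def by (intro SUP_least prod_indicator_mult_le I)
    qed
    then have "?L = (\<integral>\<^sup>+u. (SUP r. K (real r) u * h u) \<partial>PiM I (\<lambda>_. lborel))"
      unfolding h_def[symmetric] by (intro nn_integral_cong)
    also have "\<dots> = (SUP r. L (real r))"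
      unfolding L_def
    proof (rule nn_integral_monotone_convergence_SUP)
      show "incseq (\<lambda>r u. K (real r) u * h u)"
        unfolding K_def prod_indicator_eq[OF I(1)]
        by (intro incseq_SucI le_funI mult_right_mono) (auto simp: indicator_def)
    qed measurable
    finally show ?thesis .
  qed
  show ?thesis
  proof (rule order_tendstoI)
    fix l assume "l < ?L"
    then obtain r where "l < L (real r)" unfolding L_sup less_SUP_iff by auto
    \<comment> \<open>Passing to the successor makes the radius positive, as \<open>X_lim\<close>
      requires.\<close>
    then have lr: "l < L (real (Suc r))" using L_mono[of "real r" "real (Suc r)"] by (auto intro: less_le_trans)
    have "\<forall>\<^sub>F n in sequentially. l < X (real (Suc r)) n"
      by (rule order_tendstoD(1)[OF X_lim lr]) simp
    then show "\<forall>\<^sub>F n in sequentially. l < ?J n"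
      using eventually_ge_at_top[of 1] by eventually_elim (rule less_le_trans[OF _ J_ge])
  next
    fix l assume l: "?L < l"
    obtain l' where l': "?L < l'" "l' < l" using l dense by blast
    obtain e where e: "0 < e" "?L + ennreal e < l"
    proof -
      obtain p where p: "?L = ennreal p" "0 \<le> p" using L_fin by (cases ?L) auto
      obtain q where q: "l' = ennreal q" "0 \<le> q" using l'(2) by (cases l') auto
      have "p < q" using l'(1) p q by (simp add: ennreal_less_iff)
      then have "?L + ennreal (q - p) = l'" using p q by (simp add: ennreal_plus[symmetric] del: ennreal_plus)
      with \<open>p < q\<close> l'(2) show thesis by (intro that[of "q - p"]) auto
    qed
    \<comment> \<open>The order of choices matters: m makes the tail small uniformly in n, and only
      then R is taken large enough for this m.\<close>
    obtain m where m: "\<tau> m < e"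
    proof -
      obtain m where "norm (\<Sum>j. exp (- b * real (j + m) / 2) * (real (j + m) + 1) ^ card I) < e"
        using suminf_exist_split[OF e(1) summable_exp_shells[OF b(1)]] by blast
      then show thesis by (intro that[of m]) (simp add: \<tau>_def)
    qed
    \<comment> \<open>R exceeds m / (f x * V), and R \<ge> 1 gives R^d \<ge> R, so the required
      inequality holds in every dimension.\<close>
    define R where "R = (real m + 1) / (f x * V) + 1"
    have R: "1 \<le> R" using fx V by (simp add: R_def)
    have "real m < f x * V * R" using fx V by (simp add: R_def field_simps add_pos_pos)
    also have "\<dots> \<le> f x * V * R ^ DIM('a)"
      using fx V R by (intro mult_left_mono self_le_power) auto
    finally have mR: "real m < f x * (V * R ^ DIM('a))" by (simp add: mult.assoc)
    have R0: "0 < R" using R by simp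
    have "(\<lambda>n. X R n + ennreal (\<tau> m)) \<longlonglongrightarrow> L R + ennreal (\<tau> m)"
      by (intro tendsto_add X_lim R0 tendsto_const)
    moreover have "L R + ennreal (\<tau> m) < l"
    proof -
      have "L R + ennreal (\<tau> m) \<le> ?L + ennreal e"
        using m by (intro add_mono L_le ennreal_leI) auto
      also note e(2)
      finally show ?thesis .
    qed
    ultimately have "\<forall>\<^sub>F n in sequentially. X R n + ennreal (\<tau> m) < l" by (rule order_tendstoD(2))
    with J_le[OF R0 mR] show "\<forall>\<^sub>F n in sequentially. ?J n < l"
      by eventually_elim (rule le_less_trans)
  qed
qed

end

subsection \<open>The limit law\<close>

text \<open>The moments are bounded by k!, which is the growth condition for determinacy. Order 0,
  which \<open>has_W_moments\<close> does not list, is supplied by the total mass 1.\<close>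

lemma has_W_moments_unique:
  assumes "has_W_moments i \<nu>1" "has_W_moments i \<nu>2"
  shows "\<nu>1 = \<nu>2"
proof -
  have *: "real_distribution \<nu> \<and> integrable \<nu> (\<lambda>z. \<bar>z\<bar> ^ k) \<and> (\<integral>z. \<bar>z\<bar> ^ k \<partial>\<nu>) \<le> fact k \<and>
      (\<integral>z. z ^ k \<partial>\<nu>) = (if k = 0 then 1 else \<integral>Y. fact k / W i k Y ^ k \<partial>unit_ball_sample k)"
    if "has_W_moments i \<nu>" for \<nu> k
  proof -
    have \<nu>: "real_distribution \<nu>" "AE z in \<nu>. 0 \<le> z"
      using that by (auto simp: has_W_moments_def)
    interpret real_distribution \<nu> by fact
    have "integrable \<nu> (\<lambda>z. z ^ k)" and
      eq: "(\<integral>z. z ^ k \<partial>\<nu>) = (if k = 0 then 1 else \<integral>Y. fact k / W i k Y ^ k \<partial>unit_ball_sample k)"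
      using that prob_space by (cases "k = 0"; auto simp: has_W_moments_def)+
    moreover have "(\<integral>z. z ^ k \<partial>\<nu>) \<le> fact k"
      using W_moment_bounds(2)[of k i] by (simp add: eq)
    ultimately show ?thesis
      using \<nu> AE_nonneg_abs_moment[OF \<nu>(2) events_eq_borel, of k] by simp
  qed
  show ?thesis
    using *[OF assms(1)] *[OF assms(2)] by (intro moments_determine_distribution) auto
qed

text \<open>The limit law is constructed from the sequence at a single point x, so the existence of
  Z is a conclusion here and not an input.\<close>

lemma voronoi_weak_limit:
  fixes \<mu> :: "(real^'d) measure" and f :: "real^'d \<Rightarrow> real"
    and M :: "'a measure" and X :: "nat \<Rightarrow> 'a \<Rightarrow> real^'d" and i :: 'd
  assumes \<mu>: "prob_space \<mu>" and f_meas: "f \<in> borel_measurable borel" and f: "\<And>x. 0 \<le> f x"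
    and \<mu>_eq: "\<mu> = density lborel (\<lambda>x. ennreal (f x))"
    and M: "prob_space M"
    and indep: "prob_space.indep_vars M (\<lambda>_. borel) X {1..}"
    and distr_X: "\<And>j. 1 \<le> j \<Longrightarrow> distr M borel (X j) = \<mu>"
    and lp: "lebesgue_point f x" and fx: "0 < f x"
  obtains \<nu> where "has_W_moments i \<nu>"
    "weak_conv_m (\<lambda>n. distr M borel (\<lambda>\<omega>. real n * measure \<mu> (voronoi_cell n ((\<lambda>j. X j \<omega>)(1 := x)) 1))) \<nu>"
proof -
  interpret M: prob_space M by (rule M)
  interpret \<mu>: prob_space \<mu> by (rule \<mu>)
  have sets_\<mu>: "sets \<mu> = sets borel" by (simp add: \<mu>_eq)
  define Z where "Z n \<omega> = real n * measure \<mu> (voronoi_cell n ((\<lambda>j. X j \<omega>)(1 := x)) 1)" for n \<omega>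
  define D where "D n = distr M borel (Z n)" for n
  define m where "m k = (\<integral>Y. fact k / W i k Y ^ k \<partial>unit_ball_sample k)" for k
  have Z[measurable]: "Z n \<in> borel_measurable M" for n
    unfolding Z_def[abs_def] by (rule voronoi_measure_measurable[OF \<mu> sets_\<mu> M indep distr_X])
  have Z_bounds: "0 \<le> Z n \<omega>" "Z n \<omega> \<le> real n" for n \<omega>
    by (auto simp: Z_def mult_left_le)
  have int_Z: "integrable M (\<lambda>\<omega>. Z n \<omega> ^ k)" for n k
  proof (rule M.integrable_const_bound)
    show "AE \<omega> in M. norm (Z n \<omega> ^ k) \<le> real n ^ k"
      using Z_bounds by (auto intro!: power_mono)
  qed measurable
  have D: "real_distribution (D n)" for n
    unfolding D_def by (rule M.real_distribution_distr) (rule Z)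
  have nn: "AE z in D n. 0 \<le> z" for n
    unfolding D_def using Z_bounds by (subst AE_distr_iff) auto
  have int: "integrable (D n) (\<lambda>z. z ^ k)" for n k
    unfolding D_def using int_Z by (subst integrable_distr_eq) auto
  have moment: "(\<integral>z. z ^ k \<partial>D n) = (\<integral>\<omega>. Z n \<omega> ^ k \<partial>M)" for n k
    unfolding D_def by (subst integral_distr) auto
  \<comment> \<open>At k = 0 the integrand is 1, so the formula gives the right moment and
    \<open>m\<close> can be used for all orders.\<close>
  have m0: "m 0 = 1"
    using prob_space.prob_space[OF prob_space_unit_ball_sample[of 0, where 'd = 'd]] by (simp add: m_def)
  have lim: "(\<lambda>n. \<integral>z. z ^ k \<partial>D n) \<longlonglongrightarrow> m k" for k
  proof (cases "k = 0")
    case True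
    have "(\<integral>z. z ^ k \<partial>D n) = 1" for n
      unfolding moment using True by (simp add: M.prob_space)
    then show ?thesis using True by (simp add: m0)
  next
    case False
    then have k: "1 \<le> k" by simp
    \<comment> \<open>At this scale a ball of radius a n * R has volume proportional to 1 / n, which
      keeps n times its mass near x of order 1.\<close>
    define a where "a n = root DIM(real^'d) (1 / real n)" for n
    have a: "0 < a n" "a n ^ DIM(real^'d) = 1 / real n" if "1 \<le> n" for n
      using that unfolding a_def by (auto simp del: DIM_cart)
    have a_lim: "a \<longlonglongrightarrow> 0"
      unfolding a_def[abs_def] using tendsto_real_root[OF lim_1_over_n, of "DIM(real^'d)"] by simp
    have L: "(\<integral>\<^sup>+u. ennreal (f x ^ card {..<k} * exp (- f x * measure lborel (ball_union (0::real^'d) {..<k} u)))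
        \<partial>PiM {..<k} (\<lambda>_. lborel)) = ennreal (m k)"
      using nn_integral_exp_ball_union[OF k fx, of i] by (simp add: m_def)
    have "(\<lambda>n. ennreal (real n ^ card {..<k}) *
        (\<integral>\<^sup>+y. ennreal ((1 - measure \<mu> (ball_union x {..<k} y)) ^ (n - 1)) \<partial>PiM {..<k} (\<lambda>_. \<mu>))) \<longlonglongrightarrow> ennreal (m k)"
      unfolding L[symmetric]
      by (rule avoidance_tendsto_moment[OF f_meas f \<mu>_eq \<mu> lp fx a a_lim])
        (use k L in \<open>auto simp: lessThan_empty_iff\<close>)
    moreover have "\<forall>\<^sub>F n in sequentially. ennreal (real n ^ card {..<k}) *
        (\<integral>\<^sup>+y. ennreal ((1 - measure \<mu> (ball_union x {..<k} y)) ^ (n - 1)) \<partial>PiM {..<k} (\<lambda>_. \<mu>)) =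
        ennreal (\<integral>z. z ^ k \<partial>D n)"
      using eventually_ge_at_top[of 1]
    proof eventually_elim
      case (elim n)
      have meas: "(\<lambda>\<omega>. measure \<mu> (voronoi_cell n ((\<lambda>j. X j \<omega>)(1 := x)) 1)) \<in> borel_measurable M"
      proof -
        have "(\<lambda>\<omega>. Z n \<omega> / real n) \<in> borel_measurable M" by measurable
        then show ?thesis using elim by (simp add: Z_def)
      qed
      have "(\<integral>\<^sup>+\<omega>. emeasure \<mu> (voronoi_cell n ((\<lambda>j. X j \<omega>)(1 := x)) 1) ^ k \<partial>M) =
          (\<integral>\<^sup>+y. ennreal ((1 - measure \<mu> (ball_union x {..<k} y)) ^ (n - 1)) \<partial>PiM {..<k} (\<lambda>_. \<mu>))"
        by (rule nn_integral_voronoi_power[OF \<mu> sets_\<mu> M indep distr_X elim])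
      then have "ennreal (real n ^ card {..<k}) *
        (\<integral>\<^sup>+y. ennreal ((1 - measure \<mu> (ball_union x {..<k} y)) ^ (n - 1)) \<partial>PiM {..<k} (\<lambda>_. \<mu>)) =
        ennreal (real n ^ k) * (\<integral>\<^sup>+\<omega>. emeasure \<mu> (voronoi_cell n ((\<lambda>j. X j \<omega>)(1 := x)) 1) ^ k \<partial>M)"
        by (simp only: card_lessThan)
      also have "\<dots> = (\<integral>\<^sup>+\<omega>. ennreal (real n ^ k) * ennreal (measure \<mu> (voronoi_cell n ((\<lambda>j. X j \<omega>)(1 := x)) 1) ^ k) \<partial>M)"
        using meas by (subst nn_integral_cmult) (auto simp: \<mu>.emeasure_eq_measure ennreal_power)
      also have "\<dots> = (\<integral>\<^sup>+\<omega>. ennreal (Z n \<omega> ^ k) \<partial>M)"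
        by (simp add: Z_def power_mult_distrib ennreal_mult)
      also have "\<dots> = ennreal (\<integral>z. z ^ k \<partial>D n)"
        unfolding moment using Z_bounds by (intro nn_integral_eq_integral int_Z) auto
      finally show ?case .
    qed
    ultimately have "(\<lambda>n. ennreal (\<integral>z. z ^ k \<partial>D n)) \<longlonglongrightarrow> ennreal (m k)"
      by (rule Lim_transform_eventually)
    moreover have "0 \<le> m k" unfolding m_def
      using W_ge_1[of i k] by (intro integral_nonneg_AE AE_I2 divide_nonneg_nonneg zero_le_power)
        (auto intro: order_trans[OF zero_le_one])
    moreover have "0 \<le> (\<integral>z. z ^ k \<partial>D n)" for n
      unfolding moment using Z_bounds by simp
    ultimately show ?thesis by (subst (asm) tendsto_ennreal_iff) auto
  qed
  have m_le: "m k \<le> fact k" for k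
    using W_moment_bounds(2)[of k i] m0 by (cases "k = 0") (auto simp: m_def)
  obtain \<nu> where \<nu>: "real_distribution \<nu>" "AE z in \<nu>. 0 \<le> z" "\<And>k. integrable \<nu> (\<lambda>z. z ^ k)"
    "\<And>k. (\<integral>z. z ^ k \<partial>\<nu>) = m k" "weak_conv_m D \<nu>"
    using method_of_moments[OF D nn int lim m_le] by blast
  show thesis
  proof (rule that)
    show "has_W_moments i \<nu>"
      using \<nu>(1-4) by (auto simp: has_W_moments_def m_def)
    show "weak_conv_m (\<lambda>n. distr M borel (\<lambda>\<omega>. real n * measure \<mu> (voronoi_cell n ((\<lambda>j. X j \<omega>)(1 := x)) 1))) \<nu>"
      using \<nu>(5) unfolding D_def[abs_def] Z_def[abs_def] .
  qed
qed

theorem theorem2: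
  fixes \<mu> :: "(real^'d) measure" and f :: "real^'d \<Rightarrow> real"
    and M :: "'a measure" and X :: "nat \<Rightarrow> 'a \<Rightarrow> real^'d" and i :: 'd
  assumes "prob_space \<mu>"
    and "f \<in> borel_measurable lborel" and "\<And>x. 0 \<le> f x" and "\<mu> = density lborel (\<lambda>x. ennreal (f x))"
    and "prob_space M"
    and "prob_space.indep_vars M (\<lambda>_. borel) X {1..}"
    and "\<And>j. 1 \<le> j \<Longrightarrow> distr M borel (X j) = \<mu>"
  shows "(\<exists>!\<nu>. has_W_moments i \<nu>) \<and>
    (\<forall>\<nu>. has_W_moments i \<nu> \<longrightarrow>
      (AE x in \<mu>.
        weak_conv_m
          (\<lambda>n. distr M borel
            (\<lambda>\<omega>. real n * measure \<mu> (voronoi_cell n ((\<lambda>j. X j \<omega>)(1 := x)) 1)))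
          \<nu>))"
proof -
  interpret \<mu>: prob_space \<mu> by fact
  have f_meas: "f \<in> borel_measurable borel" using assms(2) by simp
  have fin: "(\<integral>\<^sup>+x. f x \<partial>lborel) < \<infinity>"
    using \<mu>.emeasure_space_1 assms(2) by (simp add: assms(4) emeasure_density)
  \<comment> \<open>Lebesgue null sets are null for \<open>\<mu>\<close>, and so is the set where
    the density vanishes.\<close>
  have good: "AE x in \<mu>. lebesgue_point f x \<and> 0 < f x"
    using AE_lebesgue_point[OF f_meas assms(3) fin] assms(2)
    unfolding assms(4) by (subst AE_density) (auto elim!: eventually_mono)
  have limit: "\<exists>\<nu>. has_W_moments i \<nu> \<and>
      weak_conv_m (\<lambda>n. distr M borel (\<lambda>\<omega>. real n * measure \<mu> (voronoi_cell n ((\<lambda>j. X j \<omega>)(1 := x)) 1))) \<nu>"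
    if "lebesgue_point f x" "0 < f x" for x
    by (rule voronoi_weak_limit[OF assms(1) f_meas assms(3-6) _ that, where i = i])
      (rule assms(7), assumption, intro exI conjI)
  \<comment> \<open>A set of full measure under a probability is nonempty; one good point already
    yields a law with the required moments.\<close>
  obtain x where "lebesgue_point f x" "0 < f x"
    using eventually_happens'[OF \<mu>.ae_filter_bot good] by blast
  then have ex: "\<exists>\<nu>. has_W_moments i \<nu>" using limit by blast
  moreover have "AE x in \<mu>. weak_conv_m (\<lambda>n. distr M borel
      (\<lambda>\<omega>. real n * measure \<mu> (voronoi_cell n ((\<lambda>j. X j \<omega>)(1 := x)) 1))) \<nu>" if "has_W_moments i \<nu>" for \<nu>
    using good
  proof eventually_elim
    case (elim x)
    \<comment> \<open>The limit law found at x could depend on x; uniqueness identifies it with the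
      given \<open>\<nu>\<close>.\<close>
    then show ?case using limit[of x] has_W_moments_unique[OF that] by blast
  qed
  ultimately show ?thesis using has_W_moments_unique by blast
qed

end
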